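(* Let $\mathbb{D}$ be a pointed derivator. Then $\mathbb{D}$ is also strongly pointed.
   Context: $\mathsf{Cat}$ is the 2-category of small categories, $\mathsf{CAT}$ that of not necessarily small categories, $e$ the terminal category. A prederivator is a strict 2-functor $\mathbb{D}\colon\mathsf{Cat}^{op}\to\mathsf{CAT}$ (contravariant on functors, covariant on natural transformations). Write $u^\ast=\mathbb{D}(u)\colon\mathbb{D}(K)\to\mathbb{D}(J)$ for $u\colon J\to K$, and $\alpha^\ast=\mathbb{D}(\alpha)$. For $k\in K$, viewed as $k\colon e\to K$, write $X_k=k^\ast X\in\mathbb{D}(e)$, $f_k=k^\ast f$. $\mathbb{D}$ is a derivator if: (Der1) for all $J_1,J_2$ the functor $\mathbb{D}(J_1\sqcup J_2)\to\mathbb{D}(J_1)\times\mathbb{D}(J_2)$ induced by the inclusions is an equivalence, and $\mathbb{D}(\emptyset)$ is not the empty category; (Der2) a morphism $f$ in $\mathbb{D}(J)$ is an isomorphism iff $f_j$ is an isomorphism in $\mathbb{D}(e)$ for all $j\in J$; (Der3) every $u^\ast$ has a left adjoint $u_!$ and a right adjoint $u_\ast$ (homotopy left/right Kan extension); (Der4) for $u\colon J\to K$ and $k\in K$ let $J_{/k}$ be the category of pairs $(j,f\colon u(j)\to k)$ and $J_{k/}$ that of pairs $(j,f\colon k\to u(j))$, with projections $\mathrm{pr}$ to $J$ and $p$ to $e$, and let $\alpha\colon u\circ\mathrm{pr}\to k\circ p$, resp. $\alpha\colon k\circ p\to u\circ\mathrm{pr}$, be the transformation with components $f$. Then the maps $p_!\mathrm{pr}^\ast\xrightarrow{\eta}p_!\mathrm{pr}^\ast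 u^\ast u_!\xrightarrow{\alpha^\ast}p_!p^\ast k^\ast u_!\xrightarrow{\epsilon}k^\ast u_!$ and $k^\ast u_\ast\xrightarrow{\eta}p_\ast p^\ast k^\ast u_\ast\xrightarrow{\alpha^\ast}p_\ast\mathrm{pr}^\ast u^\ast u_\ast\xrightarrow{\epsilon}p_\ast\mathrm{pr}^\ast$ are isomorphisms. A derivator $\mathbb{D}$ is pointed if the category $\mathbb{D}(e)$ has a zero object. A fully faithful functor $u\colon J\to K$ that is injective on objects is a cosieve if, whenever there is a morphism $u(j)\to k$ in $K$, $k$ lies in the image of $u$; it is a sieve if, whenever there is a morphism $k\to u(j)$ in $K$, $k$ lies in the image of $u$. A derivator $\mathbb{D}$ is strongly pointed if (i) for every sieve $j\colon J\to K$ the functor $j_\ast\colon\mathbb{D}(J)\to\mathbb{D}(K)$ has a right adjoint $j^!$, and (ii) for every cosieve $i\colon J\to K$ the functor $i_!\colon\mathbb{D}(J)\to\mathbb{D}(K)$ has a left adjoint $i^?$. *)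

theory Defs
  imports "HOL-Library.FuncSet" "HOL-Library.Equipollence"
begin

section \<open>Categories, functors, natural transformations\<close>

text \<open>
  All structure maps are extensional (equal to \<^const>\<open>undefined\<close> off their domains), so
  that equality of HOL values is equality of the categories, functors and transformations they
  encode.  Strict 2-functoriality is an equation between such values.
\<close>

record ('o, 'a) cat =
  Obj :: "'o set"
  Arr :: "'a set"
  Dom :: "'a \<Rightarrow> 'o"
  Cod :: "'a \<Rightarrow> 'o"
  Ide :: "'o \<Rightarrow> 'a"
  Cmp :: "'a \<Rightarrow> 'a \<Rightarrow> 'a"  \<comment> \<open>\<open>Cmp C g f\<close> is \<open>g\<close> after \<open>f\<close>\<close>

definition hom :: "('o, 'a) cat \<Rightarrow> 'o \<Rightarrow> 'o \<Rightarrow> 'a set" where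
  "hom C x y = {f \<in> Arr C. Dom C f = x \<and> Cod C f = y}"

definition category :: "('o, 'a) cat \<Rightarrow> bool" where
  "category C \<longleftrightarrow>
     Dom C \<in> Arr C \<rightarrow>\<^sub>E Obj C \<and>
     Cod C \<in> Arr C \<rightarrow>\<^sub>E Obj C \<and>
     Ide C \<in> Obj C \<rightarrow>\<^sub>E Arr C \<and>
     (\<forall>x \<in> Obj C. Ide C x \<in> hom C x x) \<and>
     (\<forall>x y z. \<forall>f \<in> hom C x y. \<forall>g \<in> hom C y z. Cmp C g f \<in> hom C x z) \<and>
     (\<forall>x y. \<forall>f \<in> hom C x y. Cmp C (Ide C y) f = f \<and> Cmp C f (Ide C x) = f) \<and>
     (\<forall>w x y z. \<forall>f \<in> hom C w x. \<forall>g \<in> hom C x y. \<forall>h \<in> hom C y z.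
        Cmp C h (Cmp C g f) = Cmp C (Cmp C h g) f) \<and>
     (\<forall>g f. \<not> (f \<in> Arr C \<and> g \<in> Arr C \<and> Dom C g = Cod C f) \<longrightarrow> Cmp C g f = undefined)"

definition iso :: "('o, 'a) cat \<Rightarrow> 'a \<Rightarrow> bool" where
  "iso C f \<longleftrightarrow> f \<in> Arr C \<and>
     (\<exists>g \<in> hom C (Cod C f) (Dom C f).
        Cmp C g f = Ide C (Dom C f) \<and> Cmp C f g = Ide C (Cod C f))"

definition zero_object :: "('o, 'a) cat \<Rightarrow> 'o \<Rightarrow> bool" where
  "zero_object C z \<longleftrightarrow> z \<in> Obj C \<and>
     (\<forall>x \<in> Obj C. (\<exists>!f. f \<in> hom C z x) \<and> (\<exists>!f. f \<in> hom C x z))"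

record ('o, 'a, 'p, 'b) func =
  FSrc :: "('o, 'a) cat"
  FTgt :: "('p, 'b) cat"
  FObj :: "'o \<Rightarrow> 'p"
  FArr :: "'a \<Rightarrow> 'b"

definition is_functor :: "('o, 'a, 'p, 'b) func \<Rightarrow> bool" where
  "is_functor F \<longleftrightarrow>
     category (FSrc F) \<and> category (FTgt F) \<and>
     FObj F \<in> Obj (FSrc F) \<rightarrow>\<^sub>E Obj (FTgt F) \<and>
     FArr F \<in> Arr (FSrc F) \<rightarrow>\<^sub>E Arr (FTgt F) \<and>
     (\<forall>x y. \<forall>f \<in> hom (FSrc F) x y. FArr F f \<in> hom (FTgt F) (FObj F x) (FObj F y)) \<and>
     (\<forall>x \<in> Obj (FSrc F). FArr F (Ide (FSrc F) x) = Ide (FTgt F) (FObj F x)) \<and>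
     (\<forall>x y z. \<forall>f \<in> hom (FSrc F) x y. \<forall>g \<in> hom (FSrc F) y z.
        FArr F (Cmp (FSrc F) g f) = Cmp (FTgt F) (FArr F g) (FArr F f))"

definition functor_between ::
  "('o, 'a, 'p, 'b) func \<Rightarrow> ('o, 'a) cat \<Rightarrow> ('p, 'b) cat \<Rightarrow> bool" where
  "functor_between F C D \<longleftrightarrow> is_functor F \<and> FSrc F = C \<and> FTgt F = D"

definition id_func :: "('o, 'a) cat \<Rightarrow> ('o, 'a, 'o, 'a) func" where
  "id_func C = \<lparr>FSrc = C, FTgt = C, FObj = (\<lambda>x \<in> Obj C. x), FArr = (\<lambda>f \<in> Arr C. f)\<rparr>"

definition comp_func ::
  "('p, 'b, 'q, 'c) func \<Rightarrow> ('o, 'a, 'p, 'b) func \<Rightarrow> ('o, 'a, 'q, 'c) func"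
  (infixl "\<circ>\<^sub>F" 55) where
  "G \<circ>\<^sub>F F = \<lparr>FSrc = FSrc F, FTgt = FTgt G,
     FObj = compose (Obj (FSrc F)) (FObj G) (FObj F),
     FArr = compose (Arr (FSrc F)) (FArr G) (FArr F)\<rparr>"

record ('o, 'a, 'p, 'b) nat_transf =
  NSrc :: "('o, 'a, 'p, 'b) func"
  NTgt :: "('o, 'a, 'p, 'b) func"
  NCmp :: "'o \<Rightarrow> 'b"

definition is_nat :: "('o, 'a, 'p, 'b) nat_transf \<Rightarrow> bool" where
  "is_nat \<alpha> \<longleftrightarrow>
     (let F = NSrc \<alpha>; G = NTgt \<alpha>; C = FSrc F; D = FTgt F in
        functor_between F C D \<and> functor_between G C D \<and>
        NCmp \<alpha> \<in> extensional (Obj C) \<and>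
        (\<forall>x \<in> Obj C. NCmp \<alpha> x \<in> hom D (FObj F x) (FObj G x)) \<and>
        (\<forall>x y. \<forall>f \<in> hom C x y.
           Cmp D (NCmp \<alpha> y) (FArr F f) = Cmp D (FArr G f) (NCmp \<alpha> x)))"

definition nat_between ::
  "('o, 'a, 'p, 'b) nat_transf \<Rightarrow> ('o, 'a, 'p, 'b) func \<Rightarrow> ('o, 'a, 'p, 'b) func \<Rightarrow> bool" where
  "nat_between \<alpha> F G \<longleftrightarrow> is_nat \<alpha> \<and> NSrc \<alpha> = F \<and> NTgt \<alpha> = G"

definition is_nat_iso :: "('o, 'a, 'p, 'b) nat_transf \<Rightarrow> bool" where
  "is_nat_iso \<alpha> \<longleftrightarrow> is_nat \<alpha> \<and> (\<forall>x \<in> Obj (FSrc (NSrc \<alpha>)). iso (FTgt (NSrc \<alpha>)) (NCmp \<alpha> x))"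

definition id_nat :: "('o, 'a, 'p, 'b) func \<Rightarrow> ('o, 'a, 'p, 'b) nat_transf" where
  "id_nat F = \<lparr>NSrc = F, NTgt = F, NCmp = (\<lambda>x \<in> Obj (FSrc F). Ide (FTgt F) (FObj F x))\<rparr>"

text \<open>Vertical composition (\<open>\<beta>\<close> after \<open>\<alpha>\<close>), horizontal composition and whiskering.\<close>

definition vcomp ::
  "('o, 'a, 'p, 'b) nat_transf \<Rightarrow> ('o, 'a, 'p, 'b) nat_transf \<Rightarrow> ('o, 'a, 'p, 'b) nat_transf"
  (infixl "\<bullet>" 55) where
  "\<beta> \<bullet> \<alpha> = \<lparr>NSrc = NSrc \<alpha>, NTgt = NTgt \<beta>,
     NCmp = (\<lambda>x \<in> Obj (FSrc (NSrc \<alpha>)). Cmp (FTgt (NSrc \<alpha>)) (NCmp \<beta> x) (NCmp \<alpha> x))\<rparr>"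

definition hcomp ::
  "('p, 'b, 'q, 'c) nat_transf \<Rightarrow> ('o, 'a, 'p, 'b) nat_transf \<Rightarrow> ('o, 'a, 'q, 'c) nat_transf"
  (infixr "\<star>" 60) where
  "\<beta> \<star> \<alpha> = \<lparr>NSrc = NSrc \<beta> \<circ>\<^sub>F NSrc \<alpha>, NTgt = NTgt \<beta> \<circ>\<^sub>F NTgt \<alpha>,
     NCmp = (\<lambda>x \<in> Obj (FSrc (NSrc \<alpha>)).
       Cmp (FTgt (NSrc \<beta>)) (FArr (NTgt \<beta>) (NCmp \<alpha> x)) (NCmp \<beta> (FObj (NSrc \<alpha>) x)))\<rparr>"

definition whisker_left ::
  "('p, 'b, 'q, 'c) func \<Rightarrow> ('o, 'a, 'p, 'b) nat_transf \<Rightarrow> ('o, 'a, 'q, 'c) nat_transf"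
  (infixr "\<rhd>" 60) where
  "F \<rhd> \<alpha> = id_nat F \<star> \<alpha>"

definition whisker_right ::
  "('p, 'b, 'q, 'c) nat_transf \<Rightarrow> ('o, 'a, 'p, 'b) func \<Rightarrow> ('o, 'a, 'q, 'c) nat_transf"
  (infixr "\<lhd>" 60) where
  "\<alpha> \<lhd> F = \<alpha> \<star> id_nat F"

text \<open>\<open>F\<close> is left adjoint to \<open>G\<close> with unit \<open>\<eta>\<close> and counit \<open>\<epsilon>\<close>.\<close>

definition adjunction ::
  "('o, 'a, 'p, 'b) func \<Rightarrow> ('p, 'b, 'o, 'a) func \<Rightarrow>
   ('o, 'a, 'o, 'a) nat_transf \<Rightarrow> ('p, 'b, 'p, 'b) nat_transf \<Rightarrow> bool" where
  "adjunction F G \<eta> \<epsilon> \<longleftrightarrow>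
     functor_between F (FSrc F) (FTgt F) \<and> functor_between G (FTgt F) (FSrc F) \<and>
     nat_between \<eta> (id_func (FSrc F)) (G \<circ>\<^sub>F F) \<and>
     nat_between \<epsilon> (F \<circ>\<^sub>F G) (id_func (FTgt F)) \<and>
     (\<epsilon> \<lhd> F) \<bullet> (F \<rhd> \<eta>) = id_nat F \<and>
     (G \<rhd> \<epsilon>) \<bullet> (\<eta> \<lhd> G) = id_nat G"

definition left_adjoint :: "('o, 'a, 'p, 'b) func \<Rightarrow> ('p, 'b, 'o, 'a) func \<Rightarrow> bool" where
  "left_adjoint F G \<longleftrightarrow> (\<exists>\<eta> \<epsilon>. adjunction F G \<eta> \<epsilon>)"

definition is_equivalence :: "('o, 'a, 'p, 'b) func \<Rightarrow> bool" where
  "is_equivalence F \<longleftrightarrow>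
     is_functor F \<and>
     (\<exists>G \<alpha> \<beta>. functor_between G (FTgt F) (FSrc F) \<and>
        is_nat_iso \<alpha> \<and> nat_between \<alpha> (id_func (FSrc F)) (G \<circ>\<^sub>F F) \<and>
        is_nat_iso \<beta> \<and> nat_between \<beta> (F \<circ>\<^sub>F G) (id_func (FTgt F)))"

definition prod_cat :: "('o, 'a) cat \<Rightarrow> ('p, 'b) cat \<Rightarrow> ('o \<times> 'p, 'a \<times> 'b) cat" where
  "prod_cat C D = \<lparr>
     Obj = Obj C \<times> Obj D,
     Arr = Arr C \<times> Arr D,
     Dom = (\<lambda>f \<in> Arr C \<times> Arr D. (Dom C (fst f), Dom D (snd f))),
     Cod = (\<lambda>f \<in> Arr C \<times> Arr D. (Cod C (fst f), Cod D (snd f))),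
     Ide = (\<lambda>x \<in> Obj C \<times> Obj D. (Ide C (fst x), Ide D (snd x))),
     Cmp = (\<lambda>g f. if f \<in> Arr C \<times> Arr D \<and> g \<in> Arr C \<times> Arr D \<and>
                      Dom C (fst g) = Cod C (fst f) \<and> Dom D (snd g) = Cod D (snd f)
                   then (Cmp C (fst g) (fst f), Cmp D (snd g) (snd f)) else undefined)\<rparr>"

definition pair_func ::
  "('o, 'a, 'p, 'b) func \<Rightarrow> ('o, 'a, 'q, 'c) func \<Rightarrow> ('o, 'a, 'p \<times> 'q, 'b \<times> 'c) func" where
  "pair_func F G = \<lparr>FSrc = FSrc F, FTgt = prod_cat (FTgt F) (FTgt G),
     FObj = (\<lambda>x \<in> Obj (FSrc F). (FObj F x, FObj G x)),
     FArr = (\<lambda>f \<in> Arr (FSrc F). (FArr F f, FArr G f))\<rparr>"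


section \<open>Small categories\<close>

text \<open>
  The universe is an arbitrary infinite type \<open>'u\<close>: a set is small if it is a set of elements of
  \<open>'u\<close> of cardinality strictly less than that of \<open>'u\<close>.  If \<open>'u\<close> is (the type of elements of) an
  uncountable Grothendieck universe, which has inaccessible cardinality \<open>\<kappa>\<close>, its elements are
  exactly its subsets of cardinality less than \<open>\<kappa>\<close>, so this is smallness in the usual sense.
  Only closure under finite products and sums is needed to form the categories below, and every
  infinite \<open>'u\<close> provides that.
\<close>

type_synonym 'u scat = "('u, 'u) cat"
type_synonym 'u sfunc = "('u, 'u, 'u, 'u) func"
type_synonym 'u snat = "('u, 'u, 'u, 'u) nat_transf"

definition small_cat :: "'u scat \<Rightarrow> bool" where
  "small_cat J \<longleftrightarrow> category J \<and> Obj J \<prec> (UNIV :: 'u set) \<and> Arr J \<prec> (UNIV :: 'u set)"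

definition small_func :: "'u sfunc \<Rightarrow> 'u scat \<Rightarrow> 'u scat \<Rightarrow> bool" where
  "small_func u J K \<longleftrightarrow> small_cat J \<and> small_cat K \<and> functor_between u J K"

text \<open>
  Ordered pairs and two distinct tags inside \<open>'u\<close>.  For infinite \<open>'u\<close> there are injections
  \<open>'u \<times> 'u \<Rightarrow> 'u\<close> and \<open>bool \<Rightarrow> 'u\<close>; any choice will do.
\<close>

definition upair :: "'u \<Rightarrow> 'u \<Rightarrow> 'u" where
  "upair x y = (SOME c :: 'u \<times> 'u \<Rightarrow> 'u. inj c) (x, y)"

definition ufst :: "'u \<Rightarrow> 'u" where
  "ufst z = (THE x. \<exists>y. z = upair x y)"

definition usnd :: "'u \<Rightarrow> 'u" where
  "usnd z = (THE y. \<exists>x. z = upair x y)"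

definition utag :: "bool \<Rightarrow> 'u" where
  "utag = (SOME c. inj c)"

definition empty_cat :: "'u scat" where
  "empty_cat = \<lparr>Obj = {}, Arr = {}, Dom = (\<lambda>_. undefined), Cod = (\<lambda>_. undefined),
     Ide = (\<lambda>_. undefined), Cmp = (\<lambda>_ _. undefined)\<rparr>"

text \<open>
  The terminal category \<open>e\<close>.  Its only object and its only arrow are both the element
  \<^const>\<open>undefined\<close> of \<open>'u\<close>; this makes all its structure maps constant and extensional.
\<close>

definition term_cat :: "'u scat" where
  "term_cat = \<lparr>Obj = {undefined}, Arr = {undefined}, Dom = (\<lambda>_. undefined),
     Cod = (\<lambda>_. undefined), Ide = (\<lambda>_. undefined), Cmp = (\<lambda>_ _. undefined)\<rparr>"

definition to_term :: "'u scat \<Rightarrow> 'u sfunc" where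
  "to_term J = \<lparr>FSrc = J, FTgt = term_cat, FObj = (\<lambda>_. undefined), FArr = (\<lambda>_. undefined)\<rparr>"

definition point :: "'u scat \<Rightarrow> 'u \<Rightarrow> 'u sfunc" where
  "point K k = \<lparr>FSrc = term_cat, FTgt = K,
     FObj = (\<lambda>x \<in> Obj term_cat. k), FArr = (\<lambda>f \<in> Arr term_cat. Ide K k)\<rparr>"

text \<open>The coproduct of \<open>J\<close> and \<open>K\<close>; objects and arrows are tagged by their summand.\<close>

definition coprod_cat :: "'u scat \<Rightarrow> 'u scat \<Rightarrow> 'u scat" where
  "coprod_cat J K =
    (let S = (\<lambda>b. if b then J else K);
         Ob = {upair (utag b) x | b x. x \<in> Obj (S b)};
         Ar = {upair (utag b) f | b f. f \<in> Arr (S b)};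
         summand = (\<lambda>z. S (ufst z = utag True))
     in \<lparr>Obj = Ob,
         Arr = Ar,
         Dom = (\<lambda>f \<in> Ar. upair (ufst f) (Dom (summand f) (usnd f))),
         Cod = (\<lambda>f \<in> Ar. upair (ufst f) (Cod (summand f) (usnd f))),
         Ide = (\<lambda>x \<in> Ob. upair (ufst x) (Ide (summand x) (usnd x))),
         Cmp = (\<lambda>g f. if f \<in> Ar \<and> g \<in> Ar \<and> ufst f = ufst g \<and>
                          Dom (summand g) (usnd g) = Cod (summand f) (usnd f)
                       then upair (ufst f) (Cmp (summand f) (usnd g) (usnd f))
                       else undefined)\<rparr>)"

definition coprod_in1 :: "'u scat \<Rightarrow> 'u scat \<Rightarrow> 'u sfunc" where
  "coprod_in1 J K = \<lparr>FSrc = J, FTgt = coprod_cat J K,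
     FObj = (\<lambda>x \<in> Obj J. upair (utag True) x), FArr = (\<lambda>f \<in> Arr J. upair (utag True) f)\<rparr>"

definition coprod_in2 :: "'u scat \<Rightarrow> 'u scat \<Rightarrow> 'u sfunc" where
  "coprod_in2 J K = \<lparr>FSrc = K, FTgt = coprod_cat J K,
     FObj = (\<lambda>x \<in> Obj K. upair (utag False) x), FArr = (\<lambda>f \<in> Arr K. upair (utag False) f)\<rparr>"

text \<open>
  The slice categories \<open>J\<^sub>/\<^sub>k\<close> and \<open>J\<^sub>k\<^sub>/\<close> of a functor \<open>u : J \<rightarrow> K\<close>.  Objects are pairs
  \<open>\<langle>j, f\<rangle>\<close>; an arrow \<open>h : \<langle>j, f\<rangle> \<rightarrow> \<langle>j', f'\<rangle>\<close> is stored as \<open>\<langle>\<langle>\<langle>j, f\<rangle>, \<langle>j', f'\<rangle>\<rangle>, h\<rangle>\<close>, so that it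
  determines its domain and codomain.  \<open>pairs_cat J Ob R\<close> is the category with such objects
  and arrows, where \<open>R\<close> singles out the admissible \<open>h\<close>.
\<close>

definition pairs_cat :: "'u scat \<Rightarrow> 'u set \<Rightarrow> ('u \<Rightarrow> 'u \<Rightarrow> 'u \<Rightarrow> bool) \<Rightarrow> 'u scat" where
  "pairs_cat J Ob R =
    (let Ar = {upair (upair x y) h | x y h. x \<in> Ob \<and> y \<in> Ob \<and> h \<in> hom J (ufst x) (ufst y) \<and>
                 R (usnd x) (usnd y) h}
     in \<lparr>Obj = Ob,
         Arr = Ar,
         Dom = (\<lambda>a \<in> Ar. ufst (ufst a)),
         Cod = (\<lambda>a \<in> Ar. usnd (ufst a)),
         Ide = (\<lambda>x \<in> Ob. upair (upair x x) (Ide J (ufst x))),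
         Cmp = (\<lambda>b a. if a \<in> Ar \<and> b \<in> Ar \<and> ufst (ufst b) = usnd (ufst a)
                       then upair (upair (ufst (ufst a)) (usnd (ufst b)))
                                  (Cmp J (usnd b) (usnd a))
                       else undefined)\<rparr>)"

definition slice :: "'u sfunc \<Rightarrow> 'u \<Rightarrow> 'u scat" where
  "slice u k = pairs_cat (FSrc u)
     {upair j f | j f. j \<in> Obj (FSrc u) \<and> f \<in> hom (FTgt u) (FObj u j) k}
     (\<lambda>f f' h. Cmp (FTgt u) f' (FArr u h) = f)"

definition coslice :: "'u sfunc \<Rightarrow> 'u \<Rightarrow> 'u scat" where
  "coslice u k = pairs_cat (FSrc u)
     {upair j f | j f. j \<in> Obj (FSrc u) \<and> f \<in> hom (FTgt u) k (FObj u j)}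
     (\<lambda>f f' h. Cmp (FTgt u) (FArr u h) f = f')"

definition slice_pr :: "'u sfunc \<Rightarrow> 'u \<Rightarrow> 'u sfunc" where
  "slice_pr u k = \<lparr>FSrc = slice u k, FTgt = FSrc u,
     FObj = (\<lambda>x \<in> Obj (slice u k). ufst x), FArr = (\<lambda>a \<in> Arr (slice u k). usnd a)\<rparr>"

definition coslice_pr :: "'u sfunc \<Rightarrow> 'u \<Rightarrow> 'u sfunc" where
  "coslice_pr u k = \<lparr>FSrc = coslice u k, FTgt = FSrc u,
     FObj = (\<lambda>x \<in> Obj (coslice u k). ufst x), FArr = (\<lambda>a \<in> Arr (coslice u k). usnd a)\<rparr>"

definition slice_nat :: "'u sfunc \<Rightarrow> 'u \<Rightarrow> 'u snat" where
  "slice_nat u k = \<lparr>NSrc = u \<circ>\<^sub>F slice_pr u k,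
     NTgt = point (FTgt u) k \<circ>\<^sub>F to_term (slice u k),
     NCmp = (\<lambda>x \<in> Obj (slice u k). usnd x)\<rparr>"

definition coslice_nat :: "'u sfunc \<Rightarrow> 'u \<Rightarrow> 'u snat" where
  "coslice_nat u k = \<lparr>NSrc = point (FTgt u) k \<circ>\<^sub>F to_term (coslice u k),
     NTgt = u \<circ>\<^sub>F coslice_pr u k,
     NCmp = (\<lambda>x \<in> Obj (coslice u k). usnd x)\<rparr>"

definition fully_faithful :: "('o, 'a, 'p, 'b) func \<Rightarrow> bool" where
  "fully_faithful F \<longleftrightarrow> is_functor F \<and>
     (\<forall>x \<in> Obj (FSrc F). \<forall>y \<in> Obj (FSrc F).
        bij_betw (FArr F) (hom (FSrc F) x y) (hom (FTgt F) (FObj F x) (FObj F y)))"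

definition cosieve :: "('o, 'a, 'p, 'b) func \<Rightarrow> bool" where
  "cosieve u \<longleftrightarrow> fully_faithful u \<and> inj_on (FObj u) (Obj (FSrc u)) \<and>
     (\<forall>j \<in> Obj (FSrc u). \<forall>k \<in> Obj (FTgt u).
        hom (FTgt u) (FObj u j) k \<noteq> {} \<longrightarrow> k \<in> FObj u ` Obj (FSrc u))"

definition sieve :: "('o, 'a, 'p, 'b) func \<Rightarrow> bool" where
  "sieve u \<longleftrightarrow> fully_faithful u \<and> inj_on (FObj u) (Obj (FSrc u)) \<and>
     (\<forall>j \<in> Obj (FSrc u). \<forall>k \<in> Obj (FTgt u).
        hom (FTgt u) k (FObj u j) \<noteq> {} \<longrightarrow> k \<in> FObj u ` Obj (FSrc u))"


section \<open>Derivators\<close>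

text \<open>
  The values of a prederivator are arbitrary categories on types \<open>'o\<close>, \<open>'a\<close> unrelated to the
  universe \<open>'u\<close>.  Only the values at small categories, functors between them, and
  transformations of those are constrained.
\<close>

record ('u, 'o, 'a) prederiv =
  D0 :: "'u scat \<Rightarrow> ('o, 'a) cat"
  D1 :: "'u sfunc \<Rightarrow> ('o, 'a, 'o, 'a) func"
  D2 :: "'u snat \<Rightarrow> ('o, 'a, 'o, 'a) nat_transf"

definition prederivator :: "('u, 'o, 'a) prederiv \<Rightarrow> bool" where
  "prederivator D \<longleftrightarrow>
     (\<forall>J. small_cat J \<longrightarrow> category (D0 D J)) \<and>
     (\<forall>u J K. small_func u J K \<longrightarrow> functor_between (D1 D u) (D0 D K) (D0 D J)) \<and>
     (\<forall>u v J K \<alpha>. small_func u J K \<and> small_func v J K \<and> nat_between \<alpha> u v \<longrightarrow>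
        nat_between (D2 D \<alpha>) (D1 D u) (D1 D v)) \<and>
     (\<forall>J. small_cat J \<longrightarrow> D1 D (id_func J) = id_func (D0 D J)) \<and>
     (\<forall>u v J K L. small_func u J K \<and> small_func v K L \<longrightarrow>
        D1 D (v \<circ>\<^sub>F u) = D1 D u \<circ>\<^sub>F D1 D v) \<and>
     (\<forall>u J K. small_func u J K \<longrightarrow> D2 D (id_nat u) = id_nat (D1 D u)) \<and>
     (\<forall>u v w J K \<alpha> \<beta>. small_func u J K \<and> small_func v J K \<and> small_func w J K \<and>
        nat_between \<alpha> u v \<and> nat_between \<beta> v w \<longrightarrow>
        D2 D (\<beta> \<bullet> \<alpha>) = D2 D \<beta> \<bullet> D2 D \<alpha>) \<and>
     (\<forall>u u' v v' J K L \<alpha> \<beta>. small_func u J K \<and> small_func u' J K \<and>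
        small_func v K L \<and> small_func v' K L \<and>
        nat_between \<alpha> u u' \<and> nat_between \<beta> v v' \<longrightarrow>
        D2 D (\<beta> \<star> \<alpha>) = D2 D \<alpha> \<star> D2 D \<beta>)"

definition der1 :: "('u, 'o, 'a) prederiv \<Rightarrow> bool" where
  "der1 D \<longleftrightarrow>
     (\<forall>J\<^sub>1 J\<^sub>2. small_cat J\<^sub>1 \<and> small_cat J\<^sub>2 \<longrightarrow>
        is_equivalence (pair_func (D1 D (coprod_in1 J\<^sub>1 J\<^sub>2)) (D1 D (coprod_in2 J\<^sub>1 J\<^sub>2)))) \<and>
     Obj (D0 D empty_cat) \<noteq> {}"

definition der2 :: "('u, 'o, 'a) prederiv \<Rightarrow> bool" where
  "der2 D \<longleftrightarrow>
     (\<forall>J. small_cat J \<longrightarrow> (\<forall>f \<in> Arr (D0 D J).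
        iso (D0 D J) f \<longleftrightarrow> (\<forall>j \<in> Obj J. iso (D0 D term_cat) (FArr (D1 D (point J j)) f))))"

definition der3 :: "('u, 'o, 'a) prederiv \<Rightarrow> bool" where
  "der3 D \<longleftrightarrow>
     (\<forall>u J K. small_func u J K \<longrightarrow>
        (\<exists>F. left_adjoint F (D1 D u)) \<and> (\<exists>G. left_adjoint (D1 D u) G))"

text \<open>
  The two canonical maps, for given adjunctions \<open>u\<^sub>! \<stileturn> u\<^sup>*\<close> with unit \<open>\<eta>\<close> and \<open>p\<^sub>! \<stileturn> p\<^sup>*\<close> with
  counit \<open>\<epsilon>\<close>, resp. \<open>u\<^sup>* \<stileturn> u\<^sub>*\<close> with counit \<open>\<epsilon>\<close> and \<open>p\<^sup>* \<stileturn> p\<^sub>*\<close> with unit \<open>\<eta>\<close>.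
\<close>

definition left_kan_map ::
  "('u, 'o, 'a) prederiv \<Rightarrow> 'u sfunc \<Rightarrow> 'u \<Rightarrow>
   ('o, 'a, 'o, 'a) func \<Rightarrow> ('o, 'a, 'o, 'a) nat_transf \<Rightarrow>
   ('o, 'a, 'o, 'a) func \<Rightarrow> ('o, 'a, 'o, 'a) nat_transf \<Rightarrow> ('o, 'a, 'o, 'a) nat_transf" where
  "left_kan_map D u k ul \<eta> pl \<epsilon> =
     (\<epsilon> \<lhd> (D1 D (point (FTgt u) k) \<circ>\<^sub>F ul)) \<bullet>
     ((pl \<rhd> (D2 D (slice_nat u k) \<lhd> ul)) \<bullet>
     ((pl \<circ>\<^sub>F D1 D (slice_pr u k)) \<rhd> \<eta>))"

definition right_kan_map ::
  "('u, 'o, 'a) prederiv \<Rightarrow> 'u sfunc \<Rightarrow> 'u \<Rightarrow>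
   ('o, 'a, 'o, 'a) func \<Rightarrow> ('o, 'a, 'o, 'a) nat_transf \<Rightarrow>
   ('o, 'a, 'o, 'a) func \<Rightarrow> ('o, 'a, 'o, 'a) nat_transf \<Rightarrow> ('o, 'a, 'o, 'a) nat_transf" where
  "right_kan_map D u k ur \<epsilon> pr \<eta> =
     ((pr \<circ>\<^sub>F D1 D (coslice_pr u k)) \<rhd> \<epsilon>) \<bullet>
     ((pr \<rhd> (D2 D (coslice_nat u k) \<lhd> ur)) \<bullet>
     (\<eta> \<lhd> (D1 D (point (FTgt u) k) \<circ>\<^sub>F ur)))"

definition der4 :: "('u, 'o, 'a) prederiv \<Rightarrow> bool" where
  "der4 D \<longleftrightarrow>
     (\<forall>u J K k. small_func u J K \<and> k \<in> Obj K \<longrightarrow>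
        (\<forall>ul \<eta> \<epsilon> pl \<eta>' \<epsilon>'.
           adjunction ul (D1 D u) \<eta> \<epsilon> \<and>
           adjunction pl (D1 D (to_term (slice u k))) \<eta>' \<epsilon>' \<longrightarrow>
           is_nat_iso (left_kan_map D u k ul \<eta> pl \<epsilon>')) \<and>
        (\<forall>ur \<eta> \<epsilon> pr \<eta>' \<epsilon>'.
           adjunction (D1 D u) ur \<eta> \<epsilon> \<and>
           adjunction (D1 D (to_term (coslice u k))) pr \<eta>' \<epsilon>' \<longrightarrow>
           is_nat_iso (right_kan_map D u k ur \<epsilon> pr \<eta>')))"

definition derivator :: "('u, 'o, 'a) prederiv \<Rightarrow> bool" where
  "derivator D \<longleftrightarrow> prederivator D \<and> der1 D \<and> der2 D \<and> der3 D \<and> der4 D"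

definition pointed :: "('u, 'o, 'a) prederiv \<Rightarrow> bool" where
  "pointed D \<longleftrightarrow> derivator D \<and> (\<exists>z. zero_object (D0 D term_cat) z)"

text \<open>
  Adjoints are unique up to isomorphism, so quantifying over all choices of \<open>j\<^sub>*\<close> and \<open>i\<^sub>!\<close>
  amounts to fixing one.
\<close>

definition strongly_pointed :: "('u, 'o, 'a) prederiv \<Rightarrow> bool" where
  "strongly_pointed D \<longleftrightarrow> derivator D \<and>
     (\<forall>j J K. small_func j J K \<and> sieve j \<longrightarrow>
        (\<forall>j_star. left_adjoint (D1 D j) j_star \<longrightarrow> (\<exists>G. left_adjoint j_star G))) \<and>
     (\<forall>i J K. small_func i J K \<and> cosieve i \<longrightarrow>
        (\<forall>i_shriek. left_adjoint i_shriek (D1 D i) \<longrightarrow> (\<exists>F. left_adjoint F i_shriek)))"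

end

theory Submission
  imports Defs
begin

text \<open>
  Let \<open>i : J \<rightarrow> K\<close> be a cosieve with complement \<open>A\<close>.  Over a pointed derivator \<open>i\<^sub>!\<close> is extension by zero:
  it is fully faithful, and its essential image consists of the objects \<open>W\<close> of \<open>D(K)\<close> with \<open>W\<^sub>a = 0\<close> for \<open>a\<close> in
  \<open>A\<close> (\<open>extension_by_zero_cosieve\<close>).  A left adjoint \<open>i\<^sup>?\<close> has to replace an object \<open>X\<close> of \<open>D(K)\<close> by its
  universal quotient that vanishes on \<open>A\<close>, obtained by gluing zeros to the values \<open>X\<^sub>a\<close>.  To express
  it by Kan extensions, enlarge \<open>K\<close> to a category \<open>L\<close> (\<open>partial_cylinder\<close>) with a second copy \<open>a'\<close> of
  every \<open>a\<close> in \<open>A\<close> and arrows \<open>a \<rightarrow> a'\<close>; let \<open>z : K \<rightarrow> L\<close> be the inclusion and \<open>r : L \<rightarrow> K\<close> the retraction.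
  Then \<open>z\<close> is a sieve, so \<open>z\<^sub>* X\<close> is \<open>X\<close> together with zeros at the \<open>a'\<close>, and \<open>r\<^sub>!\<close> glues these
  zeros in.  The left adjoint is \<open>i\<^sup>? = i\<^sup>* r\<^sub>! z\<^sub>*\<close>.

  That it is one is a chain of natural bijections between sets of arrows, which takes place in the
  three categories \<open>D(J)\<close>, \<open>D(K)\<close>, \<open>D(L)\<close> and uses nothing but the adjunctions, the identity \<open>z\<^sup>* r\<^sup>* = id\<close> and
  four families of isomorphisms (\<open>left_adjoint_of_extension\<close>).  The isomorphisms come from two consequences of the
  pointwise formulas: if \<open>u\<close> is bijective on arrows into \<open>j\<close>, then the unit \<open>Y \<rightarrow> u\<^sup>* u\<^sub>! Y\<close> is
  invertible at \<open>j\<close>, because the slice over \<open>u j\<close> has a terminal object (\<open>unit_iso_at\<close>); and if no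
  arrow leads from the image of \<open>u\<close> to \<open>k\<close>, then \<open>u\<^sub>! Y\<close> is zero at \<open>k\<close>, because the slice is empty
  (\<open>left_kan_zero\<close>).

  The statement on sieves is dual.  The argument about arrows is dualised formally, by opposites
  of the categories \<open>D(J)\<close>; the pointwise formulas are treated separately for left and right Kan
  extensions, as the slices \<open>J\<^sub>/\<^sub>k\<close> and \<open>J\<^sub>k\<^sub>/\<close> are not literally opposite to each other.
\<close>


section \<open>Elementary category theory\<close>

lemma hom_iff: "f \<in> hom C x y \<longleftrightarrow> f \<in> Arr C \<and> Dom C f = x \<and> Cod C f = y"
  by (auto simp: hom_def)

lemma hom_obj:
  assumes "category C" "f \<in> hom C x y"
  shows "x \<in> Obj C" "y \<in> Obj C"
  using assms by (auto simp: category_def hom_def PiE_iff)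

lemma Ide_hom: "category C \<Longrightarrow> x \<in> Obj C \<Longrightarrow> Ide C x \<in> hom C x x"
  by (simp add: category_def)

lemma Cmp_hom: "category C \<Longrightarrow> f \<in> hom C x y \<Longrightarrow> g \<in> hom C y z \<Longrightarrow> Cmp C g f \<in> hom C x z"
  unfolding category_def by blast

lemma Cmp_Ide_left: "category C \<Longrightarrow> f \<in> hom C x y \<Longrightarrow> Cmp C (Ide C y) f = f"
  unfolding category_def by blast

lemma Cmp_Ide_right: "category C \<Longrightarrow> f \<in> hom C x y \<Longrightarrow> Cmp C f (Ide C x) = f"
  unfolding category_def by blast

lemma Cmp_assoc:
  "category C \<Longrightarrow> f \<in> hom C w x \<Longrightarrow> g \<in> hom C x y \<Longrightarrow> h \<in> hom C y z \<Longrightarrow>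
    Cmp C h (Cmp C g f) = Cmp C (Cmp C h g) f"
  unfolding category_def by blast

lemma iso_hom_iff:
  assumes "f \<in> hom C x y"
  shows "iso C f \<longleftrightarrow> (\<exists>g \<in> hom C y x. Cmp C g f = Ide C x \<and> Cmp C f g = Ide C y)"
  using assms by (auto simp: iso_def hom_iff)

lemma iso_left_inverse:
  assumes C: "category C" and f: "f \<in> hom C x y" and g: "g \<in> hom C y x"
    and gf: "Cmp C g f = Ide C x" and "iso C g"
  shows "iso C f"
proof -
  obtain g' where g': "g' \<in> hom C x y" "Cmp C g' g = Ide C y" "Cmp C g g' = Ide C x"
    using \<open>iso C g\<close> g by (auto simp: iso_hom_iff)
  have "f = Cmp C (Cmp C g' g) f"
    using Cmp_Ide_left[OF C f] g' by simp
  also have "\<dots> = Cmp C g' (Cmp C g f)"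
    using Cmp_assoc[OF C f g g'(1)] by simp
  also have "\<dots> = g'"
    using gf Cmp_Ide_right[OF C g'(1)] by simp
  finally show ?thesis
    using g g' gf f by (auto simp: iso_hom_iff)
qed

lemma iso_right_inverse:
  assumes C: "category C" and f: "f \<in> hom C x y" and g: "g \<in> hom C y x"
    and gf: "Cmp C g f = Ide C x" and "iso C f"
  shows "iso C g"
proof -
  obtain f' where f': "f' \<in> hom C y x" "Cmp C f' f = Ide C x" "Cmp C f f' = Ide C y"
    using \<open>iso C f\<close> f by (auto simp: iso_hom_iff)
  have "g = Cmp C g (Cmp C f f')"
    using Cmp_Ide_right[OF C g] f' by simp
  also have "\<dots> = Cmp C (Cmp C g f) f'"
    using Cmp_assoc[OF C f'(1) f g] by simp
  also have "\<dots> = f'"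
    using gf Cmp_Ide_left[OF C f'(1)] by simp
  finally show ?thesis
    using f f' g by (auto simp: iso_hom_iff)
qed

lemma bij_betw_precomp_iso:
  assumes C: "category C" and f: "f \<in> hom C x y" and "iso C f"
  shows "bij_betw (\<lambda>h. Cmp C h f) (hom C y z) (hom C x z)"
proof -
  obtain g where g: "g \<in> hom C y x" "Cmp C g f = Ide C x" "Cmp C f g = Ide C y"
    using \<open>iso C f\<close> f by (auto simp: iso_hom_iff)
  show ?thesis
    by (rule bij_betw_byWitness[where f' = "\<lambda>h. Cmp C h g"])
      (use C f g in \<open>auto simp: Cmp_hom Cmp_assoc[symmetric] Cmp_Ide_right\<close>)
qed

lemma bij_betw_postcomp_iso:
  assumes C: "category C" and f: "f \<in> hom C x y" and "iso C f"
  shows "bij_betw (\<lambda>h. Cmp C f h) (hom C z x) (hom C z y)"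
proof -
  obtain g where g: "g \<in> hom C y x" "Cmp C g f = Ide C x" "Cmp C f g = Ide C y"
    using \<open>iso C f\<close> f by (auto simp: iso_hom_iff)
  show ?thesis
    by (rule bij_betw_byWitness[where f' = "\<lambda>h. Cmp C g h"])
      (use C f g in \<open>auto simp: Cmp_hom Cmp_assoc Cmp_Ide_left\<close>)
qed

lemma zero_object_hom_unique:
  assumes "zero_object C a" "f \<in> hom C x y" "g \<in> hom C x y" "category C" "x = a \<or> y = a"
  shows "f = g"
  using assms hom_obj[of C f x y] by (auto simp: zero_object_def)

lemma iso_between_zero_objects:
  assumes C: "category C" and f: "f \<in> hom C a b" and ab: "zero_object C a" "zero_object C b"
  shows "iso C f"
proof -
  obtain g where g: "g \<in> hom C b a"
    using ab by (auto simp: zero_object_def)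
  have "Cmp C g f = Ide C a"
    using zero_object_hom_unique[OF ab(1) Cmp_hom[OF C f g] Ide_hom[OF C] C] hom_obj[OF C f] by simp
  moreover have "Cmp C f g = Ide C b"
    using zero_object_hom_unique[OF ab(2) Cmp_hom[OF C g f] Ide_hom[OF C] C] hom_obj[OF C f] by simp
  ultimately show ?thesis
    using f g by (auto simp: iso_hom_iff)
qed

lemma bij_betw_Ex1:
  assumes f: "bij_betw f A B"
  shows "(\<exists>!x. x \<in> A) \<longleftrightarrow> (\<exists>!y. y \<in> B)"
proof
  show "\<exists>!y. y \<in> B" if "\<exists>!x. x \<in> A"
    using that f by (auto simp: bij_betw_def)
  show "\<exists>!x. x \<in> A" if "\<exists>!y. y \<in> B"
    using that f unfolding bij_betw_def inj_on_def by blast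
qed

lemma zero_object_iso:
  assumes C: "category C" and f: "f \<in> hom C x y" "iso C f"
  shows "zero_object C x \<longleftrightarrow> zero_object C y"
  using hom_obj[OF C f(1)] bij_betw_Ex1[OF bij_betw_precomp_iso[OF C f]]
    bij_betw_Ex1[OF bij_betw_postcomp_iso[OF C f]]
  by (simp add: zero_object_def)

lemma zero_objectI_initial:
  assumes C: "category C" and z: "zero_object C z" and x: "x \<in> Obj C"
    and uniq: "\<And>y. y \<in> Obj C \<Longrightarrow> \<exists>!f. f \<in> hom C x y"
  shows "zero_object C x"
proof -
  obtain f g where f: "f \<in> hom C x z" and g: "g \<in> hom C z x"
    using z x by (auto simp: zero_object_def)
  have "Cmp C g f = Ide C x"
    using uniq[OF x] Cmp_hom[OF C f g] Ide_hom[OF C x] by blast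
  moreover have "Cmp C f g = Ide C z"
    using zero_object_hom_unique[OF z Cmp_hom[OF C g f] Ide_hom[OF C] C] hom_obj[OF C f] by simp
  ultimately have "iso C f"
    using f g by (auto simp: iso_hom_iff)
  then show ?thesis
    using zero_object_iso[OF C f] z by simp
qed

lemma zero_objectI_terminal:
  assumes C: "category C" and z: "zero_object C z" and x: "x \<in> Obj C"
    and uniq: "\<And>y. y \<in> Obj C \<Longrightarrow> \<exists>!f. f \<in> hom C y x"
  shows "zero_object C x"
proof -
  obtain f g where f: "f \<in> hom C x z" and g: "g \<in> hom C z x"
    using z x by (auto simp: zero_object_def)
  have "Cmp C g f = Ide C x"
    using uniq[OF x] Cmp_hom[OF C f g] Ide_hom[OF C x] by blast
  moreover have "Cmp C f g = Ide C z"
    using zero_object_hom_unique[OF z Cmp_hom[OF C g f] Ide_hom[OF C] C] hom_obj[OF C f] by simp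
  ultimately have "iso C f"
    using f g by (auto simp: iso_hom_iff)
  then show ?thesis
    using zero_object_iso[OF C f] z by simp
qed


section \<open>Functors and natural transformations\<close>

lemma functorD:
  assumes "functor_between F C D"
  shows "category C" "category D" "FSrc F = C" "FTgt F = D"
    and "x \<in> Obj C \<Longrightarrow> FObj F x \<in> Obj D"
    and "f \<in> hom C x y \<Longrightarrow> FArr F f \<in> hom D (FObj F x) (FObj F y)"
    and "x \<in> Obj C \<Longrightarrow> FArr F (Ide C x) = Ide D (FObj F x)"
    and "f \<in> hom C x y \<Longrightarrow> g \<in> hom C y z \<Longrightarrow>
      FArr F (Cmp C g f) = Cmp D (FArr F g) (FArr F f)"
  using assms unfolding functor_between_def is_functor_def PiE_iff by blast+

lemma functorI:
  assumes "category C" "category D" "FSrc F = C" "FTgt F = D"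
    and "FObj F \<in> extensional (Obj C)" "FArr F \<in> extensional (Arr C)"
    and "\<And>x. x \<in> Obj C \<Longrightarrow> FObj F x \<in> Obj D"
    and "\<And>f x y. f \<in> hom C x y \<Longrightarrow> FArr F f \<in> hom D (FObj F x) (FObj F y)"
    and "\<And>x. x \<in> Obj C \<Longrightarrow> FArr F (Ide C x) = Ide D (FObj F x)"
    and "\<And>f g x y z. f \<in> hom C x y \<Longrightarrow> g \<in> hom C y z \<Longrightarrow>
      FArr F (Cmp C g f) = Cmp D (FArr F g) (FArr F f)"
  shows "functor_between F C D"
proof -
  have "FArr F f \<in> Arr D" if "f \<in> Arr C" for f
    using assms(8)[of f "Dom C f" "Cod C f"] that by (simp add: hom_iff)
  then show ?thesis
    using assms unfolding functor_between_def is_functor_def PiE_iff by simp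
qed

lemma functor_eqI:
  assumes F: "functor_between F C D" and G: "functor_between G C D"
    and Obj: "\<And>x. x \<in> Obj C \<Longrightarrow> FObj F x = FObj G x"
    and Arr: "\<And>x y f. f \<in> hom C x y \<Longrightarrow> FArr F f = FArr G f"
  shows "F = G"
proof (rule func.equality)
  show "FObj F = FObj G"
    using F G Obj by (intro extensionalityI[where A = "Obj C"])
      (auto simp: functor_between_def is_functor_def PiE_iff)
  show "FArr F = FArr G"
    using F G Arr by (intro extensionalityI[where A = "Arr C"])
      (auto simp: functor_between_def is_functor_def PiE_iff hom_iff)
qed (use F G in \<open>simp_all add: functor_between_def\<close>)

lemma id_func_simps [simp]:
  "FSrc (id_func C) = C" "FTgt (id_func C) = C"
  "x \<in> Obj C \<Longrightarrow> FObj (id_func C) x = x" "f \<in> hom C x y \<Longrightarrow> FArr (id_func C) f = f"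
  by (simp_all add: id_func_def hom_iff)

lemma functor_id_func:
  assumes C: "category C"
  shows "functor_between (id_func C) C C"
proof (rule functorI[OF C C])
  fix f g x y z assume f: "f \<in> hom C x y" and g: "g \<in> hom C y z"
  show "FArr (id_func C) (Cmp C g f) = Cmp C (FArr (id_func C) g) (FArr (id_func C) f)"
    using Cmp_hom[OF C f g] f g by simp
next
  fix f x y assume f: "f \<in> hom C x y"
  show "FArr (id_func C) f \<in> hom C (FObj (id_func C) x) (FObj (id_func C) y)"
    using f hom_obj[OF C f] by simp
next
  fix x assume x: "x \<in> Obj C"
  show "FArr (id_func C) (Ide C x) = Ide C (FObj (id_func C) x)"
    using Ide_hom[OF C x] x by simp
qed (simp_all add: id_func_def)

lemma comp_func_simps [simp]:
  "FSrc (G \<circ>\<^sub>F F) = FSrc F" "FTgt (G \<circ>\<^sub>F F) = FTgt G"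
  by (simp_all add: comp_func_def)

lemma FObj_comp: "functor_between F C D \<Longrightarrow> x \<in> Obj C \<Longrightarrow> FObj (G \<circ>\<^sub>F F) x = FObj G (FObj F x)"
  by (simp add: comp_func_def compose_def functor_between_def)

lemma FArr_comp: "functor_between F C D \<Longrightarrow> f \<in> hom C x y \<Longrightarrow> FArr (G \<circ>\<^sub>F F) f = FArr G (FArr F f)"
  by (simp add: comp_func_def compose_def functor_between_def hom_iff)

lemma functor_comp:
  assumes F: "functor_between F C D" and G: "functor_between G D E"
  shows "functor_between (G \<circ>\<^sub>F F) C E"
proof (rule functorI)
  show "FObj (G \<circ>\<^sub>F F) \<in> extensional (Obj C)" "FArr (G \<circ>\<^sub>F F) \<in> extensional (Arr C)"
    using F by (simp_all add: comp_func_def compose_def functor_between_def)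
  fix f g x y z assume f: "f \<in> hom C x y" and g: "g \<in> hom C y z"
  show "FArr (G \<circ>\<^sub>F F) (Cmp C g f) = Cmp E (FArr (G \<circ>\<^sub>F F) g) (FArr (G \<circ>\<^sub>F F) f)"
    using functorD(8)[OF F f g] functorD(8)[OF G functorD(6)[OF F f] functorD(6)[OF F g]]
    by (simp only: FArr_comp[OF F f] FArr_comp[OF F g]
        FArr_comp[OF F Cmp_hom[OF functorD(1)[OF F] f g]])
next
  fix f x y assume f: "f \<in> hom C x y"
  note xy = hom_obj[OF functorD(1)[OF F] f]
  show "FArr (G \<circ>\<^sub>F F) f \<in> hom E (FObj (G \<circ>\<^sub>F F) x) (FObj (G \<circ>\<^sub>F F) y)"
    using functorD(6)[OF G functorD(6)[OF F f]]
    by (simp only: FArr_comp[OF F f] FObj_comp[OF F xy(1)] FObj_comp[OF F xy(2)])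
next
  fix x assume x: "x \<in> Obj C"
  show "FObj (G \<circ>\<^sub>F F) x \<in> Obj E"
    using functorD(5)[OF G functorD(5)[OF F x]] by (simp only: FObj_comp[OF F x])
  show "FArr (G \<circ>\<^sub>F F) (Ide C x) = Ide E (FObj (G \<circ>\<^sub>F F) x)"
    by (simp only: FArr_comp[OF F Ide_hom[OF functorD(1)[OF F] x]] FObj_comp[OF F x]
        functorD(7)[OF F x] functorD(7)[OF G functorD(5)[OF F x]])
qed (simp_all add: functorD[OF F] functorD[OF G])

lemma comp_func_id:
  assumes F: "functor_between F C D"
  shows "F \<circ>\<^sub>F id_func C = F" "id_func D \<circ>\<^sub>F F = F"
proof -
  note C = functorD(1)[OF F] and D = functorD(2)[OF F]
  show "F \<circ>\<^sub>F id_func C = F"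
    by (rule functor_eqI[OF functor_comp[OF functor_id_func[OF C] F] F])
      (simp_all add: FObj_comp[OF functor_id_func[OF C]] FArr_comp[OF functor_id_func[OF C]])
  show "id_func D \<circ>\<^sub>F F = F"
    by (rule functor_eqI[OF functor_comp[OF F functor_id_func[OF D]] F])
      (simp_all add: FObj_comp[OF F] FArr_comp[OF F] functorD(5)[OF F] id_func_simps(4)[OF functorD(6)[OF F]])
qed

lemma comp_func_assoc:
  assumes F: "functor_between F A B" and G: "functor_between G B C" and H: "functor_between H C D"
  shows "H \<circ>\<^sub>F (G \<circ>\<^sub>F F) = (H \<circ>\<^sub>F G) \<circ>\<^sub>F F"
proof (rule functor_eqI)
  show "functor_between (H \<circ>\<^sub>F (G \<circ>\<^sub>F F)) A D" "functor_between ((H \<circ>\<^sub>F G) \<circ>\<^sub>F F) A D"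
    by (rule functor_comp[OF functor_comp[OF F G] H] functor_comp[OF F functor_comp[OF G H]])+
  fix x assume x: "x \<in> Obj A"
  show "FObj (H \<circ>\<^sub>F (G \<circ>\<^sub>F F)) x = FObj ((H \<circ>\<^sub>F G) \<circ>\<^sub>F F) x"
    by (simp only: FObj_comp[OF functor_comp[OF F G] x] FObj_comp[OF F x]
        FObj_comp[OF G functorD(5)[OF F x]])
next
  fix x y f assume f: "f \<in> hom A x y"
  show "FArr (H \<circ>\<^sub>F (G \<circ>\<^sub>F F)) f = FArr ((H \<circ>\<^sub>F G) \<circ>\<^sub>F F) f"
    by (simp only: FArr_comp[OF functor_comp[OF F G] f] FArr_comp[OF F f]
        FArr_comp[OF G functorD(6)[OF F f]])
qed

lemma functor_iso:
  assumes F: "functor_between F C D" and f: "f \<in> hom C x y" "iso C f"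
  shows "iso D (FArr F f)"
proof -
  note C = functorD(1)[OF F]
  obtain g where g: "g \<in> hom C y x" "Cmp C g f = Ide C x" "Cmp C f g = Ide C y"
    using f by (auto simp: iso_hom_iff)
  then have "Cmp D (FArr F g) (FArr F f) = Ide D (FObj F x)"
      "Cmp D (FArr F f) (FArr F g) = Ide D (FObj F y)"
    using functorD(8)[OF F f(1) g(1)] functorD(8)[OF F g(1) f(1)] functorD(7)[OF F]
      hom_obj[OF C f(1)] by simp_all
  then show ?thesis
    using iso_hom_iff[OF functorD(6)[OF F f(1)]] functorD(6)[OF F g(1)] by blast
qed

lemma nat_betweenD:
  assumes "nat_between \<alpha> F G" "functor_between F C D"
  shows "functor_between G C D" "NSrc \<alpha> = F" "NTgt \<alpha> = G"
    and "x \<in> Obj C \<Longrightarrow> NCmp \<alpha> x \<in> hom D (FObj F x) (FObj G x)"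
    and "f \<in> hom C x y \<Longrightarrow> Cmp D (NCmp \<alpha> y) (FArr F f) = Cmp D (FArr G f) (NCmp \<alpha> x)"
  using assms unfolding nat_between_def is_nat_def functor_between_def Let_def by metis+

lemma nat_betweenI:
  assumes "functor_between F C D" "functor_between G C D" "NSrc \<alpha> = F" "NTgt \<alpha> = G"
    and "NCmp \<alpha> \<in> extensional (Obj C)"
    and "\<And>x. x \<in> Obj C \<Longrightarrow> NCmp \<alpha> x \<in> hom D (FObj F x) (FObj G x)"
    and "\<And>f x y. f \<in> hom C x y \<Longrightarrow>
      Cmp D (NCmp \<alpha> y) (FArr F f) = Cmp D (FArr G f) (NCmp \<alpha> x)"
  shows "nat_between \<alpha> F G"
  using assms unfolding nat_between_def is_nat_def functor_between_def Let_def by auto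

lemma nat_eqI:
  assumes \<alpha>: "nat_between \<alpha> F G" and \<beta>: "nat_between \<beta> F G"
    and eq: "\<And>x. x \<in> Obj (FSrc F) \<Longrightarrow> NCmp \<alpha> x = NCmp \<beta> x"
  shows "\<alpha> = \<beta>"
proof (rule nat_transf.equality)
  show "NCmp \<alpha> = NCmp \<beta>"
    using \<alpha> \<beta> eq by (intro extensionalityI[where A = "Obj (FSrc F)"])
      (auto simp: nat_between_def is_nat_def Let_def)
qed (use \<alpha> \<beta> in \<open>simp_all add: nat_between_def\<close>)

lemma NCmp_id_nat: "functor_between F C D \<Longrightarrow> x \<in> Obj C \<Longrightarrow> NCmp (id_nat F) x = Ide D (FObj F x)"
  by (simp add: id_nat_def functor_between_def)

lemma nat_id_nat:
  assumes F: "functor_between F C D"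
  shows "nat_between (id_nat F) F F"
proof (rule nat_betweenI[OF F F])
  show "NCmp (id_nat F) \<in> extensional (Obj C)"
    using functorD(3)[OF F] by (simp add: id_nat_def)
  fix f x y assume f: "f \<in> hom C x y"
  show "Cmp D (NCmp (id_nat F) y) (FArr F f) = Cmp D (FArr F f) (NCmp (id_nat F) x)"
    using hom_obj[OF functorD(1)[OF F] f] functorD(6)[OF F f] functorD(2)[OF F]
    by (simp add: NCmp_id_nat[OF F] Cmp_Ide_left Cmp_Ide_right)
qed (simp_all add: id_nat_def functorD[OF F] Ide_hom)

lemma NCmp_vcomp:
  "nat_between \<alpha> F G \<Longrightarrow> functor_between F C D \<Longrightarrow> x \<in> Obj C \<Longrightarrow>
    NCmp (\<beta> \<bullet> \<alpha>) x = Cmp D (NCmp \<beta> x) (NCmp \<alpha> x)"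
  by (simp add: vcomp_def nat_between_def functor_between_def)

lemma nat_vcomp:
  assumes F: "functor_between F C D" and \<alpha>: "nat_between \<alpha> F G" and \<beta>: "nat_between \<beta> G H"
  shows "nat_between (\<beta> \<bullet> \<alpha>) F H"
proof -
  note C = functorD(1)[OF F] and D = functorD(2)[OF F]
  note G = nat_betweenD(1)[OF \<alpha> F]
  note H = nat_betweenD(1)[OF \<beta> G]
  show ?thesis
  proof (rule nat_betweenI[OF F H])
    show "NCmp (\<beta> \<bullet> \<alpha>) \<in> extensional (Obj C)"
      using \<alpha> functorD(3)[OF F] by (simp add: vcomp_def nat_between_def)
    fix f x y assume f: "f \<in> hom C x y"
    note xy = hom_obj[OF C f]
    note a = nat_betweenD(4)[OF \<alpha> F] and b = nat_betweenD(4)[OF \<beta> G]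
    have "Cmp D (Cmp D (NCmp \<beta> y) (NCmp \<alpha> y)) (FArr F f) = Cmp D (NCmp \<beta> y) (Cmp D (FArr G f) (NCmp \<alpha> x))"
      using Cmp_assoc[OF D functorD(6)[OF F f] a[OF xy(2)] b[OF xy(2)]] nat_betweenD(5)[OF \<alpha> F f] by simp
    also have "\<dots> = Cmp D (Cmp D (FArr H f) (NCmp \<beta> x)) (NCmp \<alpha> x)"
      using Cmp_assoc[OF D a[OF xy(1)] functorD(6)[OF G f] b[OF xy(2)]] nat_betweenD(5)[OF \<beta> G f] by simp
    also have "\<dots> = Cmp D (FArr H f) (Cmp D (NCmp \<beta> x) (NCmp \<alpha> x))"
      using Cmp_assoc[OF D a[OF xy(1)] b[OF xy(1)] functorD(6)[OF H f]] by simp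
    finally show "Cmp D (NCmp (\<beta> \<bullet> \<alpha>) y) (FArr F f) = Cmp D (FArr H f) (NCmp (\<beta> \<bullet> \<alpha>) x)"
      using xy by (simp add: NCmp_vcomp[OF \<alpha> F])
  next
    fix x assume x: "x \<in> Obj C"
    show "NCmp (\<beta> \<bullet> \<alpha>) x \<in> hom D (FObj F x) (FObj H x)"
      unfolding NCmp_vcomp[OF \<alpha> F x]
      by (rule Cmp_hom[OF D nat_betweenD(4)[OF \<alpha> F x] nat_betweenD(4)[OF \<beta> G x]])
  qed (use \<alpha> \<beta> in \<open>simp_all add: vcomp_def nat_between_def\<close>)
qed

lemma NCmp_hcomp:
  "nat_between \<alpha> F F' \<Longrightarrow> nat_between \<beta> G G' \<Longrightarrow> functor_between F C D \<Longrightarrow> functor_between G D E \<Longrightarrow>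
    x \<in> Obj C \<Longrightarrow> NCmp (\<beta> \<star> \<alpha>) x = Cmp E (FArr G' (NCmp \<alpha> x)) (NCmp \<beta> (FObj F x))"
  by (simp add: hcomp_def nat_between_def functor_between_def)

lemma nat_hcomp:
  assumes F: "functor_between F C D" and G: "functor_between G D E"
    and \<alpha>: "nat_between \<alpha> F F'" and \<beta>: "nat_between \<beta> G G'"
  shows "nat_between (\<beta> \<star> \<alpha>) (G \<circ>\<^sub>F F) (G' \<circ>\<^sub>F F')"
proof -
  note C = functorD(1)[OF F] and D = functorD(2)[OF F] and E = functorD(2)[OF G]
  note F' = nat_betweenD(1)[OF \<alpha> F] and G' = nat_betweenD(1)[OF \<beta> G]
  note a = nat_betweenD(4)[OF \<alpha> F] and b = nat_betweenD(4)[OF \<beta> G]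
  note comp = NCmp_hcomp[OF \<alpha> \<beta> F G]
  have mem: "NCmp (\<beta> \<star> \<alpha>) x \<in> hom E (FObj (G \<circ>\<^sub>F F) x) (FObj (G' \<circ>\<^sub>F F') x)" if x: "x \<in> Obj C" for x
    using Cmp_hom[OF E b[OF functorD(5)[OF F x]] functorD(6)[OF G' a[OF x]]]
    by (simp add: comp FObj_comp[OF F] FObj_comp[OF F'] x)
  show ?thesis
  proof (rule nat_betweenI[OF functor_comp[OF F G] functor_comp[OF F' G']])
    show "NCmp (\<beta> \<star> \<alpha>) \<in> extensional (Obj C)"
      using \<alpha> functorD(3)[OF F] by (simp add: hcomp_def nat_between_def)
    fix f x y assume f: "f \<in> hom C x y"
    note xy = hom_obj[OF C f]
    let ?a = "NCmp \<alpha>" and ?b = "\<lambda>x. NCmp \<beta> (FObj F x)"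
    note Ff = functorD(6)[OF F f] and F'f = functorD(6)[OF F' f]
    have "Cmp E (Cmp E (FArr G' (?a y)) (?b y)) (FArr G (FArr F f))
        = Cmp E (FArr G' (?a y)) (Cmp E (FArr G' (FArr F f)) (?b x))"
      using Cmp_assoc[OF E functorD(6)[OF G Ff] b functorD(6)[OF G' a]] xy functorD(5)[OF F]
        nat_betweenD(5)[OF \<beta> G Ff] by simp
    also have "\<dots> = Cmp E (FArr G' (Cmp D (?a y) (FArr F f))) (?b x)"
      using Cmp_assoc[OF E b functorD(6)[OF G' Ff] functorD(6)[OF G' a]] xy functorD(5)[OF F]
        functorD(8)[OF G' Ff a] by simp
    also have "\<dots> = Cmp E (Cmp E (FArr G' (FArr F' f)) (FArr G' (?a x))) (?b x)"
      using nat_betweenD(5)[OF \<alpha> F f] functorD(8)[OF G' a F'f] xy by simp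
    also have "\<dots> = Cmp E (FArr G' (FArr F' f)) (Cmp E (FArr G' (?a x)) (?b x))"
      using Cmp_assoc[OF E b functorD(6)[OF G' a] functorD(6)[OF G' F'f]] xy functorD(5)[OF F] by simp
    finally show "Cmp E (NCmp (\<beta> \<star> \<alpha>) y) (FArr (G \<circ>\<^sub>F F) f)
        = Cmp E (FArr (G' \<circ>\<^sub>F F') f) (NCmp (\<beta> \<star> \<alpha>) x)"
      using xy by (simp add: comp FArr_comp[OF F f] FArr_comp[OF F' f])
  next
    fix x assume "x \<in> Obj C"
    then show "NCmp (\<beta> \<star> \<alpha>) x \<in> hom E (FObj (G \<circ>\<^sub>F F) x) (FObj (G' \<circ>\<^sub>F F') x)"
      by (rule mem)
  qed (use \<alpha> \<beta> in \<open>simp_all add: hcomp_def nat_between_def\<close>)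
qed

lemma NCmp_whisker_left:
  assumes G: "functor_between G C D" and \<alpha>: "nat_between \<alpha> G H" and F: "functor_between F D E"
    and x: "x \<in> Obj C"
  shows "NCmp (F \<rhd> \<alpha>) x = FArr F (NCmp \<alpha> x)"
  unfolding whisker_left_def NCmp_hcomp[OF \<alpha> nat_id_nat[OF F] G F x]
  by (simp add: NCmp_id_nat[OF F] functorD(5)[OF G x]
      Cmp_Ide_right[OF functorD(2)[OF F] functorD(6)[OF F nat_betweenD(4)[OF \<alpha> G x]]])

lemma nat_whisker_left:
  assumes G: "functor_between G C D" and \<alpha>: "nat_between \<alpha> G H" and F: "functor_between F D E"
  shows "nat_between (F \<rhd> \<alpha>) (F \<circ>\<^sub>F G) (F \<circ>\<^sub>F H)"
  unfolding whisker_left_def by (rule nat_hcomp[OF G F \<alpha> nat_id_nat[OF F]])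

lemma NCmp_whisker_right:
  assumes F: "functor_between F C D" and G: "functor_between G D E" and \<alpha>: "nat_between \<alpha> G H"
    and x: "x \<in> Obj C"
  shows "NCmp (\<alpha> \<lhd> F) x = NCmp \<alpha> (FObj F x)"
  unfolding whisker_right_def NCmp_hcomp[OF nat_id_nat[OF F] \<alpha> F G x]
  using nat_betweenD(1)[OF \<alpha> G] functorD(5)[OF F x]
  by (simp add: NCmp_id_nat[OF F x] functorD(7)
      Cmp_Ide_left[OF functorD(2)[OF G] nat_betweenD(4)[OF \<alpha> G]])

lemma nat_whisker_right:
  assumes F: "functor_between F C D" and G: "functor_between G D E" and \<alpha>: "nat_between \<alpha> G H"
  shows "nat_between (\<alpha> \<lhd> F) (G \<circ>\<^sub>F F) (H \<circ>\<^sub>F F)"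
  unfolding whisker_right_def by (rule nat_hcomp[OF F G nat_id_nat[OF F] \<alpha>])


section \<open>Adjunctions\<close>

lemma adjunctionD:
  assumes adj: "adjunction F G \<eta> \<epsilon>" and F: "functor_between F C D"
  shows "functor_between G D C"
    and "nat_between \<eta> (id_func C) (G \<circ>\<^sub>F F)" "nat_between \<epsilon> (F \<circ>\<^sub>F G) (id_func D)"
    and "x \<in> Obj C \<Longrightarrow> NCmp \<eta> x \<in> hom C x (FObj G (FObj F x))"
    and "y \<in> Obj D \<Longrightarrow> NCmp \<epsilon> y \<in> hom D (FObj F (FObj G y)) y"
    and "f \<in> hom C x x' \<Longrightarrow>
      Cmp C (NCmp \<eta> x') f = Cmp C (FArr G (FArr F f)) (NCmp \<eta> x)"
    and "g \<in> hom D y y' \<Longrightarrow>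
      Cmp D (NCmp \<epsilon> y') (FArr F (FArr G g)) = Cmp D g (NCmp \<epsilon> y)"
    and "x \<in> Obj C \<Longrightarrow> Cmp D (NCmp \<epsilon> (FObj F x)) (FArr F (NCmp \<eta> x)) = Ide D (FObj F x)"
    and "y \<in> Obj D \<Longrightarrow> Cmp C (FArr G (NCmp \<epsilon> y)) (NCmp \<eta> (FObj G y)) = Ide C (FObj G y)"
proof -
  note C = functorD(1)[OF F] and D = functorD(2)[OF F]
  note idC = functor_id_func[OF C]
  show G: "functor_between G D C" and \<eta>: "nat_between \<eta> (id_func C) (G \<circ>\<^sub>F F)"
    and \<epsilon>: "nat_between \<epsilon> (F \<circ>\<^sub>F G) (id_func D)"
    using adj functorD(3,4)[OF F] by (simp_all add: adjunction_def)
  note FG = functor_comp[OF G F]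
  show "NCmp \<eta> x \<in> hom C x (FObj G (FObj F x))" if "x \<in> Obj C"
    using nat_betweenD(4)[OF \<eta> idC that] that by (simp add: FObj_comp[OF F])
  show "NCmp \<epsilon> y \<in> hom D (FObj F (FObj G y)) y" if "y \<in> Obj D"
    using nat_betweenD(4)[OF \<epsilon> FG that] that by (simp add: FObj_comp[OF G])
  show "Cmp C (NCmp \<eta> x') f = Cmp C (FArr G (FArr F f)) (NCmp \<eta> x)" if "f \<in> hom C x x'"
    using nat_betweenD(5)[OF \<eta> idC that] id_func_simps(4)[OF that] FArr_comp[OF F that, of G] by simp
  show "Cmp D (NCmp \<epsilon> y') (FArr F (FArr G g)) = Cmp D g (NCmp \<epsilon> y)" if "g \<in> hom D y y'"
    using nat_betweenD(5)[OF \<epsilon> FG that] id_func_simps(4)[OF that] FArr_comp[OF G that, of F] by simp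
  show "Cmp D (NCmp \<epsilon> (FObj F x)) (FArr F (NCmp \<eta> x)) = Ide D (FObj F x)" if x: "x \<in> Obj C"
  proof -
    have "NCmp ((\<epsilon> \<lhd> F) \<bullet> (F \<rhd> \<eta>)) x = NCmp (id_nat F) x"
      using adj by (simp add: adjunction_def)
    then show ?thesis
      by (simp only: NCmp_vcomp[OF nat_whisker_left[OF idC \<eta> F] functor_comp[OF idC F] x]
          NCmp_whisker_right[OF F FG \<epsilon> x] NCmp_whisker_left[OF idC \<eta> F x] NCmp_id_nat[OF F x])
  qed
  show "Cmp C (FArr G (NCmp \<epsilon> y)) (NCmp \<eta> (FObj G y)) = Ide C (FObj G y)" if y: "y \<in> Obj D"
  proof -
    have "NCmp ((G \<rhd> \<epsilon>) \<bullet> (\<eta> \<lhd> G)) y = NCmp (id_nat G) y"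
      using adj by (simp add: adjunction_def)
    then show ?thesis
      by (simp only: NCmp_vcomp[OF nat_whisker_right[OF G idC \<eta>] functor_comp[OF G idC] y]
          NCmp_whisker_left[OF FG \<epsilon> G y] NCmp_whisker_right[OF G idC \<eta> y] NCmp_id_nat[OF G y])
  qed
qed

lemma adjunctionI:
  assumes F: "functor_between F C D" and G: "functor_between G D C"
    and \<eta>: "nat_between \<eta> (id_func C) (G \<circ>\<^sub>F F)" and \<epsilon>: "nat_between \<epsilon> (F \<circ>\<^sub>F G) (id_func D)"
    and tri1: "\<And>x. x \<in> Obj C \<Longrightarrow>
      Cmp D (NCmp \<epsilon> (FObj F x)) (FArr F (NCmp \<eta> x)) = Ide D (FObj F x)"
    and tri2: "\<And>y. y \<in> Obj D \<Longrightarrow>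
      Cmp C (FArr G (NCmp \<epsilon> y)) (NCmp \<eta> (FObj G y)) = Ide C (FObj G y)"
  shows "adjunction F G \<eta> \<epsilon>"
proof -
  note C = functorD(1)[OF F] and D = functorD(2)[OF F]
  note idC = functor_id_func[OF C]
  note FG = functor_comp[OF G F]
  have F\<eta>: "nat_between (F \<rhd> \<eta>) F (F \<circ>\<^sub>F (G \<circ>\<^sub>F F))"
    using nat_whisker_left[OF idC \<eta> F] by (simp add: comp_func_id[OF F])
  have \<epsilon>F: "nat_between (\<epsilon> \<lhd> F) (F \<circ>\<^sub>F (G \<circ>\<^sub>F F)) F"
    using nat_whisker_right[OF F FG \<epsilon>] by (simp add: comp_func_id[OF F] comp_func_assoc[OF F G F])
  have \<eta>G: "nat_between (\<eta> \<lhd> G) G (G \<circ>\<^sub>F (F \<circ>\<^sub>F G))"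
    using nat_whisker_right[OF G idC \<eta>] by (simp add: comp_func_id[OF G] comp_func_assoc[OF G F G])
  have G\<epsilon>: "nat_between (G \<rhd> \<epsilon>) (G \<circ>\<^sub>F (F \<circ>\<^sub>F G)) G"
    using nat_whisker_left[OF FG \<epsilon> G] by (simp add: comp_func_id[OF G])
  have "(\<epsilon> \<lhd> F) \<bullet> (F \<rhd> \<eta>) = id_nat F"
  proof (rule nat_eqI[OF nat_vcomp[OF F F\<eta> \<epsilon>F] nat_id_nat[OF F]])
    fix x assume "x \<in> Obj (FSrc F)"
    then have x: "x \<in> Obj C" by (simp add: functorD[OF F])
    show "NCmp ((\<epsilon> \<lhd> F) \<bullet> (F \<rhd> \<eta>)) x = NCmp (id_nat F) x"
      by (simp only: NCmp_vcomp[OF F\<eta> F x] NCmp_whisker_right[OF F FG \<epsilon> x]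
          NCmp_whisker_left[OF idC \<eta> F x] NCmp_id_nat[OF F x] tri1[OF x])
  qed
  moreover have "(G \<rhd> \<epsilon>) \<bullet> (\<eta> \<lhd> G) = id_nat G"
  proof (rule nat_eqI[OF nat_vcomp[OF G \<eta>G G\<epsilon>] nat_id_nat[OF G]])
    fix y assume "y \<in> Obj (FSrc G)"
    then have y: "y \<in> Obj D" by (simp add: functorD[OF G])
    show "NCmp ((G \<rhd> \<epsilon>) \<bullet> (\<eta> \<lhd> G)) y = NCmp (id_nat G) y"
      by (simp only: NCmp_vcomp[OF \<eta>G G y] NCmp_whisker_left[OF FG \<epsilon> G y]
          NCmp_whisker_right[OF G idC \<eta> y] NCmp_id_nat[OF G y] tri2[OF y])
  qed
  ultimately show ?thesis
    using F G \<eta> \<epsilon> by (simp add: adjunction_def functorD[OF F])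
qed

lemma bij_betw_transpose:
  assumes adj: "adjunction F G \<eta> \<epsilon>" and F: "functor_between F C D"
    and x: "x \<in> Obj C" and y: "y \<in> Obj D"
  shows "bij_betw (\<lambda>g. Cmp C (FArr G g) (NCmp \<eta> x)) (hom D (FObj F x) y) (hom C x (FObj G y))"
proof -
  note C = functorD(1)[OF F] and D = functorD(2)[OF F]
  note A = adjunctionD[OF adj F]
  note G = A(1)
  note \<eta> = A(4)[OF x] and \<epsilon> = A(5)[OF y]
  let ?t = "\<lambda>g. Cmp C (FArr G g) (NCmp \<eta> x)" and ?s = "\<lambda>f. Cmp D (NCmp \<epsilon> y) (FArr F f)"
  have t: "?t g \<in> hom C x (FObj G y)" if "g \<in> hom D (FObj F x) y" for g
    by (rule Cmp_hom[OF C \<eta> functorD(6)[OF G that]])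
  have s: "?s f \<in> hom D (FObj F x) y" if "f \<in> hom C x (FObj G y)" for f
    by (rule Cmp_hom[OF D functorD(6)[OF F that] \<epsilon>])
  have st: "?s (?t g) = g" if g: "g \<in> hom D (FObj F x) y" for g
  proof -
    note Gg = functorD(6)[OF G g]
    have "?s (?t g) = Cmp D (Cmp D (NCmp \<epsilon> y) (FArr F (FArr G g))) (FArr F (NCmp \<eta> x))"
      by (simp only: functorD(8)[OF F \<eta> Gg]
          Cmp_assoc[OF D functorD(6)[OF F \<eta>] functorD(6)[OF F Gg] \<epsilon>])
    also have "\<dots> = Cmp D g (Cmp D (NCmp \<epsilon> (FObj F x)) (FArr F (NCmp \<eta> x)))"
      by (simp only: A(7)[OF g] Cmp_assoc[OF D functorD(6)[OF F \<eta>] A(5)[OF functorD(5)[OF F x]] g])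
    also have "\<dots> = g"
      by (simp only: A(8)[OF x] Cmp_Ide_right[OF D g])
    finally show ?thesis .
  qed
  have ts: "?t (?s f) = f" if f: "f \<in> hom C x (FObj G y)" for f
  proof -
    note Ff = functorD(6)[OF F f]
    have "?t (?s f) = Cmp C (FArr G (NCmp \<epsilon> y)) (Cmp C (FArr G (FArr F f)) (NCmp \<eta> x))"
      by (simp only: functorD(8)[OF G Ff \<epsilon>]
          Cmp_assoc[OF C \<eta> functorD(6)[OF G Ff] functorD(6)[OF G \<epsilon>]])
    also have "\<dots> = Cmp C (Cmp C (FArr G (NCmp \<epsilon> y)) (NCmp \<eta> (FObj G y))) f"
      by (simp only: A(6)[OF f, symmetric]
          Cmp_assoc[OF C f A(4)[OF functorD(5)[OF G y]] functorD(6)[OF G \<epsilon>]])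
    also have "\<dots> = f"
      by (simp only: A(9)[OF y] Cmp_Ide_left[OF C f])
    finally show ?thesis .
  qed
  show ?thesis
    by (rule bij_betw_byWitness[where f' = ?s]) (use s t st ts in auto)
qed

text \<open>Transposing \<open>F f\<close> along the adjunction gives \<open>\<eta>\<^sub>y \<circ> f\<close>; so \<open>F\<close> is bijective on maps into
  \<open>y\<close> as soon as \<open>\<eta>\<^sub>y\<close> is invertible.\<close>

lemma bij_betw_FArr_if_iso_unit:
  assumes adj: "adjunction F G \<eta> \<epsilon>" and F: "functor_between F C D"
    and x: "x \<in> Obj C" and y: "y \<in> Obj C" and "iso C (NCmp \<eta> y)"
  shows "bij_betw (FArr F) (hom C x y) (hom D (FObj F x) (FObj F y))"
proof -
  note C = functorD(1)[OF F]
  note A = adjunctionD[OF adj F]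
  let ?t = "\<lambda>g. Cmp C (FArr G g) (NCmp \<eta> x)"
  have "bij_betw (\<lambda>f. Cmp C (NCmp \<eta> y) f) (hom C x y) (hom C x (FObj G (FObj F y)))"
    by (rule bij_betw_postcomp_iso[OF C A(4)[OF y] \<open>iso C (NCmp \<eta> y)\<close>])
  then have "bij_betw (?t \<circ> FArr F) (hom C x y) (hom C x (FObj G (FObj F y)))"
    by (rule bij_betw_cong[THEN iffD1, rotated]) (simp add: A(6))
  moreover have "FArr F ` hom C x y \<subseteq> hom D (FObj F x) (FObj F y)"
    using functorD(6)[OF F] by blast
  ultimately show ?thesis
    using bij_betw_comp_iff2[OF bij_betw_transpose[OF adj F x functorD(5)[OF F y]]] by blast
qed

text \<open>The left adjoint sends \<open>x\<close> to the target \<open>R x\<close> of its universal arrow \<open>\<theta> x\<close>.  Its values on arrows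
  and the counit are lifts along the bijections; every equation between arrows out of \<open>R x\<close> holds
  because both sides agree after composition with \<open>\<theta> x\<close>.\<close>

lemma left_adjoint_if_universal_arrows:
  assumes G: "functor_between G D C"
    and univ: "\<And>x. x \<in> Obj C \<Longrightarrow> \<exists>y \<in> Obj D. \<exists>\<theta> \<in> hom C x (FObj G y). \<forall>y' \<in> Obj D.
      bij_betw (\<lambda>h. Cmp C (FArr G h) \<theta>) (hom D y y') (hom C x (FObj G y'))"
  shows "\<exists>F. left_adjoint F G"
proof -
  note D = functorD(1)[OF G] and C = functorD(2)[OF G]
  have "\<forall>x. \<exists>y \<theta>. x \<in> Obj C \<longrightarrow> y \<in> Obj D \<and> \<theta> \<in> hom C x (FObj G y) \<and> (\<forall>y' \<in> Obj D.
      bij_betw (\<lambda>h. Cmp C (FArr G h) \<theta>) (hom D y y') (hom C x (FObj G y')))"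
    using univ by meson
  then obtain R \<theta> where R: "\<And>x. x \<in> Obj C \<Longrightarrow> R x \<in> Obj D"
    and \<theta>: "\<And>x. x \<in> Obj C \<Longrightarrow> \<theta> x \<in> hom C x (FObj G (R x))"
    and bij: "\<And>x y'. x \<in> Obj C \<Longrightarrow> y' \<in> Obj D \<Longrightarrow>
      bij_betw (\<lambda>h. Cmp C (FArr G h) (\<theta> x)) (hom D (R x) y') (hom C x (FObj G y'))"
    by metis
  define lift where
    "lift x y f = the_inv_into (hom D (R x) y) (\<lambda>h. Cmp C (FArr G h) (\<theta> x)) f" for x y f
  have lift: "lift x y f \<in> hom D (R x) y" "Cmp C (FArr G (lift x y f)) (\<theta> x) = f"
    if "x \<in> Obj C" "y \<in> Obj D" "f \<in> hom C x (FObj G y)" for x y f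
    using bij[OF that(1,2)] that(3) the_inv_into_into[of "\<lambda>h. Cmp C (FArr G h) (\<theta> x)"]
      f_the_inv_into_f[of "\<lambda>h. Cmp C (FArr G h) (\<theta> x)"]
    unfolding lift_def bij_betw_def by auto
  have uniq: "h = k" if "x \<in> Obj C" "h \<in> hom D (R x) y" "k \<in> hom D (R x) y"
      "Cmp C (FArr G h) (\<theta> x) = Cmp C (FArr G k) (\<theta> x)" for x y h k
    using bij[OF that(1) hom_obj(2)[OF D that(2)]] that unfolding bij_betw_def inj_on_def by blast
  define Ra where "Ra f = lift (Dom C f) (R (Cod C f)) (Cmp C (\<theta> (Cod C f)) f)" for f
  have Ra: "Ra f \<in> hom D (R x) (R y)" "Cmp C (FArr G (Ra f)) (\<theta> x) = Cmp C (\<theta> y) f"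
    if f: "f \<in> hom C x y" for f x y
    using lift[OF hom_obj(1)[OF C f] R[OF hom_obj(2)[OF C f]] Cmp_hom[OF C f \<theta>[OF hom_obj(2)[OF C f]]]] f
    by (simp_all add: Ra_def hom_iff)
  define F where "F = \<lparr>FSrc = C, FTgt = D, FObj = restrict R (Obj C), FArr = restrict Ra (Arr C)\<rparr>"
  have FObj: "FObj F x = R x" if "x \<in> Obj C" for x
    using that by (simp add: F_def)
  have FArr: "FArr F f = Ra f" if "f \<in> hom C x y" for f x y
    using that by (simp add: F_def hom_iff)
  have F: "functor_between F C D"
  proof (rule functorI[OF C D])
    fix x assume x: "x \<in> Obj C"
    have "Ra (Ide C x) = Ide D (R x)"
      by (rule uniq[OF x Ra(1)[OF Ide_hom[OF C x]] Ide_hom[OF D R[OF x]]])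
        (simp only: Ra(2)[OF Ide_hom[OF C x]] functorD(7)[OF G R[OF x]]
          Cmp_Ide_left[OF C \<theta>[OF x]] Cmp_Ide_right[OF C \<theta>[OF x]])
    then show "FArr F (Ide C x) = Ide D (FObj F x)"
      by (simp only: FArr[OF Ide_hom[OF C x]] FObj[OF x])
  next
    fix f g x y z assume f: "f \<in> hom C x y" and g: "g \<in> hom C y z"
    note x = hom_obj(1)[OF C f] and y = hom_obj(2)[OF C f] and z = hom_obj(2)[OF C g]
    note gf = Cmp_hom[OF C f g]
    have "Cmp C (FArr G (Ra (Cmp C g f))) (\<theta> x) = Cmp C (Cmp C (\<theta> z) g) f"
      by (simp only: Ra(2)[OF gf] Cmp_assoc[OF C f g \<theta>[OF z]])
    also have "\<dots> = Cmp C (FArr G (Ra g)) (Cmp C (\<theta> y) f)"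
      by (simp only: Ra(2)[OF g, symmetric] Cmp_assoc[OF C f \<theta>[OF y] functorD(6)[OF G Ra(1)[OF g]]])
    also have "\<dots> = Cmp C (FArr G (Cmp D (Ra g) (Ra f))) (\<theta> x)"
      by (simp only: Ra(2)[OF f, symmetric] functorD(8)[OF G Ra(1)[OF f] Ra(1)[OF g]]
          Cmp_assoc[OF C \<theta>[OF x] functorD(6)[OF G Ra(1)[OF f]] functorD(6)[OF G Ra(1)[OF g]]])
    finally have "Ra (Cmp C g f) = Cmp D (Ra g) (Ra f)"
      by (rule uniq[OF x Ra(1)[OF gf] Cmp_hom[OF D Ra(1)[OF f] Ra(1)[OF g]]])
    then show "FArr F (Cmp C g f) = Cmp D (FArr F g) (FArr F f)"
      by (simp only: FArr[OF f] FArr[OF g] FArr[OF gf])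
  next
    fix f x y assume f: "f \<in> hom C x y"
    show "FArr F f \<in> hom D (FObj F x) (FObj F y)"
      using Ra(1)[OF f] by (simp only: FArr[OF f] FObj[OF hom_obj(1)[OF C f]] FObj[OF hom_obj(2)[OF C f]])
  qed (simp_all add: F_def R)
  note FG = functor_comp[OF G F] and GF = functor_comp[OF F G]
  note idC = functor_id_func[OF C] and idD = functor_id_func[OF D]
  define \<eta> where "\<eta> = \<lparr>NSrc = id_func C, NTgt = G \<circ>\<^sub>F F, NCmp = restrict \<theta> (Obj C)\<rparr>"
  have \<eta>x: "NCmp \<eta> x = \<theta> x" if "x \<in> Obj C" for x
    using that by (simp add: \<eta>_def)
  have \<eta>: "nat_between \<eta> (id_func C) (G \<circ>\<^sub>F F)"
  proof (rule nat_betweenI[OF idC GF])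
    fix x assume x: "x \<in> Obj C"
    show "NCmp \<eta> x \<in> hom C (FObj (id_func C) x) (FObj (G \<circ>\<^sub>F F) x)"
      using \<theta>[OF x] by (simp add: \<eta>x x FObj_comp[OF F x] FObj)
  next
    fix f x y assume f: "f \<in> hom C x y"
    show "Cmp C (NCmp \<eta> y) (FArr (id_func C) f) = Cmp C (FArr (G \<circ>\<^sub>F F) f) (NCmp \<eta> x)"
      using Ra(2)[OF f] by (simp add: \<eta>x hom_obj[OF C f] FArr_comp[OF F f] FArr[OF f]
          id_func_simps(4)[OF f])
  qed (simp_all add: \<eta>_def)
  define e where "e y = lift (FObj G y) y (Ide C (FObj G y))" for y
  have e: "e y \<in> hom D (R (FObj G y)) y" "Cmp C (FArr G (e y)) (\<theta> (FObj G y)) = Ide C (FObj G y)"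
    if "y \<in> Obj D" for y
    using lift[OF functorD(5)[OF G that] that Ide_hom[OF C functorD(5)[OF G that]]]
    by (simp_all add: e_def)
  define \<epsilon> where "\<epsilon> = \<lparr>NSrc = F \<circ>\<^sub>F G, NTgt = id_func D, NCmp = restrict e (Obj D)\<rparr>"
  have \<epsilon>y: "NCmp \<epsilon> y = e y" if "y \<in> Obj D" for y
    using that by (simp add: \<epsilon>_def)
  have \<epsilon>: "nat_between \<epsilon> (F \<circ>\<^sub>F G) (id_func D)"
  proof (rule nat_betweenI[OF FG idD])
    fix y assume y: "y \<in> Obj D"
    show "NCmp \<epsilon> y \<in> hom D (FObj (F \<circ>\<^sub>F G) y) (FObj (id_func D) y)"
      using e(1)[OF y] by (simp add: \<epsilon>y y FObj_comp[OF G y] FObj functorD(5)[OF G])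
  next
    fix g y y' assume g: "g \<in> hom D y y'"
    note y = hom_obj(1)[OF D g] and y' = hom_obj(2)[OF D g]
    note Gy = functorD(5)[OF G y] and Gy' = functorD(5)[OF G y'] and Gg = functorD(6)[OF G g]
    note RGg = Ra(1)[OF Gg]
    have "Cmp C (FArr G (Cmp D (e y') (Ra (FArr G g)))) (\<theta> (FObj G y))
        = Cmp C (FArr G (e y')) (Cmp C (\<theta> (FObj G y')) (FArr G g))"
      by (simp only: functorD(8)[OF G RGg e(1)[OF y']] Ra(2)[OF Gg, symmetric]
          Cmp_assoc[OF C \<theta>[OF Gy] functorD(6)[OF G RGg] functorD(6)[OF G e(1)[OF y']]])
    also have "\<dots> = FArr G g"
      by (simp only: Cmp_assoc[OF C Gg \<theta>[OF Gy'] functorD(6)[OF G e(1)[OF y']]] e(2)[OF y']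
          Cmp_Ide_left[OF C Gg])
    also have "\<dots> = Cmp C (FArr G (Cmp D g (e y))) (\<theta> (FObj G y))"
      by (simp only: functorD(8)[OF G e(1)[OF y] g] e(2)[OF y] Cmp_Ide_right[OF C Gg]
          Cmp_assoc[OF C \<theta>[OF Gy] functorD(6)[OF G e(1)[OF y]] Gg, symmetric])
    finally have "Cmp D (e y') (Ra (FArr G g)) = Cmp D g (e y)"
      by (rule uniq[OF Gy Cmp_hom[OF D RGg e(1)[OF y']] Cmp_hom[OF D e(1)[OF y] g]])
    then show "Cmp D (NCmp \<epsilon> y') (FArr (F \<circ>\<^sub>F G) g) = Cmp D (FArr (id_func D) g) (NCmp \<epsilon> y)"
      by (simp only: \<epsilon>y[OF y] \<epsilon>y[OF y'] FArr_comp[OF G g] FArr[OF Gg] id_func_simps(4)[OF g])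
  qed (simp_all add: \<epsilon>_def FG[THEN functorD(3)])
  have "adjunction F G \<eta> \<epsilon>"
  proof (rule adjunctionI[OF F G \<eta> \<epsilon>])
    fix y assume y: "y \<in> Obj D"
    show "Cmp C (FArr G (NCmp \<epsilon> y)) (NCmp \<eta> (FObj G y)) = Ide C (FObj G y)"
      by (simp only: \<epsilon>y[OF y] \<eta>x[OF functorD(5)[OF G y]] e(2)[OF y])
  next
    fix x assume x: "x \<in> Obj C"
    note Rx = R[OF x] and GRx = functorD(5)[OF G R[OF x]] and t = \<theta>[OF x]
    note Rt = Ra(1)[OF t]
    have "Cmp C (FArr G (Cmp D (e (R x)) (Ra (\<theta> x)))) (\<theta> x)
        = Cmp C (FArr G (e (R x))) (Cmp C (\<theta> (FObj G (R x))) (\<theta> x))"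
      by (simp only: functorD(8)[OF G Rt e(1)[OF Rx]] Ra(2)[OF t, symmetric]
          Cmp_assoc[OF C t functorD(6)[OF G Rt] functorD(6)[OF G e(1)[OF Rx]]])
    also have "\<dots> = Cmp C (FArr G (Ide D (R x))) (\<theta> x)"
      by (simp only: Cmp_assoc[OF C t \<theta>[OF GRx] functorD(6)[OF G e(1)[OF Rx]]] e(2)[OF Rx]
          functorD(7)[OF G Rx])
    finally have "Cmp D (e (R x)) (Ra (\<theta> x)) = Ide D (R x)"
      by (rule uniq[OF x Cmp_hom[OF D Rt e(1)[OF Rx]] Ide_hom[OF D Rx]])
    then show "Cmp D (NCmp \<epsilon> (FObj F x)) (FArr F (NCmp \<eta> x)) = Ide D (FObj F x)"
      by (simp only: FObj[OF x] \<epsilon>y[OF Rx] \<eta>x[OF x] FArr[OF t])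
  qed
  then show ?thesis
    unfolding left_adjoint_def by blast
qed


section \<open>A criterion for further adjoints\<close>

text \<open>In the application \<open>il\<close>, \<open>istar\<close> stand for \<open>i\<^sub>!\<close>, \<open>i\<^sup>*\<close>, the functors \<open>zs\<close>, \<open>zr\<close> for \<open>z\<^sup>*\<close>, \<open>z\<^sub>*\<close>, and
  \<open>rl\<close>, \<open>rs\<close> for \<open>r\<^sub>!\<close>, \<open>r\<^sup>*\<close>.  Put \<open>W = r\<^sub>! z\<^sub>* X\<close>.  The object \<open>i\<^sup>* W\<close> corepresents
  \<open>Y \<mapsto> hom X (i\<^sub>! Y)\<close> because of the natural bijections
  \<open>hom (i\<^sup>* W) Y \<cong> hom (i\<^sub>! i\<^sup>* W) (i\<^sub>! Y) \<cong> hom W (i\<^sub>! Y) \<cong> hom (z\<^sub>* X) (r\<^sup>* i\<^sub>! Y)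
    \<cong> hom (z\<^sup>* z\<^sub>* X) (z\<^sup>* r\<^sup>* i\<^sub>! Y) \<cong> hom X (i\<^sub>! Y)\<close>.
  They come from, in this order: \<open>i\<^sub>!\<close> is fully faithful; the counit at \<open>W\<close> is invertible; \<open>r\<^sub>!\<close> is
  left adjoint to \<open>r\<^sup>*\<close>; the unit of \<open>z\<^sup>* \<stileturn> z\<^sub>*\<close> at \<open>r\<^sup>* i\<^sub>! Y\<close> is invertible; \<open>z\<^sub>*\<close> is fully faithful
  and \<open>z\<^sup>* r\<^sup>*\<close> is the identity.\<close>

theorem left_adjoint_of_extension:
  assumes i: "adjunction il istar \<eta> \<epsilon>" and il: "functor_between il CJ CK"
    and z: "adjunction zs zr \<eta>z \<epsilon>z" and zs: "functor_between zs CL CK"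
    and r: "adjunction rl rs \<eta>r \<epsilon>r" and rl: "functor_between rl CL CK"
    and zs_rs: "zs \<circ>\<^sub>F rs = id_func CK"
    and \<eta>_iso: "\<And>Y. Y \<in> Obj CJ \<Longrightarrow> iso CJ (NCmp \<eta> Y)"
    and \<epsilon>z_iso: "\<And>X. X \<in> Obj CK \<Longrightarrow> iso CK (NCmp \<epsilon>z X)"
    and \<eta>z_iso: "\<And>Y. Y \<in> Obj CJ \<Longrightarrow> iso CL (NCmp \<eta>z (FObj rs (FObj il Y)))"
    and \<epsilon>_iso: "\<And>X. X \<in> Obj CK \<Longrightarrow> iso CK (NCmp \<epsilon> (FObj rl (FObj zr X)))"
  shows "\<exists>F. left_adjoint F il"
proof (rule left_adjoint_if_universal_arrows[OF il])
  note CJ = functorD(1)[OF il] and CK = functorD(2)[OF il] and CL = functorD(1)[OF zs]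
  note Ai = adjunctionD[OF i il] and Az = adjunctionD[OF z zs] and Ar = adjunctionD[OF r rl]
  note istar = Ai(1) and zr = Az(1) and rs = Ar(1)
  have zs_rs_Obj: "FObj zs (FObj rs X) = X" if "X \<in> Obj CK" for X
    using FObj_comp[OF rs that, of zs] that by (simp add: zs_rs)
  have zs_rs_Arr: "FArr zs (FArr rs f) = f" if "f \<in> hom CK X Y" for f X Y
    using FArr_comp[OF rs that, of zs] id_func_simps(4)[OF that] by (simp add: zs_rs)
  fix X assume X: "X \<in> Obj CK"
  define V where "V = FObj zr X"
  define W where "W = FObj rl V"
  have V: "V \<in> Obj CL" and W: "W \<in> Obj CK" and isW: "FObj istar W \<in> Obj CJ"
    using functorD(5)[OF zr X] functorD(5)[OF rl] functorD(5)[OF istar] by (simp_all add: V_def W_def)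
  have \<epsilon>X: "NCmp \<epsilon>z X \<in> hom CK (FObj zs V) X" and \<epsilon>W: "NCmp \<epsilon> W \<in> hom CK (FObj il (FObj istar W)) W"
    and \<eta>V: "NCmp \<eta>r V \<in> hom CL V (FObj rs W)"
    using Az(5)[OF X] Ai(5)[OF W] Ar(4)[OF V] by (simp_all add: V_def W_def)
  obtain a where a: "a \<in> hom CK X (FObj zs V)" "iso CK a"
    using \<epsilon>z_iso[OF X] \<epsilon>X by (auto simp: iso_hom_iff)
  obtain b where b: "b \<in> hom CK W (FObj il (FObj istar W))" "iso CK b"
    using \<epsilon>_iso[OF X] \<epsilon>W by (auto simp: iso_hom_iff V_def W_def)
  have z\<eta>: "FArr zs (NCmp \<eta>r V) \<in> hom CK (FObj zs V) W"
    using functorD(6)[OF zs \<eta>V] zs_rs_Obj[OF W] by simp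
  \<comment> \<open>\<open>X \<cong> z\<^sup>* z\<^sub>* X \<rightarrow> z\<^sup>* r\<^sup>* W = W \<cong> i\<^sub>! i\<^sup>* W\<close>\<close>
  define \<theta> where "\<theta> = Cmp CK b (Cmp CK (FArr zs (NCmp \<eta>r V)) a)"
  have \<theta>: "\<theta> \<in> hom CK X (FObj il (FObj istar W))"
    unfolding \<theta>_def by (rule Cmp_hom[OF CK Cmp_hom[OF CK a(1) z\<eta>] b(1)])
  have "bij_betw (\<lambda>h. Cmp CK (FArr il h) \<theta>) (hom CJ (FObj istar W) Y) (hom CK X (FObj il Y))"
    if Y: "Y \<in> Obj CJ" for Y
  proof -
    note ilY = functorD(5)[OF il Y] and rsY = functorD(5)[OF rs functorD(5)[OF il Y]]
    have "bij_betw (FArr il) (hom CJ (FObj istar W) Y) (hom CK (FObj il (FObj istar W)) (FObj il Y))"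
      by (rule bij_betw_FArr_if_iso_unit[OF i il isW Y \<eta>_iso[OF Y]])
    moreover have "bij_betw (\<lambda>g. Cmp CK g b)
        (hom CK (FObj il (FObj istar W)) (FObj il Y)) (hom CK W (FObj il Y))"
      by (rule bij_betw_precomp_iso[OF CK b])
    moreover have "bij_betw (\<lambda>g. Cmp CL (FArr rs g) (NCmp \<eta>r V))
        (hom CK W (FObj il Y)) (hom CL V (FObj rs (FObj il Y)))"
      unfolding W_def by (rule bij_betw_transpose[OF r rl V ilY])
    moreover have "bij_betw (FArr zs) (hom CL V (FObj rs (FObj il Y))) (hom CK (FObj zs V) (FObj il Y))"
      using bij_betw_FArr_if_iso_unit[OF z zs V rsY \<eta>z_iso[OF Y]] by (simp add: zs_rs_Obj[OF ilY])
    moreover have "bij_betw (\<lambda>g. Cmp CK g a) (hom CK (FObj zs V) (FObj il Y)) (hom CK X (FObj il Y))"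
      by (rule bij_betw_precomp_iso[OF CK a])
    ultimately have "bij_betw ((\<lambda>g. Cmp CK g a) \<circ> (FArr zs \<circ> ((\<lambda>g. Cmp CL (FArr rs g) (NCmp \<eta>r V)) \<circ>
        ((\<lambda>g. Cmp CK g b) \<circ> FArr il)))) (hom CJ (FObj istar W) Y) (hom CK X (FObj il Y))"
      by (blast intro: bij_betw_trans)
    then show ?thesis
    proof (rule bij_betw_cong[THEN iffD1, rotated])
      fix h assume h: "h \<in> hom CJ (FObj istar W) Y"
      note ilh = functorD(6)[OF il h]
      note hb = Cmp_hom[OF CK b(1) ilh]
      note a = a(1) and b = b(1)
      have "FArr zs (Cmp CL (FArr rs (Cmp CK (FArr il h) b)) (NCmp \<eta>r V))
          = Cmp CK (Cmp CK (FArr il h) b) (FArr zs (NCmp \<eta>r V))"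
        by (simp only: functorD(8)[OF zs \<eta>V functorD(6)[OF rs hb]] zs_rs_Arr[OF hb])
      then show "((\<lambda>g. Cmp CK g a) \<circ> (FArr zs \<circ> ((\<lambda>g. Cmp CL (FArr rs g) (NCmp \<eta>r V)) \<circ>
          ((\<lambda>g. Cmp CK g b) \<circ> FArr il)))) h = Cmp CK (FArr il h) \<theta>"
        by (simp only: comp_apply \<theta>_def Cmp_assoc[OF CK a z\<eta> hb, symmetric]
            Cmp_assoc[OF CK Cmp_hom[OF CK a z\<eta>] b ilh])
    qed
  qed
  then show "\<exists>y \<in> Obj CJ. \<exists>\<theta> \<in> hom CK X (FObj il y). \<forall>y' \<in> Obj CJ.
      bij_betw (\<lambda>h. Cmp CK (FArr il h) \<theta>) (hom CJ y y') (hom CK X (FObj il y'))"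
    using isW \<theta> by blast
qed


subsection \<open>Opposite categories\<close>

text \<open>The dual criterion follows by passing to the opposites of the value categories; the indexing
  categories stay as they are.\<close>

definition op_cat :: "('o, 'a) cat \<Rightarrow> ('o, 'a) cat" where
  "op_cat C = \<lparr>Obj = Obj C, Arr = Arr C, Dom = Cod C, Cod = Dom C, Ide = Ide C,
     Cmp = (\<lambda>g f. Cmp C f g)\<rparr>"

definition op_func :: "('o, 'a, 'p, 'b) func \<Rightarrow> ('o, 'a, 'p, 'b) func" where
  "op_func F = \<lparr>FSrc = op_cat (FSrc F), FTgt = op_cat (FTgt F), FObj = FObj F, FArr = FArr F\<rparr>"

definition op_nat :: "('o, 'a, 'p, 'b) nat_transf \<Rightarrow> ('o, 'a, 'p, 'b) nat_transf" where
  "op_nat \<alpha> = \<lparr>NSrc = op_func (NTgt \<alpha>), NTgt = op_func (NSrc \<alpha>), NCmp = NCmp \<alpha>\<rparr>"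

lemma op_simps [simp]:
  "Obj (op_cat C) = Obj C" "Arr (op_cat C) = Arr C" "Ide (op_cat C) = Ide C"
  "Cmp (op_cat C) g f = Cmp C f g" "hom (op_cat C) x y = hom C y x"
  "FObj (op_func F) = FObj F" "FArr (op_func F) = FArr F" "NCmp (op_nat \<alpha>) = NCmp \<alpha>"
  "op_cat (op_cat C) = C" "op_func (op_func F) = F"
  by (auto simp: op_cat_def op_func_def op_nat_def hom_def)

lemma iso_op [simp]: "iso (op_cat C) f \<longleftrightarrow> iso C f"
  unfolding iso_def by (auto simp: op_cat_def hom_def)

lemma category_op:
  assumes "category C"
  shows "category (op_cat C)"
  using assms unfolding category_def op_simps by (auto simp: op_cat_def)

lemma functor_op:
  assumes F: "functor_between F C D"
  shows "functor_between (op_func F) (op_cat C) (op_cat D)"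
proof (rule functorI[OF category_op[OF functorD(1)[OF F]] category_op[OF functorD(2)[OF F]]])
  show "FObj (op_func F) \<in> extensional (Obj (op_cat C))" "FArr (op_func F) \<in> extensional (Arr (op_cat C))"
    using F by (auto simp: functor_between_def is_functor_def PiE_iff)
qed (simp_all add: functorD[OF F], simp_all add: op_func_def functorD[OF F])

lemma op_id_func: "op_func (id_func C) = id_func (op_cat C)"
  by (simp add: op_func_def id_func_def)

lemma op_comp_func: "op_func (G \<circ>\<^sub>F F) = op_func G \<circ>\<^sub>F op_func F"
  by (simp add: op_func_def comp_func_def)

lemma nat_op:
  assumes \<alpha>: "nat_between \<alpha> F G" and F: "functor_between F C D"
  shows "nat_between (op_nat \<alpha>) (op_func G) (op_func F)"
proof (rule nat_betweenI[OF functor_op[OF nat_betweenD(1)[OF \<alpha> F]] functor_op[OF F]])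
  show "NCmp (op_nat \<alpha>) \<in> extensional (Obj (op_cat C))"
    using \<alpha> functorD(3)[OF F] by (auto simp: nat_between_def is_nat_def Let_def)
qed (simp_all add: nat_betweenD[OF \<alpha> F], simp_all add: op_nat_def nat_betweenD[OF \<alpha> F])

lemma adjunction_op:
  assumes adj: "adjunction F G \<eta> \<epsilon>" and F: "functor_between F C D"
  shows "adjunction (op_func G) (op_func F) (op_nat \<epsilon>) (op_nat \<eta>)"
proof (rule adjunctionI)
  note A = adjunctionD[OF adj F]
  note C = functorD(1)[OF F]
  show "functor_between (op_func G) (op_cat D) (op_cat C)" "functor_between (op_func F) (op_cat C) (op_cat D)"
    by (rule functor_op[OF A(1)] functor_op[OF F])+
  show "nat_between (op_nat \<epsilon>) (id_func (op_cat D)) (op_func F \<circ>\<^sub>F op_func G)"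
    using nat_op[OF A(3) functor_comp[OF A(1) F]] by (simp add: op_id_func op_comp_func)
  show "nat_between (op_nat \<eta>) (op_func G \<circ>\<^sub>F op_func F) (id_func (op_cat C))"
    using nat_op[OF A(2) functor_id_func[OF C]] by (simp add: op_id_func op_comp_func)
qed (simp_all add: adjunctionD(8,9)[OF adj F])

theorem right_adjoint_of_extension:
  assumes i: "adjunction istar ir \<eta> \<epsilon>" and istar: "functor_between istar CK CJ"
    and z: "adjunction zl zs \<eta>z \<epsilon>z" and zl: "functor_between zl CK CL"
    and r: "adjunction rs rr \<eta>r \<epsilon>r" and rs: "functor_between rs CK CL"
    and zs_rs: "zs \<circ>\<^sub>F rs = id_func CK"
    and \<epsilon>_iso: "\<And>Y. Y \<in> Obj CJ \<Longrightarrow> iso CJ (NCmp \<epsilon> Y)"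
    and \<eta>z_iso: "\<And>X. X \<in> Obj CK \<Longrightarrow> iso CK (NCmp \<eta>z X)"
    and \<epsilon>z_iso: "\<And>Y. Y \<in> Obj CJ \<Longrightarrow> iso CL (NCmp \<epsilon>z (FObj rs (FObj ir Y)))"
    and \<eta>_iso: "\<And>X. X \<in> Obj CK \<Longrightarrow> iso CK (NCmp \<eta> (FObj rr (FObj zl X)))"
  shows "\<exists>G. left_adjoint ir G"
proof -
  have "\<exists>F. left_adjoint F (op_func ir)"
  proof (rule left_adjoint_of_extension)
    show "adjunction (op_func ir) (op_func istar) (op_nat \<epsilon>) (op_nat \<eta>)"
      by (rule adjunction_op[OF i istar])
    show "adjunction (op_func zs) (op_func zl) (op_nat \<epsilon>z) (op_nat \<eta>z)"
      by (rule adjunction_op[OF z zl])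
    show "adjunction (op_func rr) (op_func rs) (op_nat \<epsilon>r) (op_nat \<eta>r)"
      by (rule adjunction_op[OF r rs])
    show "functor_between (op_func ir) (op_cat CJ) (op_cat CK)"
      "functor_between (op_func zs) (op_cat CL) (op_cat CK)"
      "functor_between (op_func rr) (op_cat CL) (op_cat CK)"
      by (rule functor_op adjunctionD(1)[OF i istar] adjunctionD(1)[OF z zl] adjunctionD(1)[OF r rs])+
    show "op_func zs \<circ>\<^sub>F op_func rs = id_func (op_cat CK)"
      using zs_rs by (simp add: op_comp_func[symmetric] op_id_func)
  qed (simp_all add: \<epsilon>_iso \<eta>z_iso \<epsilon>z_iso \<eta>_iso)
  then obtain F \<alpha> \<beta> where adj: "adjunction F (op_func ir) \<alpha> \<beta>"
    unfolding left_adjoint_def by blast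
  then have "functor_between F (FSrc F) (FTgt F)"
    by (simp add: adjunction_def)
  from adjunction_op[OF adj this] show ?thesis
    unfolding left_adjoint_def by auto
qed


section \<open>Small categories\<close>

lemma square_eqpoll: "infinite A \<Longrightarrow> A \<times> A \<approx> A"
  by (simp add: eqpoll_iff_card_of_ordIso card_of_Times_same_infinite)

lemma lepoll_linear: "A \<lesssim> B \<or> B \<lesssim> A"
  using ordLeq_total[OF card_of_Well_order card_of_Well_order, of A B]
  by (simp add: lepoll_def card_of_ordLeq)

text \<open>The cardinality of \<open>C\<close> may be singular or a successor: the product is bounded by the square of the
  larger factor, which is finite or equipollent to that factor.\<close>

lemma Times_lesspoll:
  assumes C: "infinite C" and A: "A \<prec> C" and B: "B \<prec> C"
  shows "A \<times> B \<prec> C"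
proof -
  have square: "S \<times> S \<prec> C" if S: "S \<prec> C" for S :: "'s set"
  proof (cases "finite S")
    case True
    then show ?thesis
      using C by (simp add: finite_lesspoll_infinite)
  next
    case False
    then show ?thesis
      using eq_lesspoll_trans[OF square_eqpoll S] by simp
  qed
  consider "A \<lesssim> B" | "B \<lesssim> A"
    using lepoll_linear by blast
  then show ?thesis
  proof cases
    case 1
    then show ?thesis
      using lesspoll_trans1[OF times_lepoll_mono[OF 1 lepoll_refl] square[OF B]] by simp
  next
    case 2
    then show ?thesis
      using lesspoll_trans1[OF times_lepoll_mono[OF lepoll_refl 2] square[OF A]] by simp
  qed
qed

lemma subset_image_lesspoll: "B \<subseteq> f ` A \<Longrightarrow> A \<prec> C \<Longrightarrow> B \<prec> C"
  using lesspoll_trans1 subset_image_lepoll by blast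

lemma upair_inject:
  assumes "infinite (UNIV :: 'u set)"
  shows "upair x y = upair x' (y' :: 'u) \<longleftrightarrow> x = x' \<and> y = y'"
proof -
  have "\<exists>c :: 'u \<times> 'u \<Rightarrow> 'u. inj c"
    using square_eqpoll[OF assms] by (auto simp: eqpoll_def bij_betw_def)
  then have "inj (SOME c :: 'u \<times> 'u \<Rightarrow> 'u. inj c)"
    by (rule someI_ex)
  then show ?thesis
    by (auto simp: upair_def inj_eq)
qed

lemma ufst_upair: "infinite (UNIV :: 'u set) \<Longrightarrow> ufst (upair x (y :: 'u)) = x"
  by (simp add: ufst_def upair_inject)

lemma usnd_upair: "infinite (UNIV :: 'u set) \<Longrightarrow> usnd (upair x (y :: 'u)) = y"
  by (simp add: usnd_def upair_inject)

lemma utag_inject: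
  assumes "infinite (UNIV :: 'u set)"
  shows "(utag b :: 'u) = utag b' \<longleftrightarrow> b = b'"
proof -
  obtain x y :: 'u where "x \<noteq> y"
    using assms by (metis (full_types) UNIV_I finite.emptyI finite.insertI finite_subset insertI1 subsetI)
  then have "inj (\<lambda>b. if b then x else y)"
    by (auto simp: inj_def)
  then have "inj (utag :: bool \<Rightarrow> 'u)"
    unfolding utag_def by (rule someI[where P = inj])
  then show ?thesis
    by (rule inj_eq)
qed

lemma small_catD: "small_cat J \<Longrightarrow> category J"
  by (simp add: small_cat_def)

lemma small_funcD:
  "small_func u J K \<Longrightarrow> functor_between u J K" "small_func u J K \<Longrightarrow> small_cat J"
  "small_func u J K \<Longrightarrow> small_cat K"
  by (simp_all add: small_func_def)

lemma small_id_func: "small_cat J \<Longrightarrow> small_func (id_func J) J J"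
  by (simp add: small_func_def functor_id_func small_catD)

lemma small_comp_func: "small_func u J K \<Longrightarrow> small_func v K L \<Longrightarrow> small_func (v \<circ>\<^sub>F u) J L"
  by (auto simp: small_func_def intro: functor_comp)

lemma small_empty_cat:
  assumes "infinite (UNIV :: 'u set)"
  shows "small_cat (empty_cat :: 'u scat)"
  using assms by (simp add: small_cat_def category_def empty_cat_def hom_def finite_lesspoll_infinite)

lemma term_cat_simps [simp]:
  "Obj term_cat = {undefined}" "Arr term_cat = {undefined}" "Ide term_cat x = undefined"
  "Cmp term_cat g f = undefined"
  "hom term_cat x y = (if x = undefined \<and> y = undefined then {undefined} else {})"
  by (auto simp: term_cat_def hom_def)

lemma small_term_cat:
  assumes "infinite (UNIV :: 'u set)"
  shows "small_cat (term_cat :: 'u scat)"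
proof -
  have "category (term_cat :: 'u scat)"
    unfolding category_def by (auto simp: PiE_iff extensional_def) (simp_all add: term_cat_def fun_eq_iff)
  then show ?thesis
    using assms by (simp add: small_cat_def finite_lesspoll_infinite)
qed

lemma small_to_term:
  assumes inf: "infinite (UNIV :: 'u set)" and J: "small_cat (J :: 'u scat)"
  shows "small_func (to_term J) J term_cat"
  unfolding small_func_def
proof (intro conjI J small_term_cat[OF inf])
  show "functor_between (to_term J) J term_cat"
    by (rule functorI[OF small_catD[OF J] small_catD[OF small_term_cat[OF inf]]])
      (simp_all add: to_term_def extensional_def)
qed

lemma small_point:
  assumes inf: "infinite (UNIV :: 'u set)" and K: "small_cat (K :: 'u scat)" and k: "k \<in> Obj K"
  shows "small_func (point K k) term_cat K"
  unfolding small_func_def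
proof (intro conjI K small_term_cat[OF inf])
  note cat = small_catD[OF K]
  show "functor_between (point K k) term_cat K"
    by (rule functorI[OF small_catD[OF small_term_cat[OF inf]] cat])
      (use Ide_hom[OF cat k] Cmp_Ide_left[OF cat Ide_hom[OF cat k]] k
        in \<open>auto simp: point_def split: if_splits\<close>)
qed

lemma point_simps [simp]:
  "FSrc (point K k) = term_cat" "FTgt (point K k) = K"
  "FObj (point K k) undefined = k" "FArr (point K k) undefined = Ide K k"
  by (simp_all add: point_def)

lemma comp_point:
  assumes inf: "infinite (UNIV :: 'u set)" and u: "small_func (u :: 'u sfunc) J K" and j: "j \<in> Obj J"
  shows "u \<circ>\<^sub>F point J j = point K (FObj u j)"
proof (rule functor_eqI)
  note u' = small_funcD(1)[OF u] and J = small_funcD(2)[OF u] and K = small_funcD(3)[OF u]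
  note p = small_funcD(1)[OF small_point[OF inf J j]]
  show "functor_between (u \<circ>\<^sub>F point J j) term_cat K"
    by (rule functor_comp[OF p u'])
  show "functor_between (point K (FObj u j)) term_cat K"
    by (rule small_funcD(1)[OF small_point[OF inf K functorD(5)[OF u' j]]])
  show "FObj (u \<circ>\<^sub>F point J j) x = FObj (point K (FObj u j)) x" if "x \<in> Obj term_cat" for x
    using that by (simp add: FObj_comp[OF p])
  show "FArr (u \<circ>\<^sub>F point J j) f = FArr (point K (FObj u j)) f" if "f \<in> hom term_cat x y" for f x y
    using that FArr_comp[OF p that, of u] functorD(7)[OF u' j] by (simp split: if_splits)
qed

lemma to_term_unique:
  assumes inf: "infinite (UNIV :: 'u set)" and u: "functor_between (u :: 'u sfunc) J term_cat"
    and J: "small_cat J"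
  shows "u = to_term J"
proof (rule functor_eqI[OF u small_funcD(1)[OF small_to_term[OF inf J]]])
  show "FObj u x = FObj (to_term J) x" if "x \<in> Obj J" for x
    using functorD(5)[OF u that] by (simp add: to_term_def)
  show "FArr u f = FArr (to_term J) f" if "f \<in> hom J x y" for f x y
    using functorD(6)[OF u that] by (simp add: to_term_def split: if_splits)
qed


subsection \<open>Categories of pairs\<close>

lemma pairs_cat_simps [simp]: "Obj (pairs_cat J Ob R) = Ob"
  by (simp add: pairs_cat_def Let_def)

lemma hom_pairs_cat:
  assumes inf: "infinite (UNIV :: 'u set)"
  shows "a \<in> hom (pairs_cat (J :: 'u scat) Ob R) x y \<longleftrightarrow> x \<in> Ob \<and> y \<in> Ob \<and>
    (\<exists>h \<in> hom J (ufst x) (ufst y). R (usnd x) (usnd y) h \<and> a = upair (upair x y) h)"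
  unfolding hom_iff[of _ "pairs_cat J Ob R"]
  by (auto simp: pairs_cat_def Let_def ufst_upair[OF inf] usnd_upair[OF inf])

lemma hom_pairs_catI:
  assumes "infinite (UNIV :: 'u set)" and "x \<in> Ob" "y \<in> Ob" "h \<in> hom J (ufst x) (ufst (y :: 'u))"
    "R (usnd x) (usnd y) h"
  shows "upair (upair x y) h \<in> hom (pairs_cat J Ob R) x y"
  using assms by (auto simp: hom_pairs_cat)

lemma Cmp_pairs_cat:
  assumes inf: "infinite (UNIV :: 'u set)"
    and "upair (upair x y) h \<in> hom (pairs_cat (J :: 'u scat) Ob R) x y"
    and "upair (upair y z) h' \<in> hom (pairs_cat J Ob R) y z"
  shows "Cmp (pairs_cat J Ob R) (upair (upair y z) h') (upair (upair x y) h)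
    = upair (upair x z) (Cmp J h' h)"
proof -
  have "upair (upair x y) h \<in> Arr (pairs_cat J Ob R)" "upair (upair y z) h' \<in> Arr (pairs_cat J Ob R)"
    using assms by (simp_all add: hom_iff)
  then show ?thesis
    by (simp add: pairs_cat_def Let_def ufst_upair[OF inf] usnd_upair[OF inf])
qed

lemma small_pairs_cat:
  assumes inf: "infinite (UNIV :: 'u set)" and J: "small_cat (J :: 'u scat)"
    and Ob: "\<And>x. x \<in> Ob \<Longrightarrow> ufst x \<in> Obj J" and small: "Ob \<prec> (UNIV :: 'u set)"
    and R_Ide: "\<And>x. x \<in> Ob \<Longrightarrow> R (usnd x) (usnd x) (Ide J (ufst x))"
    and R_Cmp: "\<And>x y z h h'. x \<in> Ob \<Longrightarrow> y \<in> Ob \<Longrightarrow> z \<in> Ob \<Longrightarrow>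
      h \<in> hom J (ufst x) (ufst y) \<Longrightarrow> h' \<in> hom J (ufst y) (ufst z) \<Longrightarrow>
      R (usnd x) (usnd y) h \<Longrightarrow> R (usnd y) (usnd z) h' \<Longrightarrow> R (usnd x) (usnd z) (Cmp J h' h)"
  shows "small_cat (pairs_cat J Ob R)"
proof -
  let ?P = "pairs_cat J Ob R"
  note cat = small_catD[OF J]
  note hom = hom_pairs_cat[OF inf]
  have arr: "f \<in> hom ?P (Dom ?P f) (Cod ?P f)" if "f \<in> Arr ?P" for f
    using that by (simp add: hom_iff)
  have Ide: "Ide ?P x = upair (upair x x) (Ide J (ufst x))" "Ide ?P x \<in> hom ?P x x" if x: "x \<in> Ob" for x
  proof -
    show 1: "Ide ?P x = upair (upair x x) (Ide J (ufst x))"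
      using x by (simp add: pairs_cat_def Let_def)
    show "Ide ?P x \<in> hom ?P x x"
      unfolding 1 by (rule hom_pairs_catI[OF inf x x Ide_hom[OF cat Ob[OF x]], where R = R, OF R_Ide[OF x]])
  qed
  have Cmp: "Cmp ?P g f \<in> hom ?P x z" if "f \<in> hom ?P x y" "g \<in> hom ?P y z" for f g x y z
  proof -
    obtain h where h: "x \<in> Ob" "y \<in> Ob" "h \<in> hom J (ufst x) (ufst y)" "R (usnd x) (usnd y) h"
        "f = upair (upair x y) h"
      using \<open>f \<in> hom ?P x y\<close> hom by blast
    obtain h' where h': "z \<in> Ob" "h' \<in> hom J (ufst y) (ufst z)" "R (usnd y) (usnd z) h'"
        "g = upair (upair y z) h'"
      using \<open>g \<in> hom ?P y z\<close> hom by blast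
    have "Cmp ?P g f = upair (upair x z) (Cmp J h' h)"
      using Cmp_pairs_cat[OF inf] that unfolding h(5) h'(4) .
    then show ?thesis
      using hom_pairs_catI[OF inf h(1) h'(1) Cmp_hom[OF cat h(3) h'(2)], where R = R, OF R_Cmp[OF h(1,2) h'(1) h(3) h'(2) h(4) h'(3)]]
      by simp
  qed
  have unit: "Cmp ?P (Ide ?P y) f = f \<and> Cmp ?P f (Ide ?P x) = f" if f: "f \<in> hom ?P x y" for f x y
  proof -
    obtain h where h: "x \<in> Ob" "y \<in> Ob" "h \<in> hom J (ufst x) (ufst y)" "f = upair (upair x y) h"
      using f hom by blast
    have "upair (upair x y) h \<in> hom ?P x y" "upair (upair x x) (Ide J (ufst x)) \<in> hom ?P x x"
        "upair (upair y y) (Ide J (ufst y)) \<in> hom ?P y y"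
      using f h Ide[of x] Ide[of y] by simp_all
    then show ?thesis
      using h by (simp add: Ide Cmp_pairs_cat[OF inf] Cmp_Ide_left[OF cat h(3)] Cmp_Ide_right[OF cat h(3)])
  qed
  have assoc: "Cmp ?P k (Cmp ?P g f) = Cmp ?P (Cmp ?P k g) f"
    if f: "f \<in> hom ?P w x" and g: "g \<in> hom ?P x y" and k: "k \<in> hom ?P y z" for f g k w x y z
  proof -
    obtain a where a: "a \<in> hom J (ufst w) (ufst x)" "f = upair (upair w x) a"
      using f hom by blast
    obtain b where b: "b \<in> hom J (ufst x) (ufst y)" "g = upair (upair x y) b"
      using g hom by blast
    obtain c where c: "c \<in> hom J (ufst y) (ufst z)" "k = upair (upair y z) c"
      using k hom by blast
    have gf: "Cmp ?P g f = upair (upair w y) (Cmp J b a)" and kg: "Cmp ?P k g = upair (upair x z) (Cmp J c b)"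
      using Cmp_pairs_cat[OF inf f[unfolded a] g[unfolded b]] Cmp_pairs_cat[OF inf g[unfolded b] k[unfolded c]]
      by (simp_all add: a b c)
    have "Cmp ?P k (Cmp ?P g f) = upair (upair w z) (Cmp J c (Cmp J b a))"
      using Cmp_pairs_cat[OF inf Cmp[OF f g, unfolded gf] k[unfolded c]] by (simp only: gf c)
    moreover have "Cmp ?P (Cmp ?P k g) f = upair (upair w z) (Cmp J (Cmp J c b) a)"
      using Cmp_pairs_cat[OF inf f[unfolded a] Cmp[OF g k, unfolded kg]] by (simp only: kg a)
    ultimately show ?thesis
      using Cmp_assoc[OF cat a(1) b(1) c(1)] by simp
  qed
  have "category ?P"
    unfolding category_def
  proof (intro conjI allI ballI impI)
    have "Dom ?P f \<in> Ob" "Cod ?P f \<in> Ob" if "f \<in> Arr ?P" for f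
      using arr[OF that] hom by blast+
    moreover have "Ide ?P x \<in> Arr ?P" if "x \<in> Ob" for x
      using Ide(2)[OF that] by (simp add: hom_iff)
    moreover have "Dom ?P \<in> extensional (Arr ?P)" "Cod ?P \<in> extensional (Arr ?P)"
        "Ide ?P \<in> extensional Ob"
      by (simp_all add: pairs_cat_def Let_def)
    ultimately show "Dom ?P \<in> Arr ?P \<rightarrow>\<^sub>E Obj ?P" "Cod ?P \<in> Arr ?P \<rightarrow>\<^sub>E Obj ?P"
        "Ide ?P \<in> Obj ?P \<rightarrow>\<^sub>E Arr ?P"
      by (simp_all add: PiE_iff)
    fix g f assume "\<not> (f \<in> Arr ?P \<and> g \<in> Arr ?P \<and> Dom ?P g = Cod ?P f)"
    moreover have "Dom ?P g = ufst (ufst g)" if "g \<in> Arr ?P"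
      using that by (simp add: pairs_cat_def Let_def)
    moreover have "Cod ?P f = usnd (ufst f)" if "f \<in> Arr ?P"
      using that by (simp add: pairs_cat_def Let_def)
    ultimately have "\<not> (f \<in> Arr ?P \<and> g \<in> Arr ?P \<and> ufst (ufst g) = usnd (ufst f))"
      by auto
    moreover have "Cmp ?P g f = (if f \<in> Arr ?P \<and> g \<in> Arr ?P \<and> ufst (ufst g) = usnd (ufst f)
        then upair (upair (ufst (ufst f)) (usnd (ufst g))) (Cmp J (usnd g) (usnd f)) else undefined)"
      by (simp add: pairs_cat_def Let_def)
    ultimately show "Cmp ?P g f = undefined"
      by (simp only: if_False)
  next
    fix x assume "x \<in> Obj ?P"
    then show "Ide ?P x \<in> hom ?P x x"
      by (simp add: Ide(2))
  next
    fix x y z f g assume "f \<in> hom ?P x y" "g \<in> hom ?P y z"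
    then show "Cmp ?P g f \<in> hom ?P x z"
      by (rule Cmp)
  next
    fix x y f assume "f \<in> hom ?P x y"
    then show "Cmp ?P (Ide ?P y) f = f" "Cmp ?P f (Ide ?P x) = f"
      using unit by blast+
  next
    fix w x y z f g k assume "f \<in> hom ?P w x" "g \<in> hom ?P x y" "k \<in> hom ?P y z"
    then show "Cmp ?P k (Cmp ?P g f) = Cmp ?P (Cmp ?P k g) f"
      by (rule assoc)
  qed
  moreover have "Arr ?P \<prec> (UNIV :: 'u set)"
  proof (rule subset_image_lesspoll)
    show "Arr ?P \<subseteq> (\<lambda>((x, y), h). upair (upair x y) h) ` ((Ob \<times> Ob) \<times> Arr J)"
      by (force simp: pairs_cat_def Let_def hom_iff)
    show "(Ob \<times> Ob) \<times> Arr J \<prec> (UNIV :: 'u set)"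
      using J by (intro Times_lesspoll inf small) (simp add: small_cat_def)
  qed
  ultimately show ?thesis
    using small by (simp add: small_cat_def)
qed

definition pairs_pr :: "'u scat \<Rightarrow> 'u set \<Rightarrow> ('u \<Rightarrow> 'u \<Rightarrow> 'u \<Rightarrow> bool) \<Rightarrow> 'u sfunc" where
  "pairs_pr J Ob R = \<lparr>FSrc = pairs_cat J Ob R, FTgt = J,
     FObj = restrict ufst Ob, FArr = restrict usnd (Arr (pairs_cat J Ob R))\<rparr>"

lemma FArr_pairs_pr:
  assumes "infinite (UNIV :: 'u set)" "upair (upair x y) h \<in> hom (pairs_cat (J :: 'u scat) Ob R) x y"
  shows "FArr (pairs_pr J Ob R) (upair (upair x y) h) = h"
  using assms by (simp add: pairs_pr_def hom_iff usnd_upair)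

lemma small_pairs_pr:
  assumes inf: "infinite (UNIV :: 'u set)" and J: "small_cat (J :: 'u scat)"
    and Ob: "\<And>x. x \<in> Ob \<Longrightarrow> ufst x \<in> Obj J" and P: "small_cat (pairs_cat J Ob R)"
  shows "small_func (pairs_pr J Ob R) (pairs_cat J Ob R) J"
  unfolding small_func_def
proof (intro conjI J P functorI[OF small_catD[OF P] small_catD[OF J]])
  let ?P = "pairs_cat J Ob R" and ?F = "pairs_pr J Ob R"
  note hom = hom_pairs_cat[OF inf]
  fix f x y assume f: "f \<in> hom ?P x y"
  then obtain h where h: "h \<in> hom J (ufst x) (ufst y)" "f = upair (upair x y) h" "x \<in> Ob" "y \<in> Ob"
    using hom by blast
  have Ff: "FArr ?F f = h"
    using FArr_pairs_pr[OF inf] f h by simp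
  then show "FArr ?F f \<in> hom J (FObj ?F x) (FObj ?F y)"
    using h by (simp add: pairs_pr_def)
  fix g z assume g: "g \<in> hom ?P y z"
  then obtain h' where h': "h' \<in> hom J (ufst y) (ufst z)" "g = upair (upair y z) h'"
    using hom by blast
  have Fg: "FArr ?F g = h'"
    using FArr_pairs_pr[OF inf] g h' by simp
  have gf: "Cmp ?P g f = upair (upair x z) (Cmp J h' h)"
    using Cmp_pairs_cat[OF inf f[unfolded h] g[unfolded h']] by (simp only: h h')
  have "FArr ?F (Cmp ?P g f) = Cmp J h' h"
    unfolding gf by (rule FArr_pairs_pr[OF inf]) (use Cmp_hom[OF small_catD[OF P] f g] gf in simp)
  then show "FArr ?F (Cmp ?P g f) = Cmp J (FArr ?F g) (FArr ?F f)"
    by (simp only: Ff Fg)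
next
  let ?P = "pairs_cat J Ob R" and ?F = "pairs_pr J Ob R"
  fix x assume x: "x \<in> Obj ?P"
  have "Ide ?P x = upair (upair x x) (Ide J (ufst x))"
    using x by (simp add: pairs_cat_def Let_def)
  moreover have "Ide ?P x \<in> hom ?P x x"
    by (rule Ide_hom[OF small_catD[OF P] x])
  ultimately have "FArr ?F (Ide ?P x) = Ide J (ufst x)"
    using FArr_pairs_pr[OF inf] by metis
  then show "FArr ?F (Ide ?P x) = Ide J (FObj ?F x)"
    using x by (simp add: pairs_pr_def)
qed (simp_all add: pairs_pr_def Ob)


subsection \<open>Slice categories\<close>

lemma to_term_simps [simp]: "FObj (to_term J) x = undefined" "FArr (to_term J) f = undefined"
  by (simp_all add: to_term_def)

lemma pairs_cat_empty: "pairs_cat J {} R = empty_cat"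
  by (simp add: pairs_cat_def empty_cat_def Let_def restrict_def)

lemma slice_pr_eq: "slice_pr u k = pairs_pr (FSrc u)
     {upair j f | j f. j \<in> Obj (FSrc u) \<and> f \<in> hom (FTgt u) (FObj u j) k}
     (\<lambda>f f' h. Cmp (FTgt u) f' (FArr u h) = f)"
  by (simp add: slice_pr_def slice_def pairs_pr_def)

lemma coslice_pr_eq: "coslice_pr u k = pairs_pr (FSrc u)
     {upair j f | j f. j \<in> Obj (FSrc u) \<and> f \<in> hom (FTgt u) k (FObj u j)}
     (\<lambda>f f' h. Cmp (FTgt u) (FArr u h) f = f')"
  by (simp add: coslice_pr_def coslice_def pairs_pr_def)

lemma small_slice:
  assumes inf: "infinite (UNIV :: 'u set)" and u: "small_func (u :: 'u sfunc) J K" and k: "k \<in> Obj K"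
  shows "small_cat (slice u k)" "small_func (slice_pr u k) (slice u k) J"
proof -
  note u' = small_funcD(1)[OF u] and J = small_funcD(2)[OF u] and K = small_funcD(3)[OF u]
  note cJ = small_catD[OF J] and cK = small_catD[OF K]
  let ?Ob = "{upair j f | j f. j \<in> Obj J \<and> f \<in> hom K (FObj u j) k}"
  have eq: "slice u k = pairs_cat J ?Ob (\<lambda>f f' h. Cmp K f' (FArr u h) = f)"
    by (simp add: slice_def functorD[OF u'])
  show small: "small_cat (slice u k)"
    unfolding eq
  proof (rule small_pairs_cat[OF inf J])
    show "?Ob \<prec> (UNIV :: 'u set)"
    proof (rule subset_image_lesspoll)
      show "?Ob \<subseteq> (\<lambda>(j, f). upair j f) ` (Obj J \<times> Arr K)"
        by (auto simp: hom_iff)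
      show "Obj J \<times> Arr K \<prec> (UNIV :: 'u set)"
        using J K by (intro Times_lesspoll inf) (simp_all add: small_cat_def)
    qed
    show "Cmp K (usnd x) (FArr u (Ide J (ufst x))) = usnd x" if "x \<in> ?Ob" for x
      using that functorD(7)[OF u'] Cmp_Ide_right[OF cK] by (auto simp: ufst_upair[OF inf] usnd_upair[OF inf])
    fix x y z h h' assume xyz: "x \<in> ?Ob" "y \<in> ?Ob" "z \<in> ?Ob"
      and h: "h \<in> hom J (ufst x) (ufst y)" "h' \<in> hom J (ufst y) (ufst z)"
      and R: "Cmp K (usnd y) (FArr u h) = usnd x" "Cmp K (usnd z) (FArr u h') = usnd y"
    have z: "usnd z \<in> hom K (FObj u (ufst z)) k"
      using xyz(3) by (auto simp: ufst_upair[OF inf] usnd_upair[OF inf])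
    show "Cmp K (usnd z) (FArr u (Cmp J h' h)) = usnd x"
      by (simp only: functorD(8)[OF u' h] R
          Cmp_assoc[OF cK functorD(6)[OF u' h(1)] functorD(6)[OF u' h(2)] z])
  qed (auto simp: ufst_upair[OF inf])
  show "small_func (slice_pr u k) (slice u k) J"
    using small unfolding slice_pr_eq functorD(3,4)[OF u'] eq
    by (intro small_pairs_pr[OF inf J]) (auto simp: ufst_upair[OF inf])
qed

lemma small_coslice:
  assumes inf: "infinite (UNIV :: 'u set)" and u: "small_func (u :: 'u sfunc) J K" and k: "k \<in> Obj K"
  shows "small_cat (coslice u k)" "small_func (coslice_pr u k) (coslice u k) J"
proof -
  note u' = small_funcD(1)[OF u] and J = small_funcD(2)[OF u] and K = small_funcD(3)[OF u]
  note cJ = small_catD[OF J] and cK = small_catD[OF K]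
  let ?Ob = "{upair j f | j f. j \<in> Obj J \<and> f \<in> hom K k (FObj u j)}"
  have eq: "coslice u k = pairs_cat J ?Ob (\<lambda>f f' h. Cmp K (FArr u h) f = f')"
    by (simp add: coslice_def functorD[OF u'])
  show small: "small_cat (coslice u k)"
    unfolding eq
  proof (rule small_pairs_cat[OF inf J])
    show "?Ob \<prec> (UNIV :: 'u set)"
    proof (rule subset_image_lesspoll)
      show "?Ob \<subseteq> (\<lambda>(j, f). upair j f) ` (Obj J \<times> Arr K)"
        by (auto simp: hom_iff)
      show "Obj J \<times> Arr K \<prec> (UNIV :: 'u set)"
        using J K by (intro Times_lesspoll inf) (simp_all add: small_cat_def)
    qed
    show "Cmp K (FArr u (Ide J (ufst x))) (usnd x) = usnd x" if "x \<in> ?Ob" for x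
      using that functorD(7)[OF u'] Cmp_Ide_left[OF cK] by (auto simp: ufst_upair[OF inf] usnd_upair[OF inf])
    fix x y z h h' assume xyz: "x \<in> ?Ob" "y \<in> ?Ob" "z \<in> ?Ob"
      and h: "h \<in> hom J (ufst x) (ufst y)" "h' \<in> hom J (ufst y) (ufst z)"
      and R: "Cmp K (FArr u h) (usnd x) = usnd y" "Cmp K (FArr u h') (usnd y) = usnd z"
    have x: "usnd x \<in> hom K k (FObj u (ufst x))"
      using xyz(1) by (auto simp: ufst_upair[OF inf] usnd_upair[OF inf])
    show "Cmp K (FArr u (Cmp J h' h)) (usnd x) = usnd z"
      by (simp only: functorD(8)[OF u' h] R
          Cmp_assoc[OF cK x functorD(6)[OF u' h(1)] functorD(6)[OF u' h(2)], symmetric])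
  qed (auto simp: ufst_upair[OF inf])
  show "small_func (coslice_pr u k) (coslice u k) J"
    using small unfolding coslice_pr_eq functorD(3,4)[OF u'] eq
    by (intro small_pairs_pr[OF inf J]) (auto simp: ufst_upair[OF inf])
qed

lemma nat_slice_nat:
  assumes inf: "infinite (UNIV :: 'u set)" and u: "small_func (u :: 'u sfunc) J K" and k: "k \<in> Obj K"
  shows "nat_between (slice_nat u k) (u \<circ>\<^sub>F slice_pr u k) (point K k \<circ>\<^sub>F to_term (slice u k))"
proof -
  note u' = small_funcD(1)[OF u] and K = small_funcD(3)[OF u]
  note cK = small_catD[OF K]
  note S = small_slice[OF inf u k]
  note pr = small_funcD(1)[OF S(2)] and p = small_funcD(1)[OF small_to_term[OF inf S(1)]]
    and pt = small_funcD(1)[OF small_point[OF inf K k]]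
  have obj: "Obj (slice u k) = {upair j f | j f. j \<in> Obj J \<and> f \<in> hom K (FObj u j) k}"
    by (simp add: slice_def functorD[OF u'])
  have x: "usnd x \<in> hom K (FObj u (ufst x)) k" if "x \<in> Obj (slice u k)" for x
    using that by (auto simp: obj ufst_upair[OF inf] usnd_upair[OF inf])
  have FObj_pr: "FObj (slice_pr u k) x = ufst x" if "x \<in> Obj (slice u k)" for x
    using that by (simp add: slice_pr_def)
  show ?thesis
  proof (rule nat_betweenI[OF functor_comp[OF pr u'] functor_comp[OF p pt]])
    fix x assume "x \<in> Obj (slice u k)"
    then show "NCmp (slice_nat u k) x
        \<in> hom K (FObj (u \<circ>\<^sub>F slice_pr u k) x) (FObj (point K k \<circ>\<^sub>F to_term (slice u k)) x)"
      using x by (simp add: slice_nat_def FObj_comp[OF pr] FObj_comp[OF p] FObj_pr)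
  next
    fix a x y assume a: "a \<in> hom (slice u k) x y"
    note xy = hom_obj[OF small_catD[OF S(1)] a]
    obtain h where h: "a = upair (upair x y) h" "Cmp K (usnd y) (FArr u h) = usnd x"
      using a by (auto simp: slice_def hom_pairs_cat[OF inf] functorD[OF u'])
    have "FArr (slice_pr u k) a = h"
      using a h by (simp add: slice_pr_eq slice_def FArr_pairs_pr[OF inf])
    then show "Cmp K (NCmp (slice_nat u k) y) (FArr (u \<circ>\<^sub>F slice_pr u k) a)
        = Cmp K (FArr (point K k \<circ>\<^sub>F to_term (slice u k)) a) (NCmp (slice_nat u k) x)"
      using xy by (simp add: slice_nat_def FArr_comp[OF pr a] FArr_comp[OF p a] h(2)
          Cmp_Ide_left[OF cK x])
  qed (simp_all add: slice_nat_def functorD(4)[OF u'])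
qed

lemma nat_coslice_nat:
  assumes inf: "infinite (UNIV :: 'u set)" and u: "small_func (u :: 'u sfunc) J K" and k: "k \<in> Obj K"
  shows "nat_between (coslice_nat u k) (point K k \<circ>\<^sub>F to_term (coslice u k)) (u \<circ>\<^sub>F coslice_pr u k)"
proof -
  note u' = small_funcD(1)[OF u] and K = small_funcD(3)[OF u]
  note cK = small_catD[OF K]
  note S = small_coslice[OF inf u k]
  note pr = small_funcD(1)[OF S(2)] and p = small_funcD(1)[OF small_to_term[OF inf S(1)]]
    and pt = small_funcD(1)[OF small_point[OF inf K k]]
  have obj: "Obj (coslice u k) = {upair j f | j f. j \<in> Obj J \<and> f \<in> hom K k (FObj u j)}"
    by (simp add: coslice_def functorD[OF u'])
  have x: "usnd x \<in> hom K k (FObj u (ufst x))" if "x \<in> Obj (coslice u k)" for x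
    using that by (auto simp: obj ufst_upair[OF inf] usnd_upair[OF inf])
  have FObj_pr: "FObj (coslice_pr u k) x = ufst x" if "x \<in> Obj (coslice u k)" for x
    using that by (simp add: coslice_pr_def)
  show ?thesis
  proof (rule nat_betweenI[OF functor_comp[OF p pt] functor_comp[OF pr u']])
    fix x assume "x \<in> Obj (coslice u k)"
    then show "NCmp (coslice_nat u k) x
        \<in> hom K (FObj (point K k \<circ>\<^sub>F to_term (coslice u k)) x) (FObj (u \<circ>\<^sub>F coslice_pr u k) x)"
      using x by (simp add: coslice_nat_def FObj_comp[OF pr] FObj_comp[OF p] FObj_pr)
  next
    fix a x y assume a: "a \<in> hom (coslice u k) x y"
    note xy = hom_obj[OF small_catD[OF S(1)] a]
    obtain h where h: "a = upair (upair x y) h" "Cmp K (FArr u h) (usnd x) = usnd y"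
      using a by (auto simp: coslice_def hom_pairs_cat[OF inf] functorD[OF u'])
    have "FArr (coslice_pr u k) a = h"
      using a h by (simp add: coslice_pr_eq coslice_def FArr_pairs_pr[OF inf])
    then show "Cmp K (NCmp (coslice_nat u k) y) (FArr (point K k \<circ>\<^sub>F to_term (coslice u k)) a)
        = Cmp K (FArr (u \<circ>\<^sub>F coslice_pr u k) a) (NCmp (coslice_nat u k) x)"
      using xy by (simp add: coslice_nat_def FArr_comp[OF pr a] FArr_comp[OF p a] h(2)
          Cmp_Ide_right[OF cK x])
  qed (simp_all add: coslice_nat_def functorD(4)[OF u'])
qed

lemma empty_slice:
  assumes u: "functor_between u J K" and "\<And>j. j \<in> Obj J \<Longrightarrow> hom K (FObj u j) k = {}"
  shows "slice u k = empty_cat"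
proof -
  have "{upair j f | j f. j \<in> Obj J \<and> f \<in> hom K (FObj u j) k} = {}"
    using assms(2) by auto
  then show ?thesis
    by (simp only: slice_def functorD(3,4)[OF u] pairs_cat_empty)
qed

lemma empty_coslice:
  assumes u: "functor_between u J K" and "\<And>j. j \<in> Obj J \<Longrightarrow> hom K k (FObj u j) = {}"
  shows "coslice u k = empty_cat"
proof -
  have "{upair j f | j f. j \<in> Obj J \<and> f \<in> hom K k (FObj u j)} = {}"
    using assms(2) by auto
  then show ?thesis
    by (simp only: coslice_def functorD(3,4)[OF u] pairs_cat_empty)
qed

text \<open>An object \<open>(j', f)\<close> of the slice maps to \<open>(j, id)\<close> by the arrows \<open>h\<close> with \<open>u h = f\<close>, so bijectivity of
  \<open>u\<close> on arrows into \<open>j\<close> says precisely that \<open>(j, id)\<close> is terminal.\<close>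

lemma slice_terminal:
  assumes inf: "infinite (UNIV :: 'u set)" and u: "small_func (u :: 'u sfunc) J K" and j: "j \<in> Obj J"
    and bij: "\<And>j'. j' \<in> Obj J \<Longrightarrow> bij_betw (FArr u) (hom J j' j) (hom K (FObj u j') (FObj u j))"
  defines "t \<equiv> upair j (Ide K (FObj u j))"
  shows "t \<in> Obj (slice u (FObj u j))"
    and "x \<in> Obj (slice u (FObj u j)) \<Longrightarrow> \<exists>!a. a \<in> hom (slice u (FObj u j)) x t"
proof -
  note u' = small_funcD(1)[OF u]
  note cK = functorD(2)[OF u']
  have Id: "Ide K (FObj u j) \<in> hom K (FObj u j) (FObj u j)"
    by (rule Ide_hom[OF cK functorD(5)[OF u' j]])
  then show t: "t \<in> Obj (slice u (FObj u j))"
    using j by (auto simp: slice_def t_def functorD[OF u'])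
  show "\<exists>!a. a \<in> hom (slice u (FObj u j)) x t" if x: "x \<in> Obj (slice u (FObj u j))"
  proof -
    obtain j' f where f: "j' \<in> Obj J" "f \<in> hom K (FObj u j') (FObj u j)" "x = upair j' f"
      using x by (auto simp: slice_def functorD[OF u'])
    have proj: "ufst x = j'" "usnd x = f" "ufst t = j" "usnd t = Ide K (FObj u j)"
      by (simp_all add: f(3) t_def ufst_upair[OF inf] usnd_upair[OF inf])
    have 1: "a \<in> hom (slice u (FObj u j)) x t \<longleftrightarrow> (\<exists>h \<in> hom J j' j. Cmp K (Ide K (FObj u j)) (FArr u h) = f \<and> a = upair (upair x t) h)" for a
      using x t unfolding slice_def hom_pairs_cat[OF inf] pairs_cat_simps proj functorD(3,4)[OF u']
      by (simp only: simp_thms)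
    have 2: "Cmp K (Ide K (FObj u j)) (FArr u h) = FArr u h" if "h \<in> hom J j' j" for h
      by (rule Cmp_Ide_left[OF cK functorD(6)[OF u' that]])
    obtain h where h: "h \<in> hom J j' j" "FArr u h = f"
      using f(2) unfolding bij_betw_imp_surj_on[OF bij[OF f(1)], symmetric] by blast
    have 3: "h' = h" if "h' \<in> hom J j' j" "FArr u h' = f" for h'
      using inj_onD[OF bij_betw_imp_inj_on[OF bij[OF f(1)]], of h' h] that h by simp
    show ?thesis
    proof (rule ex1I)
      show "upair (upair x t) h \<in> hom (slice u (FObj u j)) x t"
        unfolding 1 using h 2[OF h(1)] by blast
      fix a assume "a \<in> hom (slice u (FObj u j)) x t"
      then obtain h' where h': "h' \<in> hom J j' j" "FArr u h' = f" "a = upair (upair x t) h'"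
        unfolding 1 using 2 by auto
      show "a = upair (upair x t) h"
        unfolding h'(3) 3[OF h'(1,2)] ..
    qed
  qed
qed

lemma coslice_initial:
  assumes inf: "infinite (UNIV :: 'u set)" and u: "small_func (u :: 'u sfunc) J K" and j: "j \<in> Obj J"
    and bij: "\<And>j'. j' \<in> Obj J \<Longrightarrow> bij_betw (FArr u) (hom J j j') (hom K (FObj u j) (FObj u j'))"
  defines "t \<equiv> upair j (Ide K (FObj u j))"
  shows "t \<in> Obj (coslice u (FObj u j))"
    and "x \<in> Obj (coslice u (FObj u j)) \<Longrightarrow> \<exists>!a. a \<in> hom (coslice u (FObj u j)) t x"
proof -
  note u' = small_funcD(1)[OF u]
  note cK = functorD(2)[OF u']
  have Id: "Ide K (FObj u j) \<in> hom K (FObj u j) (FObj u j)"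
    by (rule Ide_hom[OF cK functorD(5)[OF u' j]])
  then show t: "t \<in> Obj (coslice u (FObj u j))"
    using j by (auto simp: coslice_def t_def functorD[OF u'])
  show "\<exists>!a. a \<in> hom (coslice u (FObj u j)) t x" if x: "x \<in> Obj (coslice u (FObj u j))"
  proof -
    obtain j' f where f: "j' \<in> Obj J" "f \<in> hom K (FObj u j) (FObj u j')" "x = upair j' f"
      using x by (auto simp: coslice_def functorD[OF u'])
    have proj: "ufst x = j'" "usnd x = f" "ufst t = j" "usnd t = Ide K (FObj u j)"
      by (simp_all add: f(3) t_def ufst_upair[OF inf] usnd_upair[OF inf])
    have 1: "a \<in> hom (coslice u (FObj u j)) t x \<longleftrightarrow> (\<exists>h \<in> hom J j j'. Cmp K (FArr u h) (Ide K (FObj u j)) = f \<and> a = upair (upair t x) h)" for a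
      using x t unfolding coslice_def hom_pairs_cat[OF inf] pairs_cat_simps proj functorD(3,4)[OF u']
      by (simp only: simp_thms)
    have 2: "Cmp K (FArr u h) (Ide K (FObj u j)) = FArr u h" if "h \<in> hom J j j'" for h
      by (rule Cmp_Ide_right[OF cK functorD(6)[OF u' that]])
    obtain h where h: "h \<in> hom J j j'" "FArr u h = f"
      using f(2) unfolding bij_betw_imp_surj_on[OF bij[OF f(1)], symmetric] by blast
    have 3: "h' = h" if "h' \<in> hom J j j'" "FArr u h' = f" for h'
      using inj_onD[OF bij_betw_imp_inj_on[OF bij[OF f(1)]], of h' h] that h by simp
    show ?thesis
    proof (rule ex1I)
      show "upair (upair t x) h \<in> hom (coslice u (FObj u j)) t x"
        unfolding 1 using h 2[OF h(1)] by blast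
      fix a assume "a \<in> hom (coslice u (FObj u j)) t x"
      then obtain h' where h': "h' \<in> hom J j j'" "FArr u h' = f" "a = upair (upair t x) h'"
        unfolding 1 using 2 by auto
      show "a = upair (upair t x) h"
        unfolding h'(3) 3[OF h'(1,2)] ..
    qed
  qed
qed


subsection \<open>Partial cylinders\<close>

text \<open>The full subcategory of \<open>K \<times> P\<close> on a copy of \<open>K\<close>, tagged \<^term>\<open>True\<close>, and a copy of \<open>A\<close>, tagged
  \<^term>\<open>False\<close>, where \<open>P\<close> is the preorder \<open>le\<close> on the two tags.  If \<open>le True False\<close> holds but not \<open>le False True\<close>, every
  object \<open>a\<close> of \<open>A\<close> has an arrow from its copy in \<open>K\<close> to its second copy, along which it can be
  collapsed to zero by a left Kan extension; in the converse case the arrow goes the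
  other way and serves right Kan extensions.\<close>

definition partial_cylinder :: "(bool \<Rightarrow> bool \<Rightarrow> bool) \<Rightarrow> 'u scat \<Rightarrow> 'u set \<Rightarrow> 'u scat" where
  "partial_cylinder le K A = pairs_cat K
     ((\<lambda>k. upair k (utag True)) ` Obj K \<union> (\<lambda>a. upair a (utag False)) ` A)
     (\<lambda>s t h. le (s = utag True) (t = utag True))"

definition cylinder_pr :: "(bool \<Rightarrow> bool \<Rightarrow> bool) \<Rightarrow> 'u scat \<Rightarrow> 'u set \<Rightarrow> 'u sfunc" where
  "cylinder_pr le K A = pairs_pr K
     ((\<lambda>k. upair k (utag True)) ` Obj K \<union> (\<lambda>a. upair a (utag False)) ` A)
     (\<lambda>s t h. le (s = utag True) (t = utag True))"

definition cylinder_in :: "(bool \<Rightarrow> bool \<Rightarrow> bool) \<Rightarrow> 'u scat \<Rightarrow> 'u set \<Rightarrow> 'u sfunc" where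
  "cylinder_in le K A = \<lparr>FSrc = K, FTgt = partial_cylinder le K A,
     FObj = (\<lambda>k \<in> Obj K. upair k (utag True)),
     FArr = (\<lambda>f \<in> Arr K. upair (upair (upair (Dom K f) (utag True)) (upair (Cod K f) (utag True))) f)\<rparr>"

context
  fixes K :: "'u scat" and A :: "'u set" and le :: "bool \<Rightarrow> bool \<Rightarrow> bool"
  assumes inf: "infinite (UNIV :: 'u set)" and K: "small_cat K" and A: "A \<subseteq> Obj K"
    and reflp: "reflp le" and transp: "transp le"
begin

lemmas rel_refl = reflpD[OF reflp] and rel_trans = transpD[OF transp]

lemma Obj_partial_cylinder: "Obj (partial_cylinder le K A) =
    (\<lambda>k. upair k (utag True)) ` Obj K \<union> (\<lambda>a. upair a (utag False)) ` A"
  by (simp add: partial_cylinder_def)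

lemma hom_partial_cylinder:
  assumes "upair x (utag b) \<in> Obj (partial_cylinder le K A)"
    and "upair y (utag c) \<in> Obj (partial_cylinder le K A)"
  shows "hom (partial_cylinder le K A) (upair x (utag b)) (upair y (utag c)) =
    (if le b c then (\<lambda>h. upair (upair (upair x (utag b)) (upair y (utag c))) h) ` hom K x y else {})"
proof -
  let ?x = "upair x (utag b)" and ?y = "upair y (utag c)"
  have "a \<in> hom (partial_cylinder le K A) ?x ?y \<longleftrightarrow>
      (\<exists>h \<in> hom K x y. le b c \<and> a = upair (upair ?x ?y) h)" for a
    using assms unfolding partial_cylinder_def hom_pairs_cat[OF inf] pairs_cat_simps
      ufst_upair[OF inf] usnd_upair[OF inf] utag_inject[OF inf]
    by (simp only: simp_thms)
  then show ?thesis
    by auto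
qed

lemma small_partial_cylinder: "small_cat (partial_cylinder le K A)"
  unfolding partial_cylinder_def
proof (rule small_pairs_cat[OF inf K])
  let ?Ob = "(\<lambda>k. upair k (utag True)) ` Obj K \<union> (\<lambda>a. upair a (utag False)) ` A"
  show "?Ob \<prec> (UNIV :: 'u set)"
  proof (rule subset_image_lesspoll)
    show "?Ob \<subseteq> (\<lambda>(k, b). upair k (utag b)) ` (Obj K \<times> UNIV)"
      using A by auto
    show "Obj K \<times> (UNIV :: bool set) \<prec> (UNIV :: 'u set)"
      using K by (intro Times_lesspoll inf) (simp_all add: small_cat_def finite_lesspoll_infinite inf)
  qed
qed (use A rel_refl rel_trans in \<open>auto simp: ufst_upair[OF inf]\<close>)

lemma small_cylinder_pr: "small_func (cylinder_pr le K A) (partial_cylinder le K A) K"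
  using small_partial_cylinder A unfolding cylinder_pr_def partial_cylinder_def
  by (intro small_pairs_pr[OF inf K]) (auto simp: ufst_upair[OF inf])

lemma FObj_cylinder_pr:
  "upair x (utag b) \<in> Obj (partial_cylinder le K A) \<Longrightarrow>
    FObj (cylinder_pr le K A) (upair x (utag b)) = x"
  by (simp add: partial_cylinder_def cylinder_pr_def pairs_pr_def ufst_upair[OF inf])

lemma bij_betw_cylinder_pr:
  assumes "upair x (utag b) \<in> Obj (partial_cylinder le K A)"
    and "upair y (utag c) \<in> Obj (partial_cylinder le K A)" and "le b c"
  shows "bij_betw (FArr (cylinder_pr le K A))
    (hom (partial_cylinder le K A) (upair x (utag b)) (upair y (utag c))) (hom K x y)"
proof -
  let ?x = "upair x (utag b)" and ?y = "upair y (utag c)"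
  have "FArr (cylinder_pr le K A) (upair (upair ?x ?y) h) = h" if "h \<in> hom K x y" for h
    unfolding cylinder_pr_def
    by (rule FArr_pairs_pr[OF inf])
      (use hom_partial_cylinder[OF assms(1,2)] that \<open>le b c\<close> in \<open>auto simp: partial_cylinder_def\<close>)
  then show ?thesis
    using \<open>le b c\<close> unfolding hom_partial_cylinder[OF assms(1,2)]
    by (intro bij_betw_byWitness[where f' = "\<lambda>h. upair (upair ?x ?y) h"]) auto
qed

lemma FArr_cylinder_in: "f \<in> hom K x y \<Longrightarrow> FArr (cylinder_in le K A) f
    = upair (upair (upair x (utag True)) (upair y (utag True))) f"
  by (simp add: cylinder_in_def hom_iff)

lemma FObj_cylinder_in: "k \<in> Obj K \<Longrightarrow> FObj (cylinder_in le K A) k = upair k (utag True)"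
  by (simp add: cylinder_in_def)

lemma small_cylinder_in: "small_func (cylinder_in le K A) K (partial_cylinder le K A)"
  unfolding small_func_def
proof (intro conjI K small_partial_cylinder functorI)
  note cK = small_catD[OF K]
  show "category K" "category (partial_cylinder le K A)"
    by (rule cK small_catD[OF small_partial_cylinder])+
  have obj: "upair k (utag True) \<in> Obj (partial_cylinder le K A)" if "k \<in> Obj K" for k
    using that by (simp add: Obj_partial_cylinder)
  have hom: "upair (upair (upair x (utag True)) (upair y (utag True))) f \<in>
      hom (partial_cylinder le K A) (upair x (utag True)) (upair y (utag True))"
    if "f \<in> hom K x y" for f x y
    using that hom_partial_cylinder[OF obj obj] hom_obj[OF cK that] rel_refl by auto
  fix f g x y z assume f: "f \<in> hom K x y" and g: "g \<in> hom K y z"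
  show "FArr (cylinder_in le K A) (Cmp K g f)
      = Cmp (partial_cylinder le K A) (FArr (cylinder_in le K A) g) (FArr (cylinder_in le K A) f)"
    unfolding FArr_cylinder_in[OF f] FArr_cylinder_in[OF g] FArr_cylinder_in[OF Cmp_hom[OF cK f g]]
    unfolding partial_cylinder_def
    by (rule Cmp_pairs_cat[OF inf hom[OF f, unfolded partial_cylinder_def]
          hom[OF g, unfolded partial_cylinder_def], symmetric])
next
  note cK = small_catD[OF K]
  fix f x y assume f: "f \<in> hom K x y"
  show "FArr (cylinder_in le K A) f \<in>
      hom (partial_cylinder le K A) (FObj (cylinder_in le K A) x) (FObj (cylinder_in le K A) y)"
    using f hom_obj[OF cK f] rel_refl
    by (simp add: FArr_cylinder_in[OF f] FObj_cylinder_in hom_partial_cylinder Obj_partial_cylinder)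
next
  note cK = small_catD[OF K]
  fix x assume x: "x \<in> Obj K"
  show "FArr (cylinder_in le K A) (Ide K x) = Ide (partial_cylinder le K A) (FObj (cylinder_in le K A) x)"
    using x unfolding FArr_cylinder_in[OF Ide_hom[OF cK x]] FObj_cylinder_in[OF x]
    by (simp add: partial_cylinder_def pairs_cat_def Let_def ufst_upair[OF inf])
qed (simp_all add: cylinder_in_def Obj_partial_cylinder)

lemma cylinder_pr_in: "cylinder_pr le K A \<circ>\<^sub>F cylinder_in le K A = id_func K"
proof (rule functor_eqI)
  note z = small_funcD(1)[OF small_cylinder_in] and cK = small_catD[OF K]
  have obj: "upair k (utag True) \<in> Obj (partial_cylinder le K A)" if "k \<in> Obj K" for k
    using that by (simp add: Obj_partial_cylinder)
  show "functor_between (cylinder_pr le K A \<circ>\<^sub>F cylinder_in le K A) K K"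
    by (rule functor_comp[OF z small_funcD(1)[OF small_cylinder_pr]])
  show "functor_between (id_func K) K K"
    by (rule functor_id_func[OF cK])
  show "FObj (cylinder_pr le K A \<circ>\<^sub>F cylinder_in le K A) x = FObj (id_func K) x" if "x \<in> Obj K" for x
    using that by (simp add: FObj_comp[OF z] FObj_cylinder_in FObj_cylinder_pr obj)
  show "FArr (cylinder_pr le K A \<circ>\<^sub>F cylinder_in le K A) f = FArr (id_func K) f"
    if f: "f \<in> hom K x y" for f x y
  proof -
    have "FArr (cylinder_in le K A) f \<in>
        hom (partial_cylinder le K A) (upair x (utag True)) (upair y (utag True))"
      using functorD(6)[OF z f] hom_obj[OF cK f] by (simp add: FObj_cylinder_in)
    then have "FArr (cylinder_pr le K A) (FArr (cylinder_in le K A) f) = f"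
      unfolding FArr_cylinder_in[OF f] unfolding cylinder_pr_def partial_cylinder_def
      by (rule FArr_pairs_pr[OF inf])
    then show ?thesis
      by (simp only: FArr_comp[OF z f] id_func_simps(4)[OF f])
  qed
qed

lemma cylinder_in_off_image:
  "Obj (partial_cylinder le K A) - FObj (cylinder_in le K A) ` Obj K = (\<lambda>a. upair a (utag False)) ` A"
  by (auto simp: Obj_partial_cylinder FObj_cylinder_in upair_inject[OF inf] utag_inject[OF inf])

lemma fully_faithful_cylinder_in: "fully_faithful (cylinder_in le K A)"
proof -
  note z = small_funcD(1)[OF small_cylinder_in] and cK = small_catD[OF K]
  have "bij_betw (FArr (cylinder_in le K A)) (hom K x y)
      (hom (partial_cylinder le K A) (FObj (cylinder_in le K A) x) (FObj (cylinder_in le K A) y))"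
    if "x \<in> Obj K" "y \<in> Obj K" for x y
  proof -
    have "hom (partial_cylinder le K A) (upair x (utag True)) (upair y (utag True)) =
        (\<lambda>h. upair (upair (upair x (utag True)) (upair y (utag True))) h) ` hom K x y"
      using that rel_refl by (simp add: hom_partial_cylinder Obj_partial_cylinder)
    moreover have "bij_betw (FArr (cylinder_in le K A)) (hom K x y)
        ((\<lambda>h. upair (upair (upair x (utag True)) (upair y (utag True))) h) ` hom K x y)"
      by (rule bij_betw_cong[THEN iffD2, OF FArr_cylinder_in])
        (simp_all add: bij_betw_def inj_on_def upair_inject[OF inf])
    ultimately show ?thesis
      using that by (simp only: FObj_cylinder_in)
  qed
  then show ?thesis
    using z by (simp add: fully_faithful_def functor_between_def)
qed

lemma sieve_cylinder_in:
  assumes "\<not> le False True"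
  shows "sieve (cylinder_in le K A)"
proof -
  note z = functorD(3,4)[OF small_funcD(1)[OF small_cylinder_in]]
  have "hom (partial_cylinder le K A) x (FObj (cylinder_in le K A) k) = {}"
    if "k \<in> Obj K" "x \<in> Obj (partial_cylinder le K A)" "x \<notin> FObj (cylinder_in le K A) ` Obj K" for k x
  proof -
    have "x \<in> (\<lambda>a. upair a (utag False)) ` A"
      unfolding cylinder_in_off_image[symmetric] using that(2,3) by (rule DiffI)
    then obtain a where a: "a \<in> A" "x = upair a (utag False)"
      by (rule imageE)
    show ?thesis
      using that(1,2) assms unfolding a(2) FObj_cylinder_in[OF that(1)]
      by (subst hom_partial_cylinder) (simp_all add: Obj_partial_cylinder)
  qed
  moreover have "inj_on (FObj (cylinder_in le K A)) (Obj K)"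
    by (rule inj_onI) (simp add: FObj_cylinder_in upair_inject[OF inf])
  ultimately show ?thesis
    unfolding sieve_def z using fully_faithful_cylinder_in by blast
qed

lemma cosieve_cylinder_in:
  assumes "\<not> le True False"
  shows "cosieve (cylinder_in le K A)"
proof -
  note z = functorD(3,4)[OF small_funcD(1)[OF small_cylinder_in]]
  have "hom (partial_cylinder le K A) (FObj (cylinder_in le K A) k) x = {}"
    if "k \<in> Obj K" "x \<in> Obj (partial_cylinder le K A)" "x \<notin> FObj (cylinder_in le K A) ` Obj K" for k x
  proof -
    have "x \<in> (\<lambda>a. upair a (utag False)) ` A"
      unfolding cylinder_in_off_image[symmetric] using that(2,3) by (rule DiffI)
    then obtain a where a: "a \<in> A" "x = upair a (utag False)"
      by (rule imageE)
    show ?thesis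
      using that(1,2) assms unfolding a(2) FObj_cylinder_in[OF that(1)]
      by (subst hom_partial_cylinder) (simp_all add: Obj_partial_cylinder)
  qed
  moreover have "inj_on (FObj (cylinder_in le K A)) (Obj K)"
    by (rule inj_onI) (simp add: FObj_cylinder_in upair_inject[OF inf])
  ultimately show ?thesis
    unfolding cosieve_def z using fully_faithful_cylinder_in by blast
qed

end


section \<open>Derivators\<close>

lemma functor_left_adjoint:
  assumes "adjunction F G \<eta> \<epsilon>" "functor_between G D C"
  shows "functor_between F C D"
  using assms by (simp add: adjunction_def functor_between_def)

locale derivator_over_infinite_universe =
  fixes D :: "('u, 'o, 'a) prederiv"
  assumes inf: "infinite (UNIV :: 'u set)" and derivator: "derivator D"
begin

abbreviation E :: "('o, 'a) cat" where
  "E \<equiv> D0 D term_cat"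

abbreviation ev :: "'u scat \<Rightarrow> 'u \<Rightarrow> ('o, 'a, 'o, 'a) func" where
  "ev K k \<equiv> D1 D (point K k)"

lemma prederivator: "prederivator D" and der1: "der1 D" and der2: "der2 D" and der3: "der3 D"
  and der4: "der4 D"
  using derivator by (simp_all add: derivator_def)

lemma category_D0: "small_cat J \<Longrightarrow> category (D0 D J)"
  using prederivator unfolding prederivator_def by (elim conjE) simp

lemma functor_D1: "small_func u J K \<Longrightarrow> functor_between (D1 D u) (D0 D K) (D0 D J)"
  using prederivator unfolding prederivator_def by (elim conjE) blast

lemma nat_D2:
  "small_func u J K \<Longrightarrow> small_func v J K \<Longrightarrow> nat_between \<alpha> u v \<Longrightarrow>
    nat_between (D2 D \<alpha>) (D1 D u) (D1 D v)"
  using prederivator unfolding prederivator_def by (elim conjE) blast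

lemma D1_id: "small_cat J \<Longrightarrow> D1 D (id_func J) = id_func (D0 D J)"
  using prederivator unfolding prederivator_def by (elim conjE) blast

lemma D1_comp: "small_func u J K \<Longrightarrow> small_func v K L \<Longrightarrow> D1 D (v \<circ>\<^sub>F u) = D1 D u \<circ>\<^sub>F D1 D v"
  using prederivator unfolding prederivator_def by (elim conjE) blast

lemma D2_id: "small_func u J K \<Longrightarrow> D2 D (id_nat u) = id_nat (D1 D u)"
  using prederivator unfolding prederivator_def by (elim conjE) blast

lemma D2_hcomp:
  "small_func u J K \<Longrightarrow> small_func u' J K \<Longrightarrow> small_func v K L \<Longrightarrow> small_func v' K L \<Longrightarrow>
    nat_between \<alpha> u u' \<Longrightarrow> nat_between \<beta> v v' \<Longrightarrow> D2 D (\<beta> \<star> \<alpha>) = D2 D \<alpha> \<star> D2 D \<beta>"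
  using prederivator unfolding prederivator_def by (elim conjE) metis

lemma NCmp_D2_whisker_right:
  assumes u: "small_func u J K" and v: "small_func v K L" and v': "small_func v' K L"
    and \<alpha>: "nat_between \<alpha> v v'" and X: "X \<in> Obj (D0 D L)"
  shows "NCmp (D2 D (\<alpha> \<star> id_nat u)) X = FArr (D1 D u) (NCmp (D2 D \<alpha>) X)"
  unfolding D2_hcomp[OF u u v v' nat_id_nat[OF small_funcD(1)[OF u]] \<alpha>] D2_id[OF u]
  using NCmp_whisker_left[OF functor_D1[OF v] nat_D2[OF v v' \<alpha>] functor_D1[OF u] X]
  by (simp add: whisker_left_def)

lemma NCmp_D2_whisker_left:
  assumes u: "small_func u J K" and u': "small_func u' J K" and v: "small_func v K L"
    and \<alpha>: "nat_between \<alpha> u u'" and X: "X \<in> Obj (D0 D L)"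
  shows "NCmp (D2 D (id_nat v \<star> \<alpha>)) X = NCmp (D2 D \<alpha>) (FObj (D1 D v) X)"
  unfolding D2_hcomp[OF u u' v v \<alpha> nat_id_nat[OF small_funcD(1)[OF v]]] D2_id[OF v]
  using NCmp_whisker_right[OF functor_D1[OF v] functor_D1[OF u] nat_D2[OF u u' \<alpha>] X]
  by (simp add: whisker_right_def)

lemma category_E: "category E"
  by (rule category_D0[OF small_term_cat[OF inf]])

lemma functor_ev: "small_cat K \<Longrightarrow> k \<in> Obj K \<Longrightarrow> functor_between (ev K k) (D0 D K) E"
  by (rule functor_D1[OF small_point[OF inf]])

lemma ev_D1: "small_func u J K \<Longrightarrow> j \<in> Obj J \<Longrightarrow> ev K (FObj u j) = ev J j \<circ>\<^sub>F D1 D u"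
  using comp_point[OF inf] D1_comp[OF small_point[OF inf]] small_funcD(2) by metis

lemma iso_if_iso_at:
  assumes J: "small_cat J" and f: "f \<in> hom (D0 D J) X Y"
    and "\<And>j. j \<in> Obj J \<Longrightarrow> iso E (FArr (ev J j) f)"
  shows "iso (D0 D J) f"
  using assms der2 by (simp add: der2_def hom_iff)


subsection \<open>Evaluation at initial and terminal objects\<close>

lemma to_term_comp_point:
  assumes S: "small_cat (S :: 'u scat)" and t: "t \<in> Obj S"
  shows "to_term S \<circ>\<^sub>F point S t = id_func term_cat"
    "to_term S \<circ>\<^sub>F (point S t \<circ>\<^sub>F to_term S) = to_term S"
proof -
  note p = small_funcD(1)[OF small_to_term[OF inf S]] and pt = small_funcD(1)[OF small_point[OF inf S t]]
    and T = small_term_cat[OF inf]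
  show "to_term S \<circ>\<^sub>F point S t = id_func term_cat"
    unfolding to_term_unique[OF inf functor_comp[OF pt p] T]
      to_term_unique[OF inf functor_id_func[OF small_catD[OF T]] T] ..
  show "to_term S \<circ>\<^sub>F (point S t \<circ>\<^sub>F to_term S) = to_term S"
    by (rule to_term_unique[OF inf functor_comp[OF functor_comp[OF p pt] p] S])
qed

lemma D1_to_term_point:
  assumes S: "small_cat S" and t: "t \<in> Obj S"
  shows "ev S t \<circ>\<^sub>F D1 D (to_term S) = id_func E"
  unfolding D1_comp[OF small_point[OF inf S t] small_to_term[OF inf S], symmetric]
    to_term_comp_point[OF S t] by (rule D1_id[OF small_term_cat[OF inf]])

text \<open>The functor \<open>t : e \<rightarrow> S\<close> is right adjoint to \<open>p : S \<rightarrow> e\<close> with counit the identity of \<open>p \<circ> t\<close>.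
  As \<open>D\<close> reverses functors but not transformations, \<open>t\<^sup>*\<close> is left adjoint to \<open>p\<^sup>*\<close>.  The counit is
  made explicit because it enters the Kan comparison map.\<close>

lemma adjunction_ev_terminal:
  assumes S: "small_cat S" and t: "t \<in> Obj S"
    and fin: "\<And>x. x \<in> Obj S \<Longrightarrow> \<exists>!a. a \<in> hom S x t"
  shows "\<exists>\<eta>. adjunction (ev S t) (D1 D (to_term S)) \<eta> (id_nat (id_func E))"
proof -
  note cS = small_catD[OF S] and p = small_to_term[OF inf S] and pt = small_point[OF inf S t]
    and id = small_id_func[OF S]
  note p' = small_funcD(1)[OF p] and pt' = small_funcD(1)[OF pt] and id' = small_funcD(1)[OF id]
  note ptp = small_comp_func[OF p pt]
  note ptp' = small_funcD(1)[OF ptp]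
  define \<tau> where "\<tau> = \<lparr>NSrc = id_func S, NTgt = point S t \<circ>\<^sub>F to_term S,
    NCmp = (\<lambda>x \<in> Obj S. THE a. a \<in> hom S x t)\<rparr>"
  have \<tau>x: "NCmp \<tau> x \<in> hom S x t" if "x \<in> Obj S" for x
    using theI'[OF fin[OF that]] that by (simp add: \<tau>_def)
  have \<tau>: "nat_between \<tau> (id_func S) (point S t \<circ>\<^sub>F to_term S)"
  proof (rule nat_betweenI[OF id' ptp'])
    fix x assume x: "x \<in> Obj S"
    show "NCmp \<tau> x \<in> hom S (FObj (id_func S) x) (FObj (point S t \<circ>\<^sub>F to_term S) x)"
      using \<tau>x[OF x] by (simp add: x FObj_comp[OF p' x])
  next
    fix f x y assume f: "f \<in> hom S x y"
    note x = hom_obj(1)[OF cS f] and y = hom_obj(2)[OF cS f]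
    have "Cmp S (NCmp \<tau> y) f = Cmp S (Ide S t) (NCmp \<tau> x)"
      using fin[OF x] Cmp_hom[OF cS f \<tau>x[OF y]] Cmp_hom[OF cS \<tau>x[OF x] Ide_hom[OF cS t]] by blast
    then show "Cmp S (NCmp \<tau> y) (FArr (id_func S) f)
        = Cmp S (FArr (point S t \<circ>\<^sub>F to_term S) f) (NCmp \<tau> x)"
      by (simp add: FArr_comp[OF p' f] id_func_simps(4)[OF f])
  qed (simp_all add: \<tau>_def)
  have \<tau>_pt: "\<tau> \<star> id_nat (point S t) = id_nat (point S t)"
  proof (rule nat_eqI[OF _ nat_id_nat[OF pt']])
    have "(point S t \<circ>\<^sub>F to_term S) \<circ>\<^sub>F point S t = point S t"
      by (simp only: comp_func_assoc[OF pt' p' pt', symmetric] to_term_comp_point[OF S t]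
          comp_func_id[OF pt'])
    then show "nat_between (\<tau> \<star> id_nat (point S t)) (point S t) (point S t)"
      using nat_hcomp[OF pt' id' nat_id_nat[OF pt'] \<tau>] by (simp only: comp_func_id[OF pt'])
    fix x assume "x \<in> Obj (FSrc (point S t))"
    then have x: "x = undefined" "x \<in> Obj term_cat" by simp_all
    have "NCmp \<tau> t = Ide S t"
      using fin[OF t] \<tau>x[OF t] Ide_hom[OF cS t] by blast
    then show "NCmp (\<tau> \<star> id_nat (point S t)) x = NCmp (id_nat (point S t)) x"
      using NCmp_whisker_right[OF pt' id' \<tau> x(2)]
      by (simp add: whisker_right_def NCmp_id_nat[OF pt'] x(1))
  qed
  have p_\<tau>: "id_nat (to_term S) \<star> \<tau> = id_nat (to_term S)"
  proof (rule nat_eqI[OF _ nat_id_nat[OF p']])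
    show "nat_between (id_nat (to_term S) \<star> \<tau>) (to_term S) (to_term S)"
      using nat_hcomp[OF id' p' \<tau> nat_id_nat[OF p']]
      by (simp only: to_term_comp_point[OF S t] comp_func_id[OF p'])
    fix x assume "x \<in> Obj (FSrc (to_term S))"
    then have x: "x \<in> Obj S" by (simp add: to_term_def)
    show "NCmp (id_nat (to_term S) \<star> \<tau>) x = NCmp (id_nat (to_term S)) x"
      using NCmp_whisker_left[OF id' \<tau> p' x] by (simp add: whisker_left_def NCmp_id_nat[OF p' x])
  qed
  note F = functor_D1[OF pt] and G = functor_D1[OF p] and idE = functor_id_func[OF category_E]
  have "adjunction (ev S t) (D1 D (to_term S)) (D2 D \<tau>) (id_nat (id_func E))"
  proof (rule adjunctionI[OF F G])
    show "nat_between (D2 D \<tau>) (id_func (D0 D S)) (D1 D (to_term S) \<circ>\<^sub>F ev S t)"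
      using nat_D2[OF id ptp \<tau>] by (simp only: D1_id[OF S] D1_comp[OF p pt])
    show "nat_between (id_nat (id_func E)) (ev S t \<circ>\<^sub>F D1 D (to_term S)) (id_func E)"
      unfolding D1_to_term_point[OF S t] by (rule nat_id_nat[OF idE])
  next
    fix X assume X: "X \<in> Obj (D0 D S)"
    have "FArr (ev S t) (NCmp (D2 D \<tau>) X) = Ide E (FObj (ev S t) X)"
      using NCmp_D2_whisker_right[OF pt id ptp \<tau> X]
      by (simp add: \<tau>_pt D2_id[OF pt] NCmp_id_nat[OF F X])
    then show "Cmp E (NCmp (id_nat (id_func E)) (FObj (ev S t) X)) (FArr (ev S t) (NCmp (D2 D \<tau>) X))
        = Ide E (FObj (ev S t) X)"
      using functorD(5)[OF F X] Cmp_Ide_left[OF category_E Ide_hom[OF category_E]]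
      by (simp add: NCmp_id_nat[OF idE])
  next
    fix Y assume Y: "Y \<in> Obj E"
    let ?G = "D1 D (to_term S)"
    note GY = functorD(5)[OF G Y]
    have "NCmp (D2 D \<tau>) (FObj ?G Y) = Ide (D0 D S) (FObj ?G Y)"
      using NCmp_D2_whisker_left[OF id ptp p \<tau> Y] by (simp add: p_\<tau> D2_id[OF p] NCmp_id_nat[OF G Y])
    then show "Cmp (D0 D S) (FArr ?G (NCmp (id_nat (id_func E)) Y)) (NCmp (D2 D \<tau>) (FObj ?G Y))
        = Ide (D0 D S) (FObj ?G Y)"
      using Y GY Cmp_Ide_left[OF category_D0[OF S] Ide_hom[OF category_D0[OF S] GY]]
      by (simp add: NCmp_id_nat[OF idE] functorD(7)[OF G Y])
  qed
  then show ?thesis by blast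
qed

lemma adjunction_ev_initial:
  assumes S: "small_cat S" and t: "t \<in> Obj S"
    and init: "\<And>x. x \<in> Obj S \<Longrightarrow> \<exists>!a. a \<in> hom S t x"
  shows "\<exists>\<epsilon>. adjunction (D1 D (to_term S)) (ev S t) (id_nat (id_func E)) \<epsilon>"
proof -
  note cS = small_catD[OF S] and p = small_to_term[OF inf S] and pt = small_point[OF inf S t]
    and id = small_id_func[OF S]
  note p' = small_funcD(1)[OF p] and pt' = small_funcD(1)[OF pt] and id' = small_funcD(1)[OF id]
  note ptp = small_comp_func[OF p pt]
  note ptp' = small_funcD(1)[OF ptp]
  define \<tau> where "\<tau> = \<lparr>NSrc = point S t \<circ>\<^sub>F to_term S, NTgt = id_func S,
    NCmp = (\<lambda>x \<in> Obj S. THE a. a \<in> hom S t x)\<rparr>"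
  have \<tau>x: "NCmp \<tau> x \<in> hom S t x" if "x \<in> Obj S" for x
    using theI'[OF init[OF that]] that by (simp add: \<tau>_def)
  have \<tau>: "nat_between \<tau> (point S t \<circ>\<^sub>F to_term S) (id_func S)"
  proof (rule nat_betweenI[OF ptp' id'])
    fix x assume x: "x \<in> Obj S"
    show "NCmp \<tau> x \<in> hom S (FObj (point S t \<circ>\<^sub>F to_term S) x) (FObj (id_func S) x)"
      using \<tau>x[OF x] by (simp add: x FObj_comp[OF p' x])
  next
    fix f x y assume f: "f \<in> hom S x y"
    note x = hom_obj(1)[OF cS f] and y = hom_obj(2)[OF cS f]
    have "Cmp S (NCmp \<tau> y) (Ide S t) = Cmp S f (NCmp \<tau> x)"
      using init[OF y] Cmp_hom[OF cS \<tau>x[OF x] f] Cmp_hom[OF cS Ide_hom[OF cS t] \<tau>x[OF y]] by blast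
    then show "Cmp S (NCmp \<tau> y) (FArr (point S t \<circ>\<^sub>F to_term S) f)
        = Cmp S (FArr (id_func S) f) (NCmp \<tau> x)"
      by (simp add: FArr_comp[OF p' f] id_func_simps(4)[OF f])
  qed (simp_all add: \<tau>_def to_term_def)
  have \<tau>_pt: "\<tau> \<star> id_nat (point S t) = id_nat (point S t)"
  proof (rule nat_eqI[OF _ nat_id_nat[OF pt']])
    have "(point S t \<circ>\<^sub>F to_term S) \<circ>\<^sub>F point S t = point S t"
      by (simp only: comp_func_assoc[OF pt' p' pt', symmetric] to_term_comp_point[OF S t]
          comp_func_id[OF pt'])
    then show "nat_between (\<tau> \<star> id_nat (point S t)) (point S t) (point S t)"
      using nat_hcomp[OF pt' ptp' nat_id_nat[OF pt'] \<tau>] by (simp only: comp_func_id[OF pt'])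
    fix x assume "x \<in> Obj (FSrc (point S t))"
    then have x: "x = undefined" "x \<in> Obj term_cat" by simp_all
    have "NCmp \<tau> t = Ide S t"
      using init[OF t] \<tau>x[OF t] Ide_hom[OF cS t] by blast
    then show "NCmp (\<tau> \<star> id_nat (point S t)) x = NCmp (id_nat (point S t)) x"
      using NCmp_whisker_right[OF pt' ptp' \<tau> x(2)]
      by (simp add: whisker_right_def NCmp_id_nat[OF pt'] x(1))
  qed
  have p_\<tau>: "id_nat (to_term S) \<star> \<tau> = id_nat (to_term S)"
  proof (rule nat_eqI[OF _ nat_id_nat[OF p']])
    show "nat_between (id_nat (to_term S) \<star> \<tau>) (to_term S) (to_term S)"
      using nat_hcomp[OF ptp' p' \<tau> nat_id_nat[OF p']]
      by (simp only: to_term_comp_point[OF S t] comp_func_id[OF p'])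
    fix x assume "x \<in> Obj (FSrc (to_term S))"
    then have x: "x \<in> Obj S" by (simp add: to_term_def)
    show "NCmp (id_nat (to_term S) \<star> \<tau>) x = NCmp (id_nat (to_term S)) x"
      using NCmp_whisker_left[OF ptp' \<tau> p' x] by (simp add: whisker_left_def NCmp_id_nat[OF p' x])
  qed
  note F = functor_D1[OF p] and G = functor_D1[OF pt] and idE = functor_id_func[OF category_E]
  have "adjunction (D1 D (to_term S)) (ev S t) (id_nat (id_func E)) (D2 D \<tau>)"
  proof (rule adjunctionI[OF F G])
    show "nat_between (D2 D \<tau>) (D1 D (to_term S) \<circ>\<^sub>F ev S t) (id_func (D0 D S))"
      using nat_D2[OF ptp id \<tau>] by (simp only: D1_id[OF S] D1_comp[OF p pt])
    show "nat_between (id_nat (id_func E)) (id_func E) (ev S t \<circ>\<^sub>F D1 D (to_term S))"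
      unfolding D1_to_term_point[OF S t] by (rule nat_id_nat[OF idE])
  next
    fix X assume X: "X \<in> Obj (D0 D S)"
    have "FArr (ev S t) (NCmp (D2 D \<tau>) X) = Ide E (FObj (ev S t) X)"
      using NCmp_D2_whisker_right[OF pt ptp id \<tau> X]
      by (simp add: \<tau>_pt D2_id[OF pt] NCmp_id_nat[OF G X])
    then show "Cmp E (FArr (ev S t) (NCmp (D2 D \<tau>) X)) (NCmp (id_nat (id_func E)) (FObj (ev S t) X))
        = Ide E (FObj (ev S t) X)"
      using functorD(5)[OF G X] Cmp_Ide_left[OF category_E Ide_hom[OF category_E]]
      by (simp add: NCmp_id_nat[OF idE])
  next
    fix Y assume Y: "Y \<in> Obj E"
    let ?F = "D1 D (to_term S)"
    note FY = functorD(5)[OF F Y]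
    have "NCmp (D2 D \<tau>) (FObj ?F Y) = Ide (D0 D S) (FObj ?F Y)"
      using NCmp_D2_whisker_left[OF ptp id p \<tau> Y] by (simp add: p_\<tau> D2_id[OF p] NCmp_id_nat[OF F Y])
    then show "Cmp (D0 D S) (NCmp (D2 D \<tau>) (FObj ?F Y)) (FArr ?F (NCmp (id_nat (id_func E)) Y))
        = Ide (D0 D S) (FObj ?F Y)"
      using Y FY Cmp_Ide_left[OF category_D0[OF S] Ide_hom[OF category_D0[OF S] FY]]
      by (simp add: NCmp_id_nat[OF idE] functorD(7)[OF F Y])
  qed
  then show ?thesis by blast
qed


subsection \<open>The pointwise formulas\<close>

text \<open>The fourth axiom at a single object \<open>Y\<close>, with the whiskerings in the comparison map carried out.\<close>

lemma left_kan_map_iso: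
  assumes u: "small_func u J K" and k: "k \<in> Obj K"
    and ul: "adjunction ul (D1 D u) \<eta> \<epsilon>"
    and pl: "adjunction pl (D1 D (to_term (slice u k))) \<eta>' \<epsilon>'"
    and Y: "Y \<in> Obj (D0 D J)"
  defines "\<kappa> \<equiv> Cmp E (NCmp \<epsilon>' (FObj (ev K k) (FObj ul Y)))
    (Cmp E (FArr pl (NCmp (D2 D (slice_nat u k)) (FObj ul Y)))
      (FArr pl (FArr (D1 D (slice_pr u k)) (NCmp \<eta> Y))))"
  shows "iso E \<kappa>"
    and "\<kappa> \<in> hom E (FObj pl (FObj (D1 D (slice_pr u k)) Y)) (FObj (ev K k) (FObj ul Y))"
proof -
  let ?S = "slice u k"
  note J = small_funcD(2)[OF u] and K = small_funcD(3)[OF u]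
  note pr = small_slice(2)[OF inf u k] and S = small_slice(1)[OF inf u k]
  note p = small_to_term[OF inf S] and pt = small_point[OF inf K k]
  let ?ul = "FObj ul Y" and ?pr = "D1 D (slice_pr u k)" and ?u = "D1 D u" and ?k = "ev K k"
    and ?p = "D1 D (to_term ?S)" and ?\<alpha> = "D2 D (slice_nat u k)"
  note Fu = functor_D1[OF u] and Fpr = functor_D1[OF pr] and Fp = functor_D1[OF p] and Fk = functor_D1[OF pt]
  note Ful = functor_left_adjoint[OF ul Fu] and Fpl = functor_left_adjoint[OF pl Fp]
  note Au = adjunctionD[OF ul Ful] and Ap = adjunctionD[OF pl Fpl]
  note idJ = functor_id_func[OF category_D0[OF J]]
  note ulY = functorD(5)[OF Ful Y]
  have \<alpha>: "nat_between ?\<alpha> (?pr \<circ>\<^sub>F ?u) (?p \<circ>\<^sub>F ?k)"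
    using nat_D2[OF small_comp_func[OF pr u] small_comp_func[OF p pt] nat_slice_nat[OF inf u k]]
    by (simp only: D1_comp[OF pr u] D1_comp[OF p pt])
  note F\<alpha> = functor_comp[OF Fu Fpr]
  let ?m = "left_kan_map D u k ul \<eta> pl \<epsilon>'"
  have tgt: "FTgt u = K"
    by (rule functorD(4)[OF small_funcD(1)[OF u]])
  have src: "NSrc ?m = (pl \<circ>\<^sub>F ?pr) \<circ>\<^sub>F id_func (D0 D J)"
    using nat_betweenD(2)[OF Au(2) idJ] by (simp add: left_kan_map_def vcomp_def whisker_left_def hcomp_def id_nat_def)
  note Fsrc = functor_comp[OF idJ functor_comp[OF Fpr Fpl]]
  have 1: "NCmp ((pl \<circ>\<^sub>F ?pr) \<rhd> \<eta>) Y = FArr pl (FArr ?pr (NCmp \<eta> Y))"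
    unfolding NCmp_whisker_left[OF idJ Au(2) functor_comp[OF Fpr Fpl] Y]
    by (rule FArr_comp[OF Fpr Au(4)[OF Y]])
  have 2: "NCmp (pl \<rhd> (?\<alpha> \<lhd> ul)) Y = FArr pl (NCmp ?\<alpha> ?ul)"
    by (simp only: NCmp_whisker_left[OF functor_comp[OF Ful F\<alpha>] nat_whisker_right[OF Ful F\<alpha> \<alpha>] Fpl Y]
        NCmp_whisker_right[OF Ful F\<alpha> \<alpha> Y])
  have 3: "NCmp (\<epsilon>' \<lhd> (?k \<circ>\<^sub>F ul)) Y = NCmp \<epsilon>' (FObj ?k ?ul)"
    by (simp only: NCmp_whisker_right[OF functor_comp[OF Ful Fk] functor_comp[OF Fp Fpl] Ap(3) Y]
        FObj_comp[OF Ful Y])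
  have src': "NSrc ((pl \<circ>\<^sub>F ?pr) \<rhd> \<eta>) = NSrc ?m" "NSrc ((pl \<rhd> (?\<alpha> \<lhd> ul)) \<bullet> ((pl \<circ>\<^sub>F ?pr) \<rhd> \<eta>)) = NSrc ?m"
    by (simp_all add: left_kan_map_def vcomp_def)
  have "NCmp ?m Y = \<kappa>"
    unfolding left_kan_map_def tgt \<kappa>_def 1[symmetric] 2[symmetric] 3[symmetric]
    using Y functorD(3,4)[OF Fsrc] src' src by (simp add: vcomp_def)
  moreover have "is_nat_iso ?m"
    using der4 u k ul pl unfolding der4_def by blast
  ultimately show "iso E \<kappa>"
    using Y functorD(3,4)[OF Fsrc] by (auto simp: is_nat_iso_def src)
  have h1: "FArr pl (FArr ?pr (NCmp \<eta> Y)) \<in>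
      hom E (FObj pl (FObj ?pr Y)) (FObj pl (FObj ?pr (FObj ?u ?ul)))"
    by (rule functorD(6)[OF Fpl functorD(6)[OF Fpr Au(4)[OF Y]]])
  have h2: "FArr pl (NCmp ?\<alpha> ?ul) \<in> hom E (FObj pl (FObj ?pr (FObj ?u ?ul))) (FObj pl (FObj ?p (FObj ?k ?ul)))"
    using functorD(6)[OF Fpl nat_betweenD(4)[OF \<alpha> F\<alpha> ulY]] by (simp only: FObj_comp[OF Fu ulY] FObj_comp[OF Fk ulY])
  have h3: "NCmp \<epsilon>' (FObj ?k ?ul) \<in> hom E (FObj pl (FObj ?p (FObj ?k ?ul))) (FObj ?k ?ul)"
    by (rule Ap(5)[OF functorD(5)[OF Fk ulY]])
  show "\<kappa> \<in> hom E (FObj pl (FObj ?pr Y)) (FObj ?k ?ul)"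
    unfolding \<kappa>_def by (rule Cmp_hom[OF category_E Cmp_hom[OF category_E h1 h2] h3])
qed

lemma right_kan_map_iso:
  assumes u: "small_func u J K" and k: "k \<in> Obj K"
    and ur: "adjunction (D1 D u) ur \<eta> \<epsilon>"
    and pr: "adjunction (D1 D (to_term (coslice u k))) pr \<eta>' \<epsilon>'"
    and Y: "Y \<in> Obj (D0 D J)"
  defines "\<kappa> \<equiv> Cmp E (FArr pr (FArr (D1 D (coslice_pr u k)) (NCmp \<epsilon> Y)))
    (Cmp E (FArr pr (NCmp (D2 D (coslice_nat u k)) (FObj ur Y)))
      (NCmp \<eta>' (FObj (ev K k) (FObj ur Y))))"
  shows "iso E \<kappa>"
    and "\<kappa> \<in> hom E (FObj (ev K k) (FObj ur Y)) (FObj pr (FObj (D1 D (coslice_pr u k)) Y))"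
proof -
  let ?S = "coslice u k"
  note J = small_funcD(2)[OF u] and K = small_funcD(3)[OF u]
  note q = small_coslice(2)[OF inf u k] and S = small_coslice(1)[OF inf u k]
  note p = small_to_term[OF inf S] and pt = small_point[OF inf K k]
  let ?ur = "FObj ur Y" and ?q = "D1 D (coslice_pr u k)" and ?u = "D1 D u" and ?k = "ev K k"
    and ?p = "D1 D (to_term ?S)" and ?\<alpha> = "D2 D (coslice_nat u k)"
  note Fu = functor_D1[OF u] and Fq = functor_D1[OF q] and Fp = functor_D1[OF p] and Fk = functor_D1[OF pt]
  note Au = adjunctionD[OF ur Fu] and Ap = adjunctionD[OF pr Fp]
  note Fur = Au(1) and Fpr = Ap(1)
  note idE = functor_id_func[OF category_E]
  note urY = functorD(5)[OF Fur Y]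
  have \<alpha>: "nat_between ?\<alpha> (?p \<circ>\<^sub>F ?k) (?q \<circ>\<^sub>F ?u)"
    using nat_D2[OF small_comp_func[OF p pt] small_comp_func[OF q u] nat_coslice_nat[OF inf u k]]
    by (simp only: D1_comp[OF q u] D1_comp[OF p pt])
  note F\<alpha> = functor_comp[OF Fk Fp]
  let ?m = "right_kan_map D u k ur \<epsilon> pr \<eta>'"
  have tgt: "FTgt u = K"
    by (rule functorD(4)[OF small_funcD(1)[OF u]])
  have src: "NSrc ?m = id_func E \<circ>\<^sub>F (?k \<circ>\<^sub>F ur)"
    using nat_betweenD(2)[OF Ap(2) idE] by (simp add: right_kan_map_def vcomp_def whisker_right_def hcomp_def id_nat_def tgt)
  note Fsrc = functor_comp[OF functor_comp[OF Fur Fk] idE]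
  have 1: "NCmp ((pr \<circ>\<^sub>F ?q) \<rhd> \<epsilon>) Y = FArr pr (FArr ?q (NCmp \<epsilon> Y))"
    unfolding NCmp_whisker_left[OF functor_comp[OF Fur Fu] Au(3) functor_comp[OF Fq Fpr] Y]
    by (rule FArr_comp[OF Fq Au(5)[OF Y]])
  have 2: "NCmp (pr \<rhd> (?\<alpha> \<lhd> ur)) Y = FArr pr (NCmp ?\<alpha> ?ur)"
    by (simp only: NCmp_whisker_left[OF functor_comp[OF Fur F\<alpha>] nat_whisker_right[OF Fur F\<alpha> \<alpha>] Fpr Y]
        NCmp_whisker_right[OF Fur F\<alpha> \<alpha> Y])
  have 3: "NCmp (\<eta>' \<lhd> (?k \<circ>\<^sub>F ur)) Y = NCmp \<eta>' (FObj ?k ?ur)"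
    by (simp only: NCmp_whisker_right[OF functor_comp[OF Fur Fk] idE Ap(2) Y]
        FObj_comp[OF Fur Y])
  have src': "NSrc (\<eta>' \<lhd> (?k \<circ>\<^sub>F ur)) = NSrc ?m" "NSrc ((pr \<rhd> (?\<alpha> \<lhd> ur)) \<bullet> (\<eta>' \<lhd> (?k \<circ>\<^sub>F ur))) = NSrc ?m"
    by (simp_all add: right_kan_map_def vcomp_def tgt)
  have "NCmp ?m Y = \<kappa>"
    unfolding right_kan_map_def tgt \<kappa>_def 1[symmetric] 2[symmetric] 3[symmetric]
    using Y functorD(3,4)[OF Fsrc] src' src by (simp add: vcomp_def)
  moreover have "is_nat_iso ?m"
    using der4 u k ur pr unfolding der4_def by blast
  ultimately show "iso E \<kappa>"
    using Y functorD(3,4)[OF Fsrc] by (auto simp: is_nat_iso_def src)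
  have h1: "FArr pr (FArr ?q (NCmp \<epsilon> Y)) \<in>
      hom E (FObj pr (FObj ?q (FObj ?u ?ur))) (FObj pr (FObj ?q Y))"
    by (rule functorD(6)[OF Fpr functorD(6)[OF Fq Au(5)[OF Y]]])
  have h2: "FArr pr (NCmp ?\<alpha> ?ur) \<in> hom E (FObj pr (FObj ?p (FObj ?k ?ur))) (FObj pr (FObj ?q (FObj ?u ?ur)))"
    using functorD(6)[OF Fpr nat_betweenD(4)[OF \<alpha> F\<alpha> urY]] by (simp only: FObj_comp[OF Fu urY] FObj_comp[OF Fk urY])
  have h3: "NCmp \<eta>' (FObj ?k ?ur) \<in> hom E (FObj ?k ?ur) (FObj pr (FObj ?p (FObj ?k ?ur)))"
    by (rule Ap(4)[OF functorD(5)[OF Fk urY]])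
  show "\<kappa> \<in> hom E (FObj ?k ?ur) (FObj pr (FObj ?q Y))"
    unfolding \<kappa>_def by (rule Cmp_hom[OF category_E Cmp_hom[OF category_E h3 h2] h1])
qed

text \<open>The slice over \<open>u j\<close> has the terminal object \<open>t = (j, id)\<close>, so evaluation at \<open>t\<close> may be taken for
  \<open>p\<^sub>!\<close>, with identity counit.  For this choice the comparison map
  \<open>p\<^sub>! pr\<^sup>* Y \<rightarrow> (u\<^sub>! Y)\<^sub>u\<^sub>j\<close> is literally the value of the unit at \<open>j\<close>.\<close>

lemma unit_iso_at:
  assumes u: "small_func u J K" and ul: "adjunction ul (D1 D u) \<eta> \<epsilon>" and j: "j \<in> Obj J"
    and bij: "\<And>j'. j' \<in> Obj J \<Longrightarrow> bij_betw (FArr u) (hom J j' j) (hom K (FObj u j') (FObj u j))"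
    and Y: "Y \<in> Obj (D0 D J)"
  shows "iso E (FArr (ev J j) (NCmp \<eta> Y))"
proof -
  define k where "k = FObj u j"
  define t where "t = upair j (Ide K k)"
  note u' = small_funcD(1)[OF u] and J = small_funcD(2)[OF u] and K = small_funcD(3)[OF u]
  have k: "k \<in> Obj K"
    using functorD(5)[OF u' j] by (simp add: k_def)
  note S = small_slice(1)[OF inf u k] and pr = small_slice(2)[OF inf u k]
  note pr' = small_funcD(1)[OF pr] and p = small_to_term[OF inf S] and pt = small_point[OF inf K k]
  have t: "t \<in> Obj (slice u k)" "\<And>x. x \<in> Obj (slice u k) \<Longrightarrow> \<exists>!a. a \<in> hom (slice u k) x t"
    unfolding t_def k_def by (rule slice_terminal[OF inf u j bij]; assumption)+
  note ptt = small_point[OF inf S t(1)]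
  note ptt' = small_funcD(1)[OF ptt] and pt' = small_funcD(1)[OF pt] and p' = small_funcD(1)[OF p]
  obtain \<tau> where pl: "adjunction (ev (slice u k) t) (D1 D (to_term (slice u k))) \<tau> (id_nat (id_func E))"
    using adjunction_ev_terminal[OF S t] by blast
  have pr_t: "FObj (slice_pr u k) t = j"
    using t(1) by (simp add: slice_pr_def t_def ufst_upair[OF inf])
  have ev_t: "ev (slice u k) t \<circ>\<^sub>F D1 D (slice_pr u k) = ev J j"
    using ev_D1[OF pr t(1)] pr_t by simp
  note Fu = functor_D1[OF u] and Ft = functor_D1[OF ptt] and Fpr = functor_D1[OF pr] and Fk = functor_D1[OF pt]
  note Ful = functor_left_adjoint[OF ul Fu]
  note ulY = functorD(5)[OF Ful Y] and \<eta>Y = adjunctionD(4)[OF ul Ful Y]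
  \<comment> \<open>At the terminal object, the comparison 2-cell of the slice square is the identity.\<close>
  have "slice_nat u k \<star> id_nat (point (slice u k) t) = id_nat (point K k)"
  proof (rule nat_eqI[OF _ nat_id_nat[OF pt']])
    have "(u \<circ>\<^sub>F slice_pr u k) \<circ>\<^sub>F point (slice u k) t = point K k"
      using comp_point[OF inf small_comp_func[OF pr u] t(1)] by (simp only: FObj_comp[OF pr' t(1)] pr_t k_def[symmetric])
    moreover have "(point K k \<circ>\<^sub>F to_term (slice u k)) \<circ>\<^sub>F point (slice u k) t = point K k"
      using comp_point[OF inf small_comp_func[OF p pt] t(1)] by (simp add: FObj_comp[OF p' t(1)])
    ultimately show "nat_between (slice_nat u k \<star> id_nat (point (slice u k) t)) (point K k) (point K k)"
      using nat_hcomp[OF ptt' functor_comp[OF pr' u'] nat_id_nat[OF ptt'] nat_slice_nat[OF inf u k]] by simp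
    fix x assume "x \<in> Obj (FSrc (point K k))"
    then have x: "x = undefined" "x \<in> Obj term_cat" by simp_all
    have "NCmp (slice_nat u k) t = Ide K k"
      using t(1) by (simp add: slice_nat_def t_def usnd_upair[OF inf])
    then show "NCmp (slice_nat u k \<star> id_nat (point (slice u k) t)) x = NCmp (id_nat (point K k)) x"
      using NCmp_whisker_right[OF ptt' functor_comp[OF pr' u'] nat_slice_nat[OF inf u k] x(2)]
      by (simp add: whisker_right_def x(1) NCmp_id_nat[OF pt'])
  qed
  then have 2: "FArr (ev (slice u k) t) (NCmp (D2 D (slice_nat u k)) (FObj ul Y))
      = Ide E (FObj (ev K k) (FObj ul Y))"
    using NCmp_D2_whisker_right[OF ptt small_comp_func[OF pr u] small_comp_func[OF p pt]
        nat_slice_nat[OF inf u k] ulY]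
    by (simp add: D2_id[OF pt] NCmp_id_nat[OF Fk ulY])
  have 1: "FArr (ev (slice u k) t) (FArr (D1 D (slice_pr u k)) (NCmp \<eta> Y)) = FArr (ev J j) (NCmp \<eta> Y)"
    using FArr_comp[OF Fpr \<eta>Y, of "ev (slice u k) t"] by (simp add: ev_t)
  have 3: "NCmp (id_nat (id_func E)) (FObj (ev K k) (FObj ul Y)) = Ide E (FObj (ev K k) (FObj ul Y))"
    using functorD(5)[OF Fk ulY] by (simp add: NCmp_id_nat[OF functor_id_func[OF category_E]])
  have "FArr (ev J j) (NCmp \<eta> Y) \<in> hom E (FObj (ev J j) Y) (FObj (ev K k) (FObj ul Y))"
    using functorD(6)[OF functor_ev[OF J j] \<eta>Y] FObj_comp[OF Fu ulY, of "ev J j"]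
    by (simp add: k_def ev_D1[OF u j])
  note 4 = Cmp_Ide_left[OF category_E this]
  show ?thesis
    using left_kan_map_iso(1)[OF u k ul pl Y] by (simp only: 1 2 3 4)
qed

lemma counit_iso_at:
  assumes u: "small_func u J K" and ur: "adjunction (D1 D u) ur \<eta> \<epsilon>" and j: "j \<in> Obj J"
    and bij: "\<And>j'. j' \<in> Obj J \<Longrightarrow> bij_betw (FArr u) (hom J j j') (hom K (FObj u j) (FObj u j'))"
    and Y: "Y \<in> Obj (D0 D J)"
  shows "iso E (FArr (ev J j) (NCmp \<epsilon> Y))"
proof -
  define k where "k = FObj u j"
  define t where "t = upair j (Ide K k)"
  note u' = small_funcD(1)[OF u] and J = small_funcD(2)[OF u] and K = small_funcD(3)[OF u]
  have k: "k \<in> Obj K"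
    using functorD(5)[OF u' j] by (simp add: k_def)
  note S = small_coslice(1)[OF inf u k] and pr = small_coslice(2)[OF inf u k]
  note pr' = small_funcD(1)[OF pr] and p = small_to_term[OF inf S] and pt = small_point[OF inf K k]
  have t: "t \<in> Obj (coslice u k)" "\<And>x. x \<in> Obj (coslice u k) \<Longrightarrow> \<exists>!a. a \<in> hom (coslice u k) t x"
    unfolding t_def k_def by (rule coslice_initial[OF inf u j bij]; assumption)+
  note ptt = small_point[OF inf S t(1)]
  note ptt' = small_funcD(1)[OF ptt] and pt' = small_funcD(1)[OF pt] and p' = small_funcD(1)[OF p]
  obtain \<tau> where pa: "adjunction (D1 D (to_term (coslice u k))) (ev (coslice u k) t) (id_nat (id_func E)) \<tau>"
    using adjunction_ev_initial[OF S t] by blast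
  have pr_t: "FObj (coslice_pr u k) t = j"
    using t(1) by (simp add: coslice_pr_def t_def ufst_upair[OF inf])
  have ev_t: "ev (coslice u k) t \<circ>\<^sub>F D1 D (coslice_pr u k) = ev J j"
    using ev_D1[OF pr t(1)] pr_t by simp
  note Fu = functor_D1[OF u] and Ft = functor_D1[OF ptt] and Fpr = functor_D1[OF pr] and Fk = functor_D1[OF pt]
  note Fur = adjunctionD(1)[OF ur Fu]
  note urY = functorD(5)[OF Fur Y] and \<epsilon>Y = adjunctionD(5)[OF ur Fu Y]
  note F\<alpha> = functor_comp[OF p' pt']
  have "coslice_nat u k \<star> id_nat (point (coslice u k) t) = id_nat (point K k)"
  proof (rule nat_eqI[OF _ nat_id_nat[OF pt']])
    have "(u \<circ>\<^sub>F coslice_pr u k) \<circ>\<^sub>F point (coslice u k) t = point K k"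
      using comp_point[OF inf small_comp_func[OF pr u] t(1)] by (simp only: FObj_comp[OF pr' t(1)] pr_t k_def[symmetric])
    moreover have "(point K k \<circ>\<^sub>F to_term (coslice u k)) \<circ>\<^sub>F point (coslice u k) t = point K k"
      using comp_point[OF inf small_comp_func[OF p pt] t(1)] by (simp add: FObj_comp[OF p' t(1)])
    ultimately show "nat_between (coslice_nat u k \<star> id_nat (point (coslice u k) t)) (point K k) (point K k)"
      using nat_hcomp[OF ptt' F\<alpha> nat_id_nat[OF ptt'] nat_coslice_nat[OF inf u k]] by simp
    fix x assume "x \<in> Obj (FSrc (point K k))"
    then have x: "x = undefined" "x \<in> Obj term_cat" by simp_all
    have "NCmp (coslice_nat u k) t = Ide K k"
      using t(1) by (simp add: coslice_nat_def t_def usnd_upair[OF inf])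
    then show "NCmp (coslice_nat u k \<star> id_nat (point (coslice u k) t)) x = NCmp (id_nat (point K k)) x"
      using NCmp_whisker_right[OF ptt' F\<alpha> nat_coslice_nat[OF inf u k] x(2)]
      by (simp add: whisker_right_def x(1) NCmp_id_nat[OF pt'])
  qed
  then have 2: "FArr (ev (coslice u k) t) (NCmp (D2 D (coslice_nat u k)) (FObj ur Y))
      = Ide E (FObj (ev K k) (FObj ur Y))"
    using NCmp_D2_whisker_right[OF ptt small_comp_func[OF p pt] small_comp_func[OF pr u]
        nat_coslice_nat[OF inf u k] urY]
    by (simp add: D2_id[OF pt] NCmp_id_nat[OF Fk urY])
  have 1: "FArr (ev (coslice u k) t) (FArr (D1 D (coslice_pr u k)) (NCmp \<epsilon> Y)) = FArr (ev J j) (NCmp \<epsilon> Y)"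
    using FArr_comp[OF Fpr \<epsilon>Y, of "ev (coslice u k) t"] by (simp add: ev_t)
  have 3: "NCmp (id_nat (id_func E)) (FObj (ev K k) (FObj ur Y)) = Ide E (FObj (ev K k) (FObj ur Y))"
    using functorD(5)[OF Fk urY] by (simp add: NCmp_id_nat[OF functor_id_func[OF category_E]])
  have 5: "FArr (ev J j) (NCmp \<epsilon> Y) \<in> hom E (FObj (ev K k) (FObj ur Y)) (FObj (ev J j) Y)"
    using functorD(6)[OF functor_ev[OF J j] \<epsilon>Y] FObj_comp[OF Fu urY, of "ev J j"]
    by (simp add: k_def ev_D1[OF u j])
  note 4 = Cmp_Ide_right[OF category_E this]
  have 6: "Cmp E (Ide E (FObj (ev K k) (FObj ur Y))) (Ide E (FObj (ev K k) (FObj ur Y)))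
      = Ide E (FObj (ev K k) (FObj ur Y))"
    by (rule Cmp_Ide_left[OF category_E Ide_hom[OF category_E functorD(5)[OF Fk urY]]])
  show ?thesis
    using right_kan_map_iso(1)[OF u k ur pa Y] by (simp only: 1 2 3 4 6)
qed

end


section \<open>Pointed derivators\<close>

lemma hom_prod_cat: "hom (prod_cat C D) x y = hom C (fst x) (fst y) \<times> hom D (snd x) (snd y)"
  by (cases x; cases y) (auto simp: prod_cat_def hom_def)

lemma Cmp_prod_cat:
  assumes "f \<in> hom C a b" "g \<in> hom C b c" "f' \<in> hom D a' b'" "g' \<in> hom D b' c'"
  shows "Cmp (prod_cat C D) (g, g') (f, f') = (Cmp C g f, Cmp D g' f')"
  using assms by (simp add: prod_cat_def hom_iff)

lemma iso_prod_cat: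
  assumes f: "f \<in> hom C a b" and g: "g \<in> hom D a' b'" and iso: "iso (prod_cat C D) (f, g)"
    and C: "category C" and D: "category D"
  shows "iso C f" "iso D g"
proof -
  have fg: "(f, g) \<in> hom (prod_cat C D) (a, a') (b, b')"
    using f g by (simp add: hom_prod_cat)
  obtain h where h: "h \<in> hom (prod_cat C D) (b, b') (a, a')"
      "Cmp (prod_cat C D) h (f, g) = Ide (prod_cat C D) (a, a')"
      "Cmp (prod_cat C D) (f, g) h = Ide (prod_cat C D) (b, b')"
    using iso iso_hom_iff[OF fg] by blast
  obtain f' g' where fg': "h = (f', g')" "f' \<in> hom C b a" "g' \<in> hom D b' a'"
    using h(1) by (auto simp: hom_prod_cat)
  have "Ide (prod_cat C D) (a, a') = (Ide C a, Ide D a')" "Ide (prod_cat C D) (b, b') = (Ide C b, Ide D b')"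
    using hom_obj[OF C f] hom_obj[OF D g] by (simp_all add: prod_cat_def)
  then show "iso C f" "iso D g"
    using h(2,3) Cmp_prod_cat[OF f fg'(2) g fg'(3)] Cmp_prod_cat[OF fg'(2) f fg'(3) g]
      fg'(2,3) iso_hom_iff[OF f] iso_hom_iff[OF g] by (auto simp: fg'(1))
qed

lemma coprod_empty:
  "coprod_cat empty_cat empty_cat = empty_cat"
  "coprod_in1 empty_cat empty_cat = id_func empty_cat"
  "coprod_in2 empty_cat empty_cat = id_func empty_cat"
proof -
  show 1: "coprod_cat empty_cat empty_cat = empty_cat"
    by (simp add: coprod_cat_def Let_def empty_cat_def restrict_def)
  show "coprod_in1 empty_cat empty_cat = id_func empty_cat"
      "coprod_in2 empty_cat empty_cat = id_func empty_cat"
    by (simp_all add: coprod_in1_def coprod_in2_def id_func_def 1) (simp_all add: empty_cat_def restrict_def)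
qed

text \<open>Essential surjectivity of the diagonal gives, for any \<open>X\<close> and \<open>Y\<close>, an object isomorphic to both, so
  all objects are connected.  Every endomorphism \<open>f\<close> of \<open>X\<close> is an identity, as \<open>(f, id)\<close> corresponds
  to a single arrow.\<close>

lemma indiscrete_if_diagonal_equivalence:
  assumes C: "category C" and eq: "is_equivalence (pair_func (id_func C) (id_func C))"
    and X: "X \<in> Obj C" and Y: "Y \<in> Obj C"
  shows "\<exists>!f. f \<in> hom C X Y"
proof -
  let ?P = "prod_cat C C" and ?\<Delta> = "pair_func (id_func C) (id_func C)"
  have src: "FSrc ?\<Delta> = C" "FTgt ?\<Delta> = ?P"
    by (simp_all add: pair_func_def)
  have \<Delta>: "functor_between ?\<Delta> C ?P"
    using eq src by (simp add: is_equivalence_def functor_between_def)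
  obtain G \<beta> where G: "functor_between G ?P C" and \<beta>_iso: "is_nat_iso \<beta>"
    and \<beta>: "nat_between \<beta> (?\<Delta> \<circ>\<^sub>F G) (id_func ?P)"
    using eq unfolding is_equivalence_def src by blast
  note \<Delta>G = functor_comp[OF G \<Delta>]
  have \<Delta>_Obj: "FObj ?\<Delta> x = (x, x)" if "x \<in> Obj C" for x
    using that by (simp add: pair_func_def)
  have \<Delta>_Arr: "FArr ?\<Delta> f = (f, f)" if "f \<in> hom C x y" for f x y
    using that id_func_simps(4)[OF that] by (simp add: pair_func_def hom_iff)
  have obj: "(x, y) \<in> Obj ?P" if "x \<in> Obj C" "y \<in> Obj C" for x y
    using that by (simp add: prod_cat_def)
  have comp: "\<exists>Z b c. Z = FObj G (x, y) \<and> NCmp \<beta> (x, y) = (b, c) \<and> b \<in> hom C Z x \<and> c \<in> hom C Z y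
      \<and> iso C b \<and> iso C c" if xy: "x \<in> Obj C" "y \<in> Obj C" for x y
  proof -
    obtain b c where bc: "NCmp \<beta> (x, y) = (b, c)"
      by (cases "NCmp \<beta> (x, y)")
    have "(b, c) \<in> hom ?P (FObj G (x, y), FObj G (x, y)) (x, y)"
      using nat_betweenD(4)[OF \<beta> \<Delta>G obj[OF xy]] obj[OF xy] functorD(5)[OF G obj[OF xy]]
      by (simp add: bc FObj_comp[OF G] \<Delta>_Obj)
    then have homs: "b \<in> hom C (FObj G (x, y)) x" "c \<in> hom C (FObj G (x, y)) y"
      by (simp_all add: hom_prod_cat)
    have "iso ?P (b, c)"
      using \<beta>_iso obj[OF xy] functorD(3,4)[OF \<Delta>G] nat_betweenD(2)[OF \<beta> \<Delta>G]
      by (auto simp: is_nat_iso_def bc[symmetric])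
    then show ?thesis
      using bc homs iso_prod_cat[OF homs _ C C] by blast
  qed
  have connected: "\<exists>f. f \<in> hom C x y" if xy: "x \<in> Obj C" "y \<in> Obj C" for x y
  proof -
    obtain Z b c where b: "b \<in> hom C Z x" "iso C b" and c: "c \<in> hom C Z y"
      using comp[OF xy] by blast
    obtain b' where "b' \<in> hom C x Z"
      using b by (auto simp: iso_hom_iff)
    then show ?thesis
      using Cmp_hom[OF C _ c] by blast
  qed
  \<comment> \<open>By naturality of \<open>\<beta>\<close> at \<open>(f, id)\<close>, its two components conjugate one endomorphism into \<open>f\<close> and
     into the identity.\<close>
  have endo: "f = Ide C x" if f: "f \<in> hom C x x" for f x
  proof -
    have x: "x \<in> Obj C" by (rule hom_obj(1)[OF C f])
    note Ix = Ide_hom[OF C x]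
    obtain Z b c where Z: "Z = FObj G (x, x)" "NCmp \<beta> (x, x) = (b, c)" "b \<in> hom C Z x" "c \<in> hom C Z x"
        "iso C b" "iso C c"
      using comp[OF x x] by blast
    have m: "(f, Ide C x) \<in> hom ?P (x, x) (x, x)"
      using f Ix by (simp add: hom_prod_cat)
    define k where "k = FArr G (f, Ide C x)"
    have k: "k \<in> hom C Z Z"
      using functorD(6)[OF G m] by (simp add: k_def Z(1))
    have "Cmp ?P (b, c) (k, k) = Cmp ?P (f, Ide C x) (b, c)"
      using nat_betweenD(5)[OF \<beta> \<Delta>G m] id_func_simps(4)[OF m] FArr_comp[OF G m, of ?\<Delta>] \<Delta>_Arr[OF k]
      by (simp add: Z(2) k_def)
    then have bk: "Cmp C b k = Cmp C f b" and ck: "Cmp C c k = Cmp C (Ide C x) c"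
      by (simp_all add: Cmp_prod_cat[OF k Z(3) k Z(4)] Cmp_prod_cat[OF Z(3) f Z(4) Ix])
    have "Cmp C c k = Cmp C c (Ide C Z)"
      by (simp only: ck Cmp_Ide_left[OF C Z(4)] Cmp_Ide_right[OF C Z(4)])
    then have "k = Ide C Z"
      by (rule inj_onD[OF bij_betw_imp_inj_on[OF bij_betw_postcomp_iso[OF C Z(4,6)]] _ k
            Ide_hom[OF C hom_obj(1)[OF C k]]])
    then have "Cmp C f b = Cmp C (Ide C x) b"
      by (simp only: bk[symmetric] Cmp_Ide_left[OF C Z(3)] Cmp_Ide_right[OF C Z(3)])
    then show ?thesis
      by (rule inj_onD[OF bij_betw_imp_inj_on[OF bij_betw_precomp_iso[OF C Z(3,5)]] _ f Ix])
  qed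
  have "f = g" if f: "f \<in> hom C X Y" and g: "g \<in> hom C X Y" for f g
  proof -
    obtain c where c: "c \<in> hom C Y X"
      using connected[OF Y X] by blast
    have "f = Cmp C f (Cmp C c g)"
      using endo[OF Cmp_hom[OF C g c]] Cmp_Ide_right[OF C f] by simp
    also have "\<dots> = Cmp C (Cmp C f c) g"
      by (rule Cmp_assoc[OF C g c f])
    also have "\<dots> = g"
      using endo[OF Cmp_hom[OF C c f]] Cmp_Ide_left[OF C g] by simp
    finally show ?thesis .
  qed
  then show ?thesis
    using connected[OF X Y] by blast
qed

context derivator_over_infinite_universe
begin

text \<open>Since \<open>\<emptyset> \<squnion> \<emptyset> = \<emptyset>\<close>, the first axiom turns the diagonal of \<open>D(\<emptyset>)\<close> into an equivalence.\<close>

lemma hom_D0_empty_cat: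
  assumes "X \<in> Obj (D0 D empty_cat)" "Y \<in> Obj (D0 D empty_cat)"
  shows "\<exists>!f. f \<in> hom (D0 D empty_cat) X Y"
proof (rule indiscrete_if_diagonal_equivalence[OF category_D0 _ assms])
  note e = small_empty_cat[OF inf]
  show "small_cat (empty_cat :: 'u scat)" by (rule e)
  have "is_equivalence (pair_func (D1 D (coprod_in1 empty_cat empty_cat)) (D1 D (coprod_in2 empty_cat empty_cat)))"
    using der1 e unfolding der1_def by blast
  then show "is_equivalence (pair_func (id_func (D0 D empty_cat)) (id_func (D0 D empty_cat)))"
    by (simp only: coprod_empty D1_id[OF e])
qed

end

locale pointed_derivator = derivator_over_infinite_universe +
  assumes zero: "\<exists>z. zero_object E z"
begin

text \<open>The slice is empty, so \<open>(u\<^sub>! Y)\<^sub>k\<close> is isomorphic to \<open>p\<^sub>! X\<close> for some \<open>X\<close> in \<open>D(\<emptyset>)\<close>.  There is exactly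
  one arrow between any two objects of \<open>D(\<emptyset>)\<close>, hence \<open>p\<^sub>! X\<close> is initial.\<close>

lemma left_kan_zero:
  assumes u: "small_func u J K" and ul: "adjunction ul (D1 D u) \<eta> \<epsilon>" and k: "k \<in> Obj K"
    and no_arrow: "\<And>j. j \<in> Obj J \<Longrightarrow> hom K (FObj u j) k = {}" and Y: "Y \<in> Obj (D0 D J)"
  shows "zero_object E (FObj (ev K k) (FObj ul Y))"
proof -
  note S = small_slice[OF inf u k]
  have S_empty: "slice u k = empty_cat"
    by (rule empty_slice[OF small_funcD(1)[OF u] no_arrow])
  note p = small_to_term[OF inf S(1)]
  obtain pl \<eta>' \<epsilon>' where pl: "adjunction pl (D1 D (to_term (slice u k))) \<eta>' \<epsilon>'"
    using der3 p unfolding der3_def left_adjoint_def by meson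
  note Fp = functor_D1[OF p]
  note Fpl = functor_left_adjoint[OF pl Fp]
  define X where "X = FObj (D1 D (slice_pr u k)) Y"
  have X: "X \<in> Obj (D0 D (slice u k))"
    unfolding X_def by (rule functorD(5)[OF functor_D1[OF S(2)] Y])
  have "\<exists>!f. f \<in> hom E (FObj pl X) B" if B: "B \<in> Obj E" for B
    unfolding bij_betw_Ex1[OF bij_betw_transpose[OF pl Fpl X B]]
    using hom_D0_empty_cat X functorD(5)[OF Fp B] by (simp add: S_empty)
  then have "zero_object E (FObj pl X)"
    using zero zero_objectI_initial[OF category_E _ functorD(5)[OF Fpl X]] by blast
  then show ?thesis
    using left_kan_map_iso[OF u k ul pl Y] zero_object_iso[OF category_E] unfolding X_def by blast
qed

lemma right_kan_zero:
  assumes u: "small_func u J K" and ur: "adjunction (D1 D u) ur \<eta> \<epsilon>" and k: "k \<in> Obj K"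
    and no_arrow: "\<And>j. j \<in> Obj J \<Longrightarrow> hom K k (FObj u j) = {}" and Y: "Y \<in> Obj (D0 D J)"
  shows "zero_object E (FObj (ev K k) (FObj ur Y))"
proof -
  note S = small_coslice[OF inf u k]
  have S_empty: "coslice u k = empty_cat"
    by (rule empty_coslice[OF small_funcD(1)[OF u] no_arrow])
  note p = small_to_term[OF inf S(1)]
  obtain pr \<eta>' \<epsilon>' where pr: "adjunction (D1 D (to_term (coslice u k))) pr \<eta>' \<epsilon>'"
    using der3 p unfolding der3_def left_adjoint_def by meson
  note Fp = functor_D1[OF p]
  note Fpr = adjunctionD(1)[OF pr Fp]
  define X where "X = FObj (D1 D (coslice_pr u k)) Y"
  have X: "X \<in> Obj (D0 D (coslice u k))"
    unfolding X_def by (rule functorD(5)[OF functor_D1[OF S(2)] Y])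
  have "\<exists>!f. f \<in> hom E B (FObj pr X)" if B: "B \<in> Obj E" for B
    unfolding bij_betw_Ex1[OF bij_betw_transpose[OF pr Fp B X], symmetric]
    using hom_D0_empty_cat X functorD(5)[OF Fp B] by (simp add: S_empty)
  then have "zero_object E (FObj pr X)"
    using zero zero_objectI_terminal[OF category_E _ functorD(5)[OF Fpr X]] by blast
  then show ?thesis
    using right_kan_map_iso[OF u k ur pr Y] zero_object_iso[OF category_E] unfolding X_def by blast
qed


subsection \<open>Extension by zero\<close>

text \<open>All three claims are checked at single objects.  On the image of \<open>i\<close> the unit is invertible
  because \<open>i\<close> is fully faithful, and then so is the counit by the triangle identity; off the image
  there are no arrows from \<open>i\<close>, which makes \<open>i\<^sub>! Y\<close> zero there.\<close>

lemma extension_by_zero_cosieve: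
  assumes i: "small_func i J K" and cosieve: "cosieve i" and il: "adjunction il (D1 D i) \<eta> \<epsilon>"
  shows "Y \<in> Obj (D0 D J) \<Longrightarrow> iso (D0 D J) (NCmp \<eta> Y)"
    and "Y \<in> Obj (D0 D J) \<Longrightarrow> k \<in> Obj K - FObj i ` Obj J \<Longrightarrow>
      zero_object E (FObj (ev K k) (FObj il Y))"
    and "W \<in> Obj (D0 D K) \<Longrightarrow>
      (\<And>k. k \<in> Obj K - FObj i ` Obj J \<Longrightarrow> zero_object E (FObj (ev K k) W)) \<Longrightarrow>
      iso (D0 D K) (NCmp \<epsilon> W)"
proof -
  note i' = small_funcD(1)[OF i] and J = small_funcD(2)[OF i] and K = small_funcD(3)[OF i]
  note Fi = functor_D1[OF i]
  note Fil = functor_left_adjoint[OF il Fi]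
  note A = adjunctionD[OF il Fil]
  show unit: "iso (D0 D J) (NCmp \<eta> Y)" if Y: "Y \<in> Obj (D0 D J)" for Y
  proof (rule iso_if_iso_at[OF J A(4)[OF Y]])
    fix j assume j: "j \<in> Obj J"
    have "bij_betw (FArr i) (hom J j' j) (hom K (FObj i j') (FObj i j))" if "j' \<in> Obj J" for j'
      using cosieve that j by (simp add: cosieve_def fully_faithful_def functorD[OF i'])
    then show "iso E (FArr (ev J j) (NCmp \<eta> Y))"
      by (rule unit_iso_at[OF i il j _ Y])
  qed
  show zero: "zero_object E (FObj (ev K k) (FObj il Y))"
    if Y: "Y \<in> Obj (D0 D J)" and k: "k \<in> Obj K - FObj i ` Obj J" for Y k
  proof (rule left_kan_zero[OF i il _ _ Y])
    show "hom K (FObj i j) k = {}" if "j \<in> Obj J" for j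
      using cosieve k that by (auto simp: cosieve_def functorD[OF i'])
  qed (use k in blast)
  show "iso (D0 D K) (NCmp \<epsilon> W)"
    if W: "W \<in> Obj (D0 D K)" and W0: "\<And>k. k \<in> Obj K - FObj i ` Obj J \<Longrightarrow> zero_object E (FObj (ev K k) W)"
  proof (rule iso_if_iso_at[OF K A(5)[OF W]])
    fix k assume k: "k \<in> Obj K"
    note iW = functorD(5)[OF Fi W]
    show "iso E (FArr (ev K k) (NCmp \<epsilon> W))"
    proof (cases "k \<in> FObj i ` Obj J")
      case True
      then obtain j where j: "j \<in> Obj J" "k = FObj i j" by blast
      have i\<epsilon>: "iso (D0 D J) (FArr (D1 D i) (NCmp \<epsilon> W))"
        by (rule iso_right_inverse[OF category_D0[OF J] A(4)[OF iW] functorD(6)[OF Fi A(5)[OF W]]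
              A(9)[OF W] unit[OF iW]])
      show ?thesis
        unfolding j(2) ev_D1[OF i j(1)] FArr_comp[OF Fi A(5)[OF W]]
        by (rule functor_iso[OF functor_ev[OF J j(1)] functorD(6)[OF Fi A(5)[OF W]] i\<epsilon>])
    next
      case False
      with k have off: "k \<in> Obj K - FObj i ` Obj J" by blast
      show ?thesis
        by (rule iso_between_zero_objects[OF category_E functorD(6)[OF functor_ev[OF K k] A(5)[OF W]]
              zero[OF iW off] W0[OF off]])
    qed
  qed
qed

lemma extension_by_zero_sieve:
  assumes i: "small_func i J K" and sieve: "sieve i" and ir: "adjunction (D1 D i) ir \<eta> \<epsilon>"
  shows "Y \<in> Obj (D0 D J) \<Longrightarrow> iso (D0 D J) (NCmp \<epsilon> Y)"
    and "Y \<in> Obj (D0 D J) \<Longrightarrow> k \<in> Obj K - FObj i ` Obj J \<Longrightarrow>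
      zero_object E (FObj (ev K k) (FObj ir Y))"
    and "W \<in> Obj (D0 D K) \<Longrightarrow>
      (\<And>k. k \<in> Obj K - FObj i ` Obj J \<Longrightarrow> zero_object E (FObj (ev K k) W)) \<Longrightarrow>
      iso (D0 D K) (NCmp \<eta> W)"
proof -
  note i' = small_funcD(1)[OF i] and J = small_funcD(2)[OF i] and K = small_funcD(3)[OF i]
  note Fi = functor_D1[OF i]
  note A = adjunctionD[OF ir Fi]
  show counit: "iso (D0 D J) (NCmp \<epsilon> Y)" if Y: "Y \<in> Obj (D0 D J)" for Y
  proof (rule iso_if_iso_at[OF J A(5)[OF Y]])
    fix j assume j: "j \<in> Obj J"
    have "bij_betw (FArr i) (hom J j j') (hom K (FObj i j) (FObj i j'))" if "j' \<in> Obj J" for j'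
      using sieve that j by (simp add: sieve_def fully_faithful_def functorD[OF i'])
    then show "iso E (FArr (ev J j) (NCmp \<epsilon> Y))"
      by (rule counit_iso_at[OF i ir j _ Y])
  qed
  show zero: "zero_object E (FObj (ev K k) (FObj ir Y))"
    if Y: "Y \<in> Obj (D0 D J)" and k: "k \<in> Obj K - FObj i ` Obj J" for Y k
  proof (rule right_kan_zero[OF i ir _ _ Y])
    show "hom K k (FObj i j) = {}" if "j \<in> Obj J" for j
      using sieve k that by (auto simp: sieve_def functorD[OF i'])
  qed (use k in blast)
  show "iso (D0 D K) (NCmp \<eta> W)"
    if W: "W \<in> Obj (D0 D K)" and W0: "\<And>k. k \<in> Obj K - FObj i ` Obj J \<Longrightarrow> zero_object E (FObj (ev K k) W)"
  proof (rule iso_if_iso_at[OF K A(4)[OF W]])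
    fix k assume k: "k \<in> Obj K"
    note iW = functorD(5)[OF Fi W]
    show "iso E (FArr (ev K k) (NCmp \<eta> W))"
    proof (cases "k \<in> FObj i ` Obj J")
      case True
      then obtain j where j: "j \<in> Obj J" "k = FObj i j" by blast
      have i\<eta>: "iso (D0 D J) (FArr (D1 D i) (NCmp \<eta> W))"
        by (rule iso_left_inverse[OF category_D0[OF J] functorD(6)[OF Fi A(4)[OF W]] A(5)[OF iW]
              A(8)[OF W] counit[OF iW]])
      show ?thesis
        unfolding j(2) ev_D1[OF i j(1)] FArr_comp[OF Fi A(4)[OF W]]
        by (rule functor_iso[OF functor_ev[OF J j(1)] functorD(6)[OF Fi A(4)[OF W]] i\<eta>])
    next
      case False
      with k have off: "k \<in> Obj K - FObj i ` Obj J" by blast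
      show ?thesis
        by (rule iso_between_zero_objects[OF category_E functorD(6)[OF functor_ev[OF K k] A(4)[OF W]]
              W0[OF off] zero[OF iW off]])
    qed
  qed
qed


subsection \<open>The additional adjoints\<close>

text \<open>The cylinder \<open>L\<close> adds to \<open>K\<close> an arrow \<open>a \<rightarrow> a'\<close> for every object \<open>a\<close> outside the cosieve; \<open>z\<close> is the
  inclusion of \<open>K\<close>, a sieve, and \<open>r\<close> the retraction \<open>a' \<mapsto> a\<close>.  So \<open>z\<^sub>* X\<close> extends \<open>X\<close> by zero to the
  new objects.  As \<open>r\<close> is bijective on arrows into \<open>a'\<close>, the left Kan extension satisfies
  \<open>(r\<^sub>! z\<^sub>* X)\<^sub>a \<cong> (z\<^sub>* X)\<^sub>a\<^sub>' = 0\<close>, hence \<open>r\<^sub>! z\<^sub>* X\<close> lies in the image of \<open>i\<^sub>!\<close>.  Likewise \<open>r\<^sup>* i\<^sub>! Y\<close>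
  vanishes at \<open>a'\<close>, hence lies in the image of \<open>z\<^sub>*\<close>.\<close>

theorem left_adjoint_of_cosieve_extension:
  assumes i: "small_func i J K" and cosieve: "cosieve i" and il: "left_adjoint il (D1 D i)"
  shows "\<exists>F. left_adjoint F il"
proof -
  note K = small_funcD(3)[OF i] and Fi = functor_D1[OF i]
  obtain \<eta> \<epsilon> where il: "adjunction il (D1 D i) \<eta> \<epsilon>"
    using il unfolding left_adjoint_def by blast
  note Fil = functor_left_adjoint[OF il Fi]
  note ext_i = extension_by_zero_cosieve[OF i cosieve il]
  define A where "A = Obj K - FObj i ` Obj J"
  define le :: "bool \<Rightarrow> bool \<Rightarrow> bool" where "le b c = (c \<longrightarrow> b)" for b c
  define L where "L = partial_cylinder le K A"
  define z where "z = cylinder_in le K A"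
  define r where "r = cylinder_pr le K A"
  have A: "A \<subseteq> Obj K" and le: "reflp le" "transp le"
    by (auto simp: A_def le_def reflp_def transp_def)
  note cyl = inf K A le
  have z: "small_func z K L" and r: "small_func r L K" and rz: "r \<circ>\<^sub>F z = id_func K"
    unfolding z_def r_def L_def
    by (rule small_cylinder_in[OF cyl] small_cylinder_pr[OF cyl] cylinder_pr_in[OF cyl])+
  have z_sieve: "sieve z"
    unfolding z_def by (rule sieve_cylinder_in[OF cyl]) (simp add: le_def)
  have off: "Obj L - FObj z ` Obj K = (\<lambda>a. upair a (utag False)) ` A"
    unfolding z_def L_def by (rule cylinder_in_off_image[OF cyl])
  have a_L: "upair a (utag False) \<in> Obj L" and r_a: "FObj r (upair a (utag False)) = a" if "a \<in> A" for a
  proof -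
    show "upair a (utag False) \<in> Obj L"
      using off that by blast
    then show "FObj r (upair a (utag False)) = a"
      unfolding r_def L_def by (rule FObj_cylinder_pr[OF cyl])
  qed
  have r_bij: "bij_betw (FArr r) (hom L x (upair a (utag False)))
      (hom K (FObj r x) (FObj r (upair a (utag False))))" if a: "a \<in> A" and x: "x \<in> Obj L" for a x
  proof -
    obtain y b where y: "x = upair y (utag b)"
      using x unfolding L_def Obj_partial_cylinder[OF cyl] by blast
    have "FObj r x = y"
      using x unfolding y r_def L_def by (rule FObj_cylinder_pr[OF cyl])
    moreover have "le b False"
      by (simp add: le_def)
    ultimately show ?thesis
      using bij_betw_cylinder_pr[OF cyl x[unfolded L_def y] a_L[OF a, unfolded L_def]]
      by (simp add: r_a[OF a] y flip: r_def L_def)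
  qed
  note Fz = functor_D1[OF z] and Fr = functor_D1[OF r]
  obtain zr \<eta>z \<epsilon>z where zr: "adjunction (D1 D z) zr \<eta>z \<epsilon>z"
    using der3 z unfolding der3_def left_adjoint_def by meson
  obtain rl \<eta>r \<epsilon>r where rl: "adjunction rl (D1 D r) \<eta>r \<epsilon>r"
    using der3 r unfolding der3_def left_adjoint_def by meson
  note Fzr = adjunctionD(1)[OF zr Fz] and Frl = functor_left_adjoint[OF rl Fr]
  note ext_z = extension_by_zero_sieve[OF z z_sieve zr]
  have ev_r: "FObj (ev K a) X = FObj (ev L (upair a (utag False))) (FObj (D1 D r) X)"
    if "a \<in> A" "X \<in> Obj (D0 D K)" for a X
    using ev_D1[OF r a_L[OF that(1)]] FObj_comp[OF Fr that(2)] by (simp add: r_a[OF that(1)])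
  show ?thesis
  proof (rule left_adjoint_of_extension[OF il Fil zr Fz rl Frl _ ext_i(1) ext_z(1)])
    show "D1 D z \<circ>\<^sub>F D1 D r = id_func (D0 D K)"
      unfolding D1_comp[OF z r, symmetric] rz by (rule D1_id[OF K])
  next
    fix Y assume Y: "Y \<in> Obj (D0 D J)"
    note ilY = functorD(5)[OF Fil Y]
    show "iso (D0 D L) (NCmp \<eta>z (FObj (D1 D r) (FObj il Y)))"
    proof (rule ext_z(3)[OF functorD(5)[OF Fr ilY]])
      fix l assume "l \<in> Obj L - FObj z ` Obj K"
      then obtain a where a: "a \<in> A" "l = upair a (utag False)"
        unfolding off by blast
      show "zero_object E (FObj (ev L l) (FObj (D1 D r) (FObj il Y)))"
        using ext_i(2)[OF Y, of a] a(1) unfolding a(2) ev_r[OF a(1) ilY, symmetric] A_def by blast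
    qed
  next
    fix X assume X: "X \<in> Obj (D0 D K)"
    define V where "V = FObj zr X"
    have V: "V \<in> Obj (D0 D L)"
      unfolding V_def by (rule functorD(5)[OF Fzr X])
    note rlV = functorD(5)[OF Frl V]
    have "zero_object E (FObj (ev K k) (FObj rl V))" if "k \<in> Obj K - FObj i ` Obj J" for k
    proof -
      let ?k = "upair k (utag False)"
      have k: "k \<in> A"
        using that by (simp add: A_def)
      have "zero_object E (FObj (ev L ?k) V)"
        unfolding V_def by (rule ext_z(2)[OF X]) (use k off in blast)
      moreover have "iso E (FArr (ev L ?k) (NCmp \<eta>r V))"
        by (rule unit_iso_at[OF r rl a_L[OF k] r_bij[OF k] V])
      moreover have "FArr (ev L ?k) (NCmp \<eta>r V) \<in>
          hom E (FObj (ev L ?k) V) (FObj (ev L ?k) (FObj (D1 D r) (FObj rl V)))"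
        by (rule functorD(6)[OF functor_ev[OF small_funcD(3)[OF z] a_L[OF k]] adjunctionD(4)[OF rl Frl V]])
      ultimately show ?thesis
        using zero_object_iso[OF category_E] ev_r[OF k rlV] by metis
    qed
    then show "iso (D0 D K) (NCmp \<epsilon> (FObj rl (FObj zr X)))"
      using ext_i(3)[OF rlV] by (simp add: V_def)
  qed
qed

text \<open>The same argument with the arrows \<open>a' \<rightarrow> a\<close> reversed: now \<open>z\<close> is a cosieve, and the right adjoint of
  \<open>i\<^sub>*\<close> is \<open>i\<^sup>* r\<^sub>* z\<^sub>!\<close>.\<close>

theorem right_adjoint_of_sieve_extension:
  assumes i: "small_func i J K" and sieve: "sieve i" and ir: "left_adjoint (D1 D i) ir"
  shows "\<exists>G. left_adjoint ir G"
proof -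
  note K = small_funcD(3)[OF i] and Fi = functor_D1[OF i]
  obtain \<eta> \<epsilon> where ir: "adjunction (D1 D i) ir \<eta> \<epsilon>"
    using ir unfolding left_adjoint_def by blast
  note Fir = adjunctionD(1)[OF ir Fi]
  note ext_i = extension_by_zero_sieve[OF i sieve ir]
  define A where "A = Obj K - FObj i ` Obj J"
  define le :: "bool \<Rightarrow> bool \<Rightarrow> bool" where "le b c = (b \<longrightarrow> c)" for b c
  define L where "L = partial_cylinder le K A"
  define z where "z = cylinder_in le K A"
  define r where "r = cylinder_pr le K A"
  have A: "A \<subseteq> Obj K" and le: "reflp le" "transp le"
    by (auto simp: A_def le_def reflp_def transp_def)
  note cyl = inf K A le
  have z: "small_func z K L" and r: "small_func r L K" and rz: "r \<circ>\<^sub>F z = id_func K"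
    unfolding z_def r_def L_def
    by (rule small_cylinder_in[OF cyl] small_cylinder_pr[OF cyl] cylinder_pr_in[OF cyl])+
  have z_cosieve: "cosieve z"
    unfolding z_def by (rule cosieve_cylinder_in[OF cyl]) (simp add: le_def)
  have off: "Obj L - FObj z ` Obj K = (\<lambda>a. upair a (utag False)) ` A"
    unfolding z_def L_def by (rule cylinder_in_off_image[OF cyl])
  have a_L: "upair a (utag False) \<in> Obj L" and r_a: "FObj r (upair a (utag False)) = a" if "a \<in> A" for a
  proof -
    show "upair a (utag False) \<in> Obj L"
      using off that by blast
    then show "FObj r (upair a (utag False)) = a"
      unfolding r_def L_def by (rule FObj_cylinder_pr[OF cyl])
  qed
  have r_bij: "bij_betw (FArr r) (hom L (upair a (utag False)) x)
      (hom K (FObj r (upair a (utag False))) (FObj r x))" if a: "a \<in> A" and x: "x \<in> Obj L" for a x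
  proof -
    obtain y b where y: "x = upair y (utag b)"
      using x unfolding L_def Obj_partial_cylinder[OF cyl] by blast
    have "FObj r x = y"
      using x unfolding y r_def L_def by (rule FObj_cylinder_pr[OF cyl])
    moreover have "le False b"
      by (simp add: le_def)
    ultimately show ?thesis
      using bij_betw_cylinder_pr[OF cyl a_L[OF a, unfolded L_def] x[unfolded L_def y]]
      by (simp add: r_a[OF a] y flip: r_def L_def)
  qed
  note Fz = functor_D1[OF z] and Fr = functor_D1[OF r]
  obtain zl \<eta>z \<epsilon>z where zl: "adjunction zl (D1 D z) \<eta>z \<epsilon>z"
    using der3 z unfolding der3_def left_adjoint_def by meson
  obtain rr \<eta>r \<epsilon>r where rr: "adjunction (D1 D r) rr \<eta>r \<epsilon>r"
    using der3 r unfolding der3_def left_adjoint_def by meson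
  note Fzl = functor_left_adjoint[OF zl Fz] and Frr = adjunctionD(1)[OF rr Fr]
  note ext_z = extension_by_zero_cosieve[OF z z_cosieve zl]
  have ev_r: "FObj (ev K a) X = FObj (ev L (upair a (utag False))) (FObj (D1 D r) X)"
    if "a \<in> A" "X \<in> Obj (D0 D K)" for a X
    using ev_D1[OF r a_L[OF that(1)]] FObj_comp[OF Fr that(2)] by (simp add: r_a[OF that(1)])
  show ?thesis
  proof (rule right_adjoint_of_extension[OF ir Fi zl Fzl rr Fr _ ext_i(1) ext_z(1)])
    show "D1 D z \<circ>\<^sub>F D1 D r = id_func (D0 D K)"
      unfolding D1_comp[OF z r, symmetric] rz by (rule D1_id[OF K])
  next
    fix Y assume Y: "Y \<in> Obj (D0 D J)"
    note irY = functorD(5)[OF Fir Y]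
    show "iso (D0 D L) (NCmp \<epsilon>z (FObj (D1 D r) (FObj ir Y)))"
    proof (rule ext_z(3)[OF functorD(5)[OF Fr irY]])
      fix l assume "l \<in> Obj L - FObj z ` Obj K"
      then obtain a where a: "a \<in> A" "l = upair a (utag False)"
        unfolding off by blast
      show "zero_object E (FObj (ev L l) (FObj (D1 D r) (FObj ir Y)))"
        using ext_i(2)[OF Y, of a] a(1) unfolding a(2) ev_r[OF a(1) irY, symmetric] A_def by blast
    qed
  next
    fix X assume X: "X \<in> Obj (D0 D K)"
    define V where "V = FObj zl X"
    have V: "V \<in> Obj (D0 D L)"
      unfolding V_def by (rule functorD(5)[OF Fzl X])
    note rrV = functorD(5)[OF Frr V]
    have "zero_object E (FObj (ev K k) (FObj rr V))" if "k \<in> Obj K - FObj i ` Obj J" for k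
    proof -
      let ?k = "upair k (utag False)"
      have k: "k \<in> A"
        using that by (simp add: A_def)
      have "zero_object E (FObj (ev L ?k) V)"
        unfolding V_def by (rule ext_z(2)[OF X]) (use k off in blast)
      moreover have "iso E (FArr (ev L ?k) (NCmp \<epsilon>r V))"
        by (rule counit_iso_at[OF r rr a_L[OF k] r_bij[OF k] V])
      moreover have "FArr (ev L ?k) (NCmp \<epsilon>r V) \<in>
          hom E (FObj (ev L ?k) (FObj (D1 D r) (FObj rr V))) (FObj (ev L ?k) V)"
        by (rule functorD(6)[OF functor_ev[OF small_funcD(3)[OF z] a_L[OF k]] adjunctionD(5)[OF rr Fr V]])
      ultimately show ?thesis
        using zero_object_iso[OF category_E] ev_r[OF k rrV] by metis
    qed
    then show "iso (D0 D K) (NCmp \<eta> (FObj rr (FObj zl X)))"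
      using ext_i(3)[OF rrV] by (simp add: V_def)
  qed
qed

end

theorem corollary3p8:
  fixes D :: "('u, 'o, 'a) prederiv"
  assumes "infinite (UNIV :: 'u set)"
    and "pointed D"
  shows "strongly_pointed D"
proof -
  interpret pointed_derivator D
    using assms by unfold_locales (simp_all add: pointed_def)
  show ?thesis
    unfolding strongly_pointed_def
    using derivator left_adjoint_of_cosieve_extension right_adjoint_of_sieve_extension by blast
qed

end
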